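(* Fix $\rho\in[0,1)$, and for each $p\ge1$ let $P_p$ be either the mpCN kernel or the MTpCN kernel (defined in the context) with $p$ proposals and parameter $\rho$. Assume $\Phi:\mathcal X\to\mathbb R$ is globally bounded and globally Lipschitz with respect to $\|\cdot\|$ with constant $L_\Phi$. Let $V$ be any one of the functions $V(x)=\|x\|^k$ with $k\in\mathbb N$; $V(x)=\exp(v\|x\|)$ with $v>0$; or $V(x)=\exp(v\|x\|^2)$ with $v>0$ sufficiently small. Then there exists $\varepsilon_*\in(0,1)$ so that, for any $\varepsilon\in(0,\varepsilon_* )$, there are $\lambda\in(0,1)$ and $n_1\in\mathbb N$ such that for all Borel probability measures $\nu_1,\nu_2$ on $\mathcal X$, $$\sup_{p\ge1}W_{\tilde d_\varepsilon}(\nu_1P_p^n,\nu_2P_p^n)\le\lambda^n\,W_{\tilde d_\varepsilon}(\nu_1,\nu_2)\quad\text{for all } n\ge n_1,$$ where $\tilde d_\varepsilon(x,\tilde x)=\sqrt{d_\varepsilon(x,\tilde x)\,(1+V(x)+V(\tilde x))}$ and $d_\varepsilon(x,\tilde x)=1\wedge\varepsilon^{-1}\|x-\tilde x\|$. Moreover, the parameters $\varepsilon_*,n_1,\lambda$ depend on $\rho,\|\Phi\|_\infty,L_\Phi$ and are bounded independently of the number of proposals $p$.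
   Context: $\mathcal X$ is a separable Hilbert space with norm $\|\cdot\|$; $\mu_0=\mathcal N(0,\mathcal C)$ is the centered Gaussian measure on $\mathcal X$ with covariance operator $\mathcal C$ linear, symmetric, strictly positive-definite and trace-class. For $\rho\in[0,1)$, $Q(x,\cdot)=\mathcal N(\rho x,(1-\rho^2)\mathcal C)$, i.e. the law of $\rho x+\sqrt{1-\rho^2}\,\xi$ with $\xi\sim\mu_0$. mpCN kernel with $p\ge1$ proposals: $$P_p(x_0,dy)=\sum_{j=0}^p\int_{\mathcal X^{p+1}}\frac{e^{-\Phi(x_j)}}{\sum_{l=0}^pe^{-\Phi(x_l)}}\,\delta_{x_j}(dy)\prod_{k=1}^pQ(z,dx_k)\,Q(x_0,dz).$$ MTpCN kernel with $p\ge1$ proposals: $$P_p(x_0,dy)=\sum_{j=1}^p\int_{\mathcal X^{2p-1}}\beta_j\big[\bar\alpha\,\delta_{x_j}(dy)+(1-\bar\alpha)\,\delta_{x_0}(dy)\big]\prod_{k=1}^{p-1}Q(x_j,dz_k)\prod_{m=1}^pQ(x_0,dx_m),$$ with $\beta_j=\dfrac{e^{-\Phi(x_j)}}{\sum_{l=1}^pe^{-\Phi(x_l)}}$ and $\bar\alpha=1\wedge\dfrac{\sum_{l=1}^pe^{-\Phi(x_l)}}{e^{-\Phi(x_0)}+\sum_{l=1}^{p-1}e^{-\Phi(z_l)}}$. For a Markov kernel $P$ and a measure $\nu$, $\nu P(A)=\int P(x,A)\,\nu(dx)$, and $P^n$ is the $n$-step kernel. $W_{\tilde d}(\nu_1,\nu_2)=\inf_\pi\int\tilde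 d(x,y)\,\pi(dx,dy)$, the infimum over all couplings $\pi$ of $\nu_1,\nu_2$. "$v$ sufficiently small" means $0<v\le v_0$ for some $v_0>0$. *)

theory Defs
  imports "HOL-Probability.Probability"
begin

text \<open>
  A separable real Hilbert space is a type of sort \<open>{real_inner, polish_space}\<close>: the metric comes
  from the inner product, is complete, and separability is second countability.
\<close>

definition orthonormal_basis :: "'a::real_inner set \<Rightarrow> bool" where
  "orthonormal_basis E \<longleftrightarrow>
     pairwise orthogonal E \<and> (\<forall>e\<in>E. norm e = 1) \<and> closure (span E) = UNIV"

text \<open>
  Below, \<open>S\<close> is the absolute value of \<open>T\<close>, i.e. the positive operator whose square is the
  adjoint of \<open>T\<close> composed with \<open>T\<close>; the last conjunct says that it has finite trace.
\<close>

definition trace_class :: "('a::real_inner \<Rightarrow> 'a) \<Rightarrow> bool" where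
  "trace_class T \<longleftrightarrow> bounded_linear T \<and>
     (\<exists>S. bounded_linear S \<and>
          (\<forall>x y. inner (S x) y = inner x (S y)) \<and> (\<forall>x. 0 \<le> inner (S x) x) \<and>
          (\<forall>x y. inner (S x) (S y) = inner (T x) (T y)) \<and>
          (\<exists>E. orthonormal_basis E \<and> (\<lambda>e. inner (S e) e) summable_on E))"

text \<open>The normal law on the line with mean \<open>a\<close> and standard deviation \<open>s\<close>, a point mass if \<open>s = 0\<close>.\<close>

definition normal_law :: "real \<Rightarrow> real \<Rightarrow> real measure" where
  "normal_law a s = (if s = 0 then return borel a else density lborel (normal_density a s))"

definition gaussian_measure ::
    "'a::{real_inner, polish_space} \<Rightarrow> ('a \<Rightarrow> 'a) \<Rightarrow> 'a measure \<Rightarrow> bool" where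
  "gaussian_measure m C \<mu> \<longleftrightarrow>
     prob_space \<mu> \<and> sets \<mu> = sets borel \<and>
     (\<forall>u. \<exists>a. \<exists>s\<ge>0. distr \<mu> borel (inner u) = normal_law a s) \<and>
     (\<forall>u. (LINT x|\<mu>. inner u x) = inner u m) \<and>
     (\<forall>u v. (LINT x|\<mu>. inner u (x - m) * inner v (x - m)) = inner (C u) v)"

text \<open>For \<open>\<mu>0 = N(0, C)\<close> this is the kernel \<open>Q(x, \<cdot>) = N(\<rho> x, (1 - \<rho>\<^sup>2) C)\<close>.\<close>

definition pCN :: "real \<Rightarrow> 'a::{real_inner, polish_space} measure \<Rightarrow> 'a \<Rightarrow> 'a measure" where
  "pCN \<rho> \<mu>0 x = distr \<mu>0 borel (\<lambda>\<xi>. \<rho> *\<^sub>R x + sqrt (1 - \<rho>\<^sup>2) *\<^sub>R \<xi>)"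

definition gibbs_weight :: "('a \<Rightarrow> real) \<Rightarrow> nat set \<Rightarrow> (nat \<Rightarrow> 'a) \<Rightarrow> nat \<Rightarrow> real" where
  "gibbs_weight \<Phi> I x j = exp (- \<Phi> (x j)) / (\<Sum>l\<in>I. exp (- \<Phi> (x l)))"

text \<open>
  The kernels are given by their values on Borel sets. The proposals are the coordinates
  \<open>1, \<dots>, p\<close> of a point \<open>x\<close> of a product space; in the first kernel, \<open>x(0 := x0)\<close> adds the current
  state as coordinate \<open>0\<close>.
\<close>

definition mpCN ::
    "real \<Rightarrow> 'a::{real_inner, polish_space} measure \<Rightarrow> ('a \<Rightarrow> real) \<Rightarrow> nat \<Rightarrow> 'a \<Rightarrow> 'a measure" where
  "mpCN \<rho> \<mu>0 \<Phi> p x0 = measure_of UNIV (sets borel) (\<lambda>A.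
     \<Sum>j=0..p. \<integral>\<^sup>+ z. (\<integral>\<^sup>+ x.
        ennreal (gibbs_weight \<Phi> {0..p} (x(0 := x0)) j) * indicator A ((x(0 := x0)) j)
        \<partial>PiM {1..p} (\<lambda>k. pCN \<rho> \<mu>0 z)) \<partial>pCN \<rho> \<mu>0 x0)"

definition mt_accept ::
    "('a \<Rightarrow> real) \<Rightarrow> nat \<Rightarrow> 'a \<Rightarrow> (nat \<Rightarrow> 'a) \<Rightarrow> (nat \<Rightarrow> 'a) \<Rightarrow> real" where
  "mt_accept \<Phi> p x0 x z =
     min 1 ((\<Sum>l=1..p. exp (- \<Phi> (x l))) / (exp (- \<Phi> x0) + (\<Sum>l=1..<p. exp (- \<Phi> (z l)))))"

definition MTpCN ::
    "real \<Rightarrow> 'a::{real_inner, polish_space} measure \<Rightarrow> ('a \<Rightarrow> real) \<Rightarrow> nat \<Rightarrow> 'a \<Rightarrow> 'a measure" where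
  "MTpCN \<rho> \<mu>0 \<Phi> p x0 = measure_of UNIV (sets borel) (\<lambda>A.
     \<Sum>j=1..p. \<integral>\<^sup>+ x. (\<integral>\<^sup>+ z.
        ennreal (gibbs_weight \<Phi> {1..p} x j *
          (mt_accept \<Phi> p x0 x z * indicator A (x j) + (1 - mt_accept \<Phi> p x0 x z) * indicator A x0))
        \<partial>PiM {1..<p} (\<lambda>k. pCN \<rho> \<mu>0 (x j))) \<partial>PiM {1..p} (\<lambda>m. pCN \<rho> \<mu>0 x0))"

text \<open>For a kernel \<open>P\<close> and a measure \<open>\<nu>\<close>, the measure \<open>\<nu> P\<close> is the monadic bind of \<open>\<nu>\<close> and \<open>P\<close>.\<close>

primrec kernel_power :: "('a::topological_space \<Rightarrow> 'a measure) \<Rightarrow> nat \<Rightarrow> 'a \<Rightarrow> 'a measure" where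
  "kernel_power P 0 = (\<lambda>x. return borel x)"
| "kernel_power P (Suc n) = (\<lambda>x. bind (kernel_power P n x) P)"

definition couplings :: "'a::topological_space measure \<Rightarrow> 'a measure \<Rightarrow> ('a \<times> 'a) measure set" where
  "couplings \<nu>1 \<nu>2 = {\<pi>. prob_space \<pi> \<and> sets \<pi> = sets (borel \<Otimes>\<^sub>M borel) \<and>
                        distr \<pi> borel fst = \<nu>1 \<and> distr \<pi> borel snd = \<nu>2}"

definition wasserstein ::
    "('a::topological_space \<Rightarrow> 'a \<Rightarrow> real) \<Rightarrow> 'a measure \<Rightarrow> 'a measure \<Rightarrow> ennreal" where
  "wasserstein d \<nu>1 \<nu>2 = (INF \<pi>\<in>couplings \<nu>1 \<nu>2. \<integral>\<^sup>+ (x, y). ennreal (d x y) \<partial>\<pi>)"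

definition dist_eps :: "real \<Rightarrow> 'a::real_normed_vector \<Rightarrow> 'a \<Rightarrow> real" where
  "dist_eps \<epsilon> x y = min 1 (norm (x - y) / \<epsilon>)"

definition dist_eps_V ::
    "('a::real_normed_vector \<Rightarrow> real) \<Rightarrow> real \<Rightarrow> 'a \<Rightarrow> 'a \<Rightarrow> real" where
  "dist_eps_V V \<epsilon> x y = sqrt (dist_eps \<epsilon> x y * (1 + V x + V y))"

text \<open>
  The exponent \<open>k\<close> is a positive integer: for \<open>k = 0\<close> the function is constant and is no Lyapunov
  function. The bound \<open>v0\<close> makes precise that \<open>v\<close> is sufficiently small in the last family.
\<close>

definition lyapunov_functions :: "real \<Rightarrow> ('a::real_normed_vector \<Rightarrow> real) set" where
  "lyapunov_functions v0 =
     {V. \<exists>k::nat. 1 \<le> k \<and> V = (\<lambda>x. norm x ^ k)} \<union>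
     {V. \<exists>v>0. V = (\<lambda>x. exp (v * norm x))} \<union>
     {V. \<exists>v>0. v \<le> v0 \<and> V = (\<lambda>x. exp (v * (norm x)\<^sup>2))}"

end

theory Submission
  imports Defs
begin

text \<open>
  Run the chain from two states \<open>x\<close> and \<open>y\<close> with the same Gaussian noise, and draw the two selected indices from a
  maximal coupling. Three things happen, with constants that depend neither on the number \<open>p\<close> of proposals nor on more of
  \<open>\<Phi>\<close> than a bound \<open>B\<close> and the Lipschitz constant \<open>L\<close>.

  Common moves contract. All proposals are affine in the current state with factor \<open>\<rho>\<close> or \<open>\<rho>\<^sup>2\<close>, so if both chains
  select the same proposal, the distance shrinks at least by the factor \<open>\<rho>\<close>. A single proposal is selected with
  probability of order \<open>1 / p\<close>, but there are \<open>p\<close> of them, and a common move has probability at least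
  \<open>exp (- 4 * B) / 2\<close>. Applied \<open>N\<close> times, this brings the points of a bounded set within distance \<open>\<epsilon> / 2\<close> with
  positive probability (\<open>coupled_closer\<close>).

  Mismatches are rare. The weights of the proposals change at most by the factor \<open>exp (4 * L * norm (x - y))\<close>, so the
  indices differ with probability at most \<open>8 * L * norm (x - y)\<close>. Below distance \<open>\<epsilon>\<close> this costs at most
  \<open>8 * L * \<epsilon> * dist_eps \<epsilon> x y\<close>, less than common moves gain if \<open>\<epsilon>\<close> is small
  (\<open>coupled_local_contraction\<close>).

  The function \<open>V\<close> has a drift. It is a convex increasing function \<open>g\<close> of the norm, hence
  \<open>g (\<rho> * r + s) \<le> \<rho> * g r + (1 - \<rho>) * g (s / (1 - \<rho>))\<close>. The factor \<open>\<rho>\<close> is not affected by the random selection,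
  and the noise term needs a moment of \<open>\<mu>0\<close> (\<open>kernel_drift\<close>). The moments are finite because
  \<open>exp (t * (norm x)\<^sup>2)\<close> is integrable for some \<open>t > 0\<close>, which follows from the finite trace of the covariance and the
  convexity of \<open>exp\<close> (\<open>gaussian_square_exp_moment\<close>); this \<open>t\<close> determines which exponents \<open>v\<close> are small enough.

  The weak Harris argument combines the three (\<open>weak_Harris_pointwise\<close>): Cauchy-Schwarz separates distance and Lyapunov
  function, points with large \<open>V\<close> gain from the drift, distant points with small \<open>V\<close> gain from common moves, and close
  points gain from the local contraction. Since \<open>n\<close> steps of the coupling applied to a coupling of the initial laws couple
  the final laws, the pointwise contraction carries over to the Wasserstein distance.
\<close>

section \<open>Positive operators and the trace\<close>

text \<open>
  The quadratic polynomial \<open>t \<mapsto> inner (A (x + t y)) (x + t y)\<close> takes no negative value, so its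
  discriminant is not positive.
\<close>

lemma positive_form_Cauchy_Schwarz:
  fixes A :: "'a::real_inner \<Rightarrow> 'a"
  assumes "bounded_linear A"
    and sym: "\<And>x y. inner (A x) y = inner x (A y)"
    and pos: "\<And>x. 0 \<le> inner (A x) x"
  shows "(inner (A x) y)\<^sup>2 \<le> inner (A x) x * inner (A y) y"
proof -
  interpret bounded_linear A by fact
  define a b c where "a = inner (A x) x" and "b = inner (A x) y" and "c = inner (A y) y"
  have quad: "0 \<le> a + 2 * t * b + t\<^sup>2 * c" for t
  proof -
    have "inner (A y) x = b"
      unfolding b_def using sym[of y x] by (simp add: inner_commute)
    then have "inner (A (x + t *\<^sub>R y)) (x + t *\<^sub>R y) = a + 2 * t * b + t\<^sup>2 * c"
      by (simp add: add scaleR a_def b_def c_def inner_add_left inner_add_right power2_eq_square algebra_simps)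
    with pos[of "x + t *\<^sub>R y"] show ?thesis by simp
  qed
  have "b\<^sup>2 \<le> a * c"
  proof (cases "c = 0")
    case True
    have "b = 0"
    proof (rule ccontr)
      assume "b \<noteq> 0"
      have "2 * (- (a + 1) / (2 * b)) * b = - (a + 1)" using \<open>b \<noteq> 0\<close> by simp
      then show False using quad[of "- (a + 1) / (2 * b)"] True by simp
    qed
    then show ?thesis using True by simp
  next
    case False
    then have c: "c > 0" using pos[of y] by (simp add: c_def)
    have "0 \<le> a + 2 * (- b / c) * b + (- b / c)\<^sup>2 * c" by (rule quad)
    also have "\<dots> = a - b\<^sup>2 / c" using c by (simp add: field_simps power2_eq_square)
    finally show ?thesis using c by (simp add: field_simps)
  qed
  then show ?thesis by (simp add: a_def b_def c_def)
qed

text \<open>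
  The exponent one half in the Loewner-Heinz inequality, obtained without a spectral theorem. Let \<open>D = C - S\<close>
  and suppose that \<open>l\<close>, the supremum of \<open>inner (D x) x\<close> over unit vectors, is positive. Cauchy-Schwarz for the
  positive form of \<open>A = l - D\<close> shows that a unit vector nearly attaining \<open>l\<close> is nearly an eigenvector:
  \<open>D x\<close> is close to \<open>l x\<close>. For such \<open>x\<close> the difference of the squares of \<open>norm (C x)\<close> and \<open>norm (S x)\<close>, which is
  \<open>inner (D x) (C x + S x)\<close>, is close to \<open>l * inner x (C x + S x)\<close>, hence positive, against the
  assumption on the squares.
\<close>

lemma sqrt_order_operators:
  fixes C S :: "'a::real_inner \<Rightarrow> 'a"
  assumes C: "bounded_linear C" and S: "bounded_linear S"
    and symC: "\<And>x y. inner (C x) y = inner x (C y)"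
    and symS: "\<And>x y. inner (S x) y = inner x (S y)"
    and posC: "\<And>x. 0 \<le> inner (C x) x"
    and posS: "\<And>x. 0 \<le> inner (S x) x"
    and sq: "\<And>x. inner (C x) (C x) \<le> inner (S x) (S x)"
  shows "inner (C x0) x0 \<le> inner (S x0) x0"
proof (rule ccontr)
  assume neg: "\<not> ?thesis"
  define D where "D x = C x - S x" for x
  have D: "bounded_linear D" unfolding D_def by (intro bounded_linear_sub C S)
  interpret D: bounded_linear D by (rule D)
  have x0: "inner (D x0) x0 > 0"
    using neg by (simp add: D_def inner_diff_left)
  then have "x0 \<noteq> 0" by (auto simp: D.zero)
  obtain KD where KD: "\<And>x. norm (D x) \<le> norm x * KD" using D.bounded by blast
  define U where "U = {inner (D x) x | x. norm x = 1}"
  define l where "l = Sup U"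
  have bdd: "bdd_above U"
  proof (rule bdd_aboveI)
    fix u assume "u \<in> U"
    then obtain x where x: "norm x = 1" "u = inner (D x) x" by (auto simp: U_def)
    have "u \<le> norm (D x) * norm x" unfolding x(2) by (rule norm_cauchy_schwarz)
    also have "\<dots> \<le> KD" using KD[of x] x(1) by simp
    finally show "u \<le> KD" .
  qed
  have scale: "inner (D x) x = (norm x)\<^sup>2 * inner (D (x /\<^sub>R norm x)) (x /\<^sub>R norm x)" if "x \<noteq> 0" for x
    using that by (simp add: D.scaleR field_simps power2_eq_square)
  have le_l: "inner (D x) x \<le> l * (norm x)\<^sup>2" for x
  proof (cases "x = 0")
    case False
    then have "inner (D (x /\<^sub>R norm x)) (x /\<^sub>R norm x) \<in> U"
      unfolding U_def by (intro CollectI exI[of _ "x /\<^sub>R norm x"]) simp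
    then have "inner (D (x /\<^sub>R norm x)) (x /\<^sub>R norm x) \<le> l"
      unfolding l_def by (rule cSup_upper[OF _ bdd])
    then have "(norm x)\<^sup>2 * inner (D (x /\<^sub>R norm x)) (x /\<^sub>R norm x) \<le> (norm x)\<^sup>2 * l"
      by (rule mult_left_mono) simp
    then show ?thesis unfolding scale[OF False] by (simp only: mult.commute)
  qed (simp add: D.zero)
  have l_pos: "l > 0"
  proof -
    have "0 < l * (norm x0)\<^sup>2" using x0 le_l[of x0] by linarith
    then show ?thesis using \<open>x0 \<noteq> 0\<close> by (simp add: zero_less_mult_iff)
  qed
  define A where "A x = l *\<^sub>R x - D x" for x
  have A: "bounded_linear A" unfolding A_def
    by (intro bounded_linear_sub D bounded_linear_scaleR_right)
  interpret A: bounded_linear A by (rule A)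
  obtain KA where KA: "\<And>x. norm (A x) \<le> norm x * KA" "KA > 0" using A.pos_bounded by blast
  have posA: "0 \<le> inner (A x) x" for x
    using le_l[of x] by (simp add: A_def inner_diff_left power2_norm_eq_inner)
  have symA: "inner (A x) y = inner x (A y)" for x y
    using symC[of x y] symS[of x y] by (simp add: A_def D_def inner_diff_left inner_diff_right)
  have A_small: "(norm (A x))\<^sup>2 \<le> KA * inner (A x) x" for x
  proof (cases "A x = 0")
    case False
    then have n: "(norm (A x))\<^sup>2 > 0" by simp
    have "((norm (A x))\<^sup>2)\<^sup>2 = (inner (A x) (A x))\<^sup>2" by (simp add: power2_norm_eq_inner)
    also have "\<dots> \<le> inner (A x) x * inner (A (A x)) (A x)"
      by (rule positive_form_Cauchy_Schwarz[OF A symA posA])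
    also have "\<dots> \<le> inner (A x) x * (KA * (norm (A x))\<^sup>2)"
    proof (rule mult_left_mono[OF _ posA])
      have "inner (A (A x)) (A x) \<le> norm (A (A x)) * norm (A x)" by (rule norm_cauchy_schwarz)
      also have "\<dots> \<le> (norm (A x) * KA) * norm (A x)" by (intro mult_right_mono KA) simp
      finally show "inner (A (A x)) (A x) \<le> KA * (norm (A x))\<^sup>2"
        by (simp add: power2_eq_square mult_ac)
    qed
    finally have "(norm (A x))\<^sup>2 * (norm (A x))\<^sup>2 \<le> (KA * inner (A x) x) * (norm (A x))\<^sup>2"
      by (simp add: power2_eq_square mult_ac)
    then show ?thesis using n by (rule mult_right_le_imp_le)
  next
    case True
    then show ?thesis using posA[of x] KA(2) by simp
  qed
  have T: "bounded_linear (\<lambda>x. C x + S x)" by (intro bounded_linear_add C S)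
  obtain KT where KT: "\<And>x. norm (C x + S x) \<le> norm x * KT" "KT > 0"
    using bounded_linear.pos_bounded[OF T] by blast
  \<comment> \<open>An \<open>x\<close> attaining \<open>l\<close> up to \<open>s\<^sup>2\<close> satisfies \<open>norm (A x) \<le> sqrt KA * s\<close>; this \<open>s\<close> makes the error term at most \<open>l\<^sup>2 / 4\<close>.\<close>
  define s where "s = min (sqrt (l / 2)) (l\<^sup>2 / (4 * KT * sqrt KA))"
  have s: "s > 0" using l_pos KT(2) KA(2) by (simp add: s_def)
  have s_sq: "s\<^sup>2 \<le> l / 2"
  proof -
    have "s\<^sup>2 \<le> (sqrt (l/2))\<^sup>2" using s by (intro power_mono) (auto simp: s_def)
    then show ?thesis using l_pos by simp
  qed
  have "U \<noteq> {}"
  proof -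
    have "norm (x0 /\<^sub>R norm x0) = 1" using \<open>x0 \<noteq> 0\<close> by simp
    then show ?thesis unfolding U_def by blast
  qed
  moreover have "l - s\<^sup>2 < Sup U" using s by (simp add: l_def)
  ultimately obtain u where "u \<in> U" "l - s\<^sup>2 < u"
    using less_cSup_iff[OF _ bdd] by blast
  then obtain x where x: "norm x = 1" "l - s\<^sup>2 < inner (D x) x" by (auto simp: U_def)
  have "inner (A x) x \<le> s\<^sup>2" using x by (simp add: A_def inner_diff_left power2_norm_eq_inner[symmetric])
  then have "(norm (A x))\<^sup>2 \<le> KA * s\<^sup>2" using A_small[of x] KA(2)
    by (meson mult_left_mono less_imp_le order_trans)
  then have "norm (A x) \<le> sqrt (KA * s\<^sup>2)" using real_le_rsqrt by blast
  then have nA: "norm (A x) \<le> sqrt KA * s" using s by (simp add: real_sqrt_mult)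
  have "inner (A x) (C x + S x) \<le> norm (A x) * norm (C x + S x)" by (rule norm_cauchy_schwarz)
  also have "\<dots> \<le> (sqrt KA * s) * KT" using nA KT x(1) KA(2) s
    by (intro mult_mono) (auto simp: KT(1)[of x, simplified x(1), simplified])
  also have "\<dots> \<le> (sqrt KA * (l\<^sup>2 / (4 * KT * sqrt KA))) * KT" using KA(2) KT(2)
    by (intro mult_right_mono mult_left_mono) (auto simp: s_def)
  also have "\<dots> = l\<^sup>2 / 4" using KA(2) KT(2) by (simp add: field_simps)
  finally have up: "inner (A x) (C x + S x) \<le> l\<^sup>2 / 4" .
  have "inner (D x) x \<le> inner x (C x + S x)"
    using posS[of x] by (simp add: D_def inner_diff_left inner_add_right inner_commute[of x])
  then have "l / 2 < inner x (C x + S x)" using x(2) s_sq by linarith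
  then have "l * (l / 2) < l * inner x (C x + S x)" using l_pos by simp
  also have "\<dots> = inner (D x) (C x + S x) + inner (A x) (C x + S x)"
    by (simp add: A_def inner_diff_left)
  also have "inner (D x) (C x + S x) = inner (C x) (C x) - inner (S x) (S x)"
    by (simp add: D_def inner_diff_left inner_add_right inner_commute[of "C x" "S x"])
  also have "\<dots> \<le> 0" using sq[of x] by simp
  finally have "l\<^sup>2 / 2 < inner (A x) (C x + S x)" by (simp add: power2_eq_square)
  moreover have "0 \<le> l\<^sup>2" by simp
  ultimately show False using up by linarith
qed

text \<open>
  The absolute value \<open>S\<close> has finite trace by definition, and it dominates \<open>C\<close> because the two positive operators
  have the same square.
\<close>

lemma trace_class_summable:
  fixes C :: "'a::real_inner \<Rightarrow> 'a"
  assumes tc: "trace_class C" and sym: "\<And>x y. inner (C x) y = inner x (C y)"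
    and pos: "\<And>x. 0 \<le> inner (C x) x"
  obtains E where "orthonormal_basis E" "(\<lambda>e. inner (C e) e) summable_on E"
proof -
  obtain S E where S: "bounded_linear C" "bounded_linear S" "\<And>x y. inner (S x) y = inner x (S y)"
      "\<And>x. 0 \<le> inner (S x) x" "\<And>x y. inner (S x) (S y) = inner (C x) (C y)"
    and E: "orthonormal_basis E" "(\<lambda>e. inner (S e) e) summable_on E"
    using tc unfolding trace_class_def by blast
  have "(\<lambda>e. inner (C e) e) summable_on E"
    using E(2)
  proof (rule summable_on_comparison_test)
    show "inner (C e) e \<le> inner (S e) e" for e
      by (rule sqrt_order_operators) (use S sym pos in auto)
  qed (use pos in auto)
  with E(1) show ?thesis by (rule that)
qed

section \<open>Exponential moments of Gaussian measures\<close>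

text \<open>
  One half of Parseval's identity: among the elements of the span of \<open>F\<close>, the sum of the \<open>inner e x\<close> multiples
  of \<open>e\<close> is the one closest to \<open>x\<close>.
\<close>

lemma norm_sq_le_finite_coefficients:
  fixes x :: "'a::real_inner"
  assumes E: "orthonormal_basis E" and "0 < \<eta>"
  obtains F where "finite F" "F \<subseteq> E" "(norm x)\<^sup>2 \<le> (\<Sum>e\<in>F. (inner e x)\<^sup>2) + \<eta>"
proof -
  have "x \<in> closure (span E)" using E by (simp add: orthonormal_basis_def)
  then obtain y where y: "y \<in> span E" "dist y x < sqrt \<eta>"
    using closure_approachable \<open>0 < \<eta>\<close> by (metis real_sqrt_gt_zero)
  obtain F r where F: "finite F" "F \<subseteq> E" "y = (\<Sum>e\<in>F. r e *\<^sub>R e)"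
    using y(1) unfolding span_explicit by auto
  have ortho: "inner e f = (if e = f then 1 else 0)" if "e \<in> F" "f \<in> F" for e f
  proof -
    have "e \<in> E" "f \<in> E" using that F by auto
    then show ?thesis using E
      by (auto simp: orthonormal_basis_def pairwise_def orthogonal_def norm_eq_1)
  qed
  have a: "inner x y = (\<Sum>e\<in>F. r e * inner e x)"
    by (simp add: F(3) inner_sum_right inner_commute)
  have b: "inner y y = (\<Sum>e\<in>F. (r e)\<^sup>2)"
  proof -
    have "inner y y = (\<Sum>e\<in>F. \<Sum>f\<in>F. r e * (r f * inner f e))"
      by (simp add: F(3) inner_sum_left inner_sum_right sum_distrib_left)
    also have "\<dots> = (\<Sum>e\<in>F. \<Sum>f\<in>F. if e = f then (r e)\<^sup>2 else 0)"
      by (intro sum.cong refl) (auto simp: ortho power2_eq_square)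
    also have "\<dots> = (\<Sum>e\<in>F. (r e)\<^sup>2)" using F(1) by simp
    finally show ?thesis .
  qed
  have "(norm x)\<^sup>2 - (\<Sum>e\<in>F. (inner e x)\<^sup>2) \<le> (norm x)\<^sup>2 - (\<Sum>e\<in>F. (inner e x)\<^sup>2) + (\<Sum>e\<in>F. (r e - inner e x)\<^sup>2)"
    by (simp add: sum_nonneg)
  also have "\<dots> = (norm x)\<^sup>2 - 2 * inner x y + inner y y"
    unfolding a b by (simp add: power2_diff sum.distrib sum_subtractf sum_distrib_left algebra_simps)
  also have "\<dots> = (dist y x)\<^sup>2"
    by (simp add: dist_norm power2_norm_eq_inner inner_diff_left inner_diff_right inner_commute)
  also have "\<dots> \<le> (sqrt \<eta>)\<^sup>2" using y(2) by (intro power_mono) auto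
  finally show ?thesis using \<open>0 < \<eta>\<close> F by (intro that[of F]) auto
qed

lemma gaussian_marginal:
  fixes \<mu> :: "'a::{real_inner, polish_space} measure"
  assumes g: "gaussian_measure 0 C \<mu>" and pos: "inner (C u) u > 0"
  shows "distr \<mu> borel (inner u) = density lborel (normal_density 0 (sqrt (inner (C u) u)))"
proof -
  have [measurable_cong]: "sets \<mu> = sets borel" using g by (simp add: gaussian_measure_def)
  obtain a s where s: "s \<ge> 0" "distr \<mu> borel (inner u) = normal_law a s"
    using g unfolding gaussian_measure_def by blast
  have m1: "(LINT y|normal_law a s. y) = 0"
  proof -
    have "(LINT y|distr \<mu> borel (inner u). y) = (LINT x|\<mu>. inner u x)"
      by (subst integral_distr) auto
    then show ?thesis using g s(2) by (simp add: gaussian_measure_def)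
  qed
  have m2: "(LINT y|normal_law a s. y\<^sup>2) = inner (C u) u"
  proof -
    have "(LINT y|distr \<mu> borel (inner u). y\<^sup>2) = (LINT x|\<mu>. inner u x * inner u x)"
      by (subst integral_distr) (auto simp: power2_eq_square)
    then show ?thesis using g s(2) by (simp add: gaussian_measure_def)
  qed
  show ?thesis
  proof (cases "s = 0")
    case True
    then have "a = 0" using m1 by (simp add: normal_law_def integral_return)
    then show ?thesis using True m2 pos by (simp add: normal_law_def integral_return)
  next
    case False
    then have s_pos: "s > 0" using s(1) by simp
    have "a = 0"
      using m1 False s_pos
      by (simp add: normal_law_def integral_density integral_normal_moment_nz_1)
    then have "inner (C u) u = s\<^sup>2"
      using m2 False s_pos integral_normal_moment_even[OF s_pos, of 0 1]
      by (simp add: normal_law_def integral_density)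
    then show ?thesis using s(2) False s_pos \<open>a = 0\<close> by (simp add: normal_law_def)
  qed
qed

text \<open>
  Multiplying a centred normal density of variance \<open>s\<^sup>2\<close> by \<open>exp (y\<^sup>2 / (4 s\<^sup>2))\<close> doubles the variance and turns the
  mass into \<open>sqrt 2\<close>.
\<close>

lemma gaussian_marginal_exp_moment:
  fixes \<mu> :: "'a::{real_inner, polish_space} measure"
  assumes g: "gaussian_measure 0 C \<mu>" and pos: "inner (C u) u > 0"
  shows "(\<integral>\<^sup>+x. ennreal (exp ((inner u x)\<^sup>2 / (4 * inner (C u) u))) \<partial>\<mu>) = ennreal (sqrt 2)"
proof -
  have [measurable_cong]: "sets \<mu> = sets borel" using g by (simp add: gaussian_measure_def)
  define s where "s = sqrt (inner (C u) u)"
  have s: "s > 0" "inner (C u) u = s\<^sup>2" using pos by (auto simp: s_def)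
  have dens: "exp (y\<^sup>2 / (4 * s\<^sup>2)) * normal_density 0 s y = sqrt 2 * normal_density 0 (sqrt 2 * s) y" for y
  proof -
    have e: "exp (y\<^sup>2 / (4 * s\<^sup>2)) * exp (- y\<^sup>2 / (2 * s\<^sup>2)) = exp (- y\<^sup>2 / (2 * (sqrt 2 * s)\<^sup>2))"
      using s(1) by (subst exp_add[symmetric]) (simp add: field_simps)
    have n: "1 / sqrt (2 * pi * s\<^sup>2) = sqrt 2 * (1 / sqrt (2 * pi * (sqrt 2 * s)\<^sup>2))"
      using s(1) by (simp add: real_sqrt_mult field_simps)
    show ?thesis unfolding normal_density_def using e n by (simp add: mult_ac)
  qed
  have "(\<integral>\<^sup>+x. ennreal (exp ((inner u x)\<^sup>2 / (4 * inner (C u) u))) \<partial>\<mu>)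
      = (\<integral>\<^sup>+y. ennreal (exp (y\<^sup>2 / (4 * s\<^sup>2))) \<partial>distr \<mu> borel (inner u))"
    by (subst nn_integral_distr) (auto simp: s(2))
  also have "\<dots> = (\<integral>\<^sup>+y. ennreal (normal_density 0 s y) * ennreal (exp (y\<^sup>2 / (4 * s\<^sup>2))) \<partial>lborel)"
    unfolding gaussian_marginal[OF g pos] s_def[symmetric] by (subst nn_integral_density) auto
  also have "\<dots> = (\<integral>\<^sup>+y. ennreal (sqrt 2) * ennreal (normal_density 0 (sqrt 2 * s) y) \<partial>lborel)"
    using dens by (intro nn_integral_cong) (simp add: ennreal_mult[symmetric] mult.commute)
  also have "\<dots> = ennreal (sqrt 2) * (\<integral>\<^sup>+y. ennreal (normal_density 0 (sqrt 2 * s) y) \<partial>lborel)"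
    by (rule nn_integral_cmult) auto
  also have "(\<integral>\<^sup>+y. ennreal (normal_density 0 (sqrt 2 * s) y) \<partial>lborel) = 1"
    using s(1) by (subst nn_integral_eq_integral) (auto intro!: integrable_normal_density)
  finally show ?thesis by simp
qed

text \<open>
  A form of Fernique's theorem. Let \<open>l e = inner (C e) e\<close> along an orthonormal basis on which these numbers are
  summable, and let \<open>w e = l e / T\<close> with \<open>T\<close> so large that the weights sum to at most one. Convexity of \<open>exp\<close>
  gives
  \<open>exp ((\<Sum>e. (inner e x)\<^sup>2) / (4 * T)) \<le> 1 + (\<Sum>e. w e * exp ((inner e x)\<^sup>2 / (4 * l e)))\<close>,
  which treats the coordinates one at a time, and each summand on the right has expectation \<open>w e * sqrt 2\<close>.
\<close>

lemma gaussian_square_exp_moment: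
  fixes \<mu> :: "'a::{real_inner, polish_space} measure"
  assumes g: "gaussian_measure 0 C \<mu>" and tc: "trace_class C"
    and sym: "\<And>x y. inner (C x) y = inner x (C y)"
    and pos: "\<And>x. x \<noteq> 0 \<Longrightarrow> 0 < inner (C x) x"
  obtains t where "t > 0" "(\<integral>\<^sup>+x. ennreal (exp (t * (norm x)\<^sup>2)) \<partial>\<mu>) < top"
proof -
  have [measurable_cong]: "sets \<mu> = sets borel" using g by (simp add: gaussian_measure_def)
  interpret prob_space \<mu> using g by (simp add: gaussian_measure_def)
  have pos': "0 \<le> inner (C x) x" for x
    using pos[of x] by (cases "x = 0") auto
  obtain E where E: "orthonormal_basis E" "(\<lambda>e. inner (C e) e) summable_on E"
    using trace_class_summable[OF tc sym pos'] by blast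
  define l where "l e = inner (C e) e" for e
  have nz: "e \<noteq> 0" if "e \<in> E" for e using E(1) that by (auto simp: orthonormal_basis_def)
  have l_pos: "l e > 0" if "e \<in> E" for e using pos[OF nz[OF that]] by (simp add: l_def)
  have sm: "l summable_on E" using E(2) by (simp add: l_def[abs_def])
  have cE: "countable E"
  proof -
    have "{e\<in>E. l e \<noteq> 0} = E" using l_pos by force
    then show ?thesis using summable_countable_real[OF sm] by simp
  qed
  \<comment> \<open>The summand 1 keeps \<open>T\<close> positive on the trivial space, where the basis is empty.\<close>
  define T where "T = infsum l E + 1"
  have T: "T > 0" unfolding T_def using infsum_nonneg[of E l] l_pos by (simp add: less_imp_le add_nonneg_pos)
  define w where "w e = l e / T" for e
  have w_pos: "w e > 0" if "e \<in> E" for e using l_pos[OF that] T by (simp add: w_def)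
  have w_sum: "(\<Sum>e\<in>F. w e) \<le> 1" if "finite F" "F \<subseteq> E" for F
  proof -
    have "(\<Sum>e\<in>F. l e) \<le> infsum l E"
      by (rule finite_sum_le_infsum[OF sm that]) (use l_pos in \<open>auto intro: less_imp_le\<close>)
    then have "(\<Sum>e\<in>F. l e) / T \<le> 1" using T by (simp add: T_def)
    then show ?thesis by (simp add: w_def sum_divide_distrib)
  qed
  define t where "t = 1 / (4 * T)"
  have t: "t > 0" using T by (simp add: t_def)
  define G where "G e x = ennreal (w e) * ennreal (exp ((inner e x)\<^sup>2 / (4 * l e)))" for e and x :: 'a
  have [measurable]: "G e \<in> borel_measurable borel" for e unfolding G_def[abs_def] by measurable
  define H where "H x = (\<integral>\<^sup>+e. G e x \<partial>count_space E)" for x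
  have finite_bound: "ennreal (exp (t * (\<Sum>e\<in>F. (inner e x)\<^sup>2))) \<le> 1 + H x"
    if F: "finite F" "F \<subseteq> E" for F x
  proof -
    define y where "y e = (inner e x)\<^sup>2 / (4 * l e)" for e
    have wy: "t * (inner e x)\<^sup>2 = w e * y e" if "e \<in> F" for e
    proof -
      have "l e > 0" using l_pos that F by auto
      then show ?thesis using T by (simp add: w_def y_def t_def field_simps)
    qed
    \<comment> \<open>The missing mass of the weights is put on the value \<open>exp 0 = 1\<close>.\<close>
    define w0 where "w0 = 1 - (\<Sum>e\<in>F. w e)"
    have nn: "0 \<le> w e" if "e \<in> F" for e using w_pos that F by (auto intro: less_imp_le)
    have w0: "0 \<le> w0" "w0 \<le> 1" using w_sum[OF F] sum_nonneg[of F w] nn by (auto simp: w0_def)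
    have "exp (t * (\<Sum>e\<in>F. (inner e x)\<^sup>2)) = exp (\<Sum>e\<in>F. w e * y e)"
      using wy by (simp add: sum_distrib_left)
    also have "\<dots> = exp (\<Sum>e\<in>insert None (Some ` F). (case e of None \<Rightarrow> w0 | Some e \<Rightarrow> w e) *\<^sub>R (case e of None \<Rightarrow> 0 | Some e \<Rightarrow> y e))"
      using F by (subst sum.insert) (auto simp: sum.reindex)
    also have "\<dots> \<le> (\<Sum>e\<in>insert None (Some ` F). (case e of None \<Rightarrow> w0 | Some e \<Rightarrow> w e) * exp (case e of None \<Rightarrow> 0 | Some e \<Rightarrow> y e))"
    proof (rule convex_on_sum[OF _ _ exp_convex])
      show "(\<Sum>e\<in>insert None (Some ` F). case e of None \<Rightarrow> w0 | Some e \<Rightarrow> w e) = 1"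
        using F by (subst sum.insert) (auto simp: sum.reindex w0_def)
    qed (use F w0 nn in \<open>auto split: option.splits\<close>)
    also have "\<dots> = w0 + (\<Sum>e\<in>F. w e * exp (y e))"
      using F by (subst sum.insert) (auto simp: sum.reindex)
    also have "\<dots> \<le> 1 + (\<Sum>e\<in>F. w e * exp (y e))" using w0 by simp
    finally have "ennreal (exp (t * (\<Sum>e\<in>F. (inner e x)\<^sup>2))) \<le> ennreal (1 + (\<Sum>e\<in>F. w e * exp (y e)))"
      by (rule ennreal_leI)
    also have "\<dots> = 1 + (\<Sum>e\<in>F. G e x)"
    proof -
      have "ennreal (\<Sum>e\<in>F. w e * exp (y e)) = (\<Sum>e\<in>F. ennreal (w e * exp (y e)))"
        using nn by (intro sum_ennreal[symmetric]) simp
      also have "\<dots> = (\<Sum>e\<in>F. G e x)"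
        unfolding G_def y_def using nn by (intro sum.cong refl ennreal_mult) auto
      finally show ?thesis using nn by (simp add: sum_nonneg)
    qed
    also have "(\<Sum>e\<in>F. G e x) = (\<integral>\<^sup>+e. G e x \<partial>count_space F)"
      using F by (simp add: nn_integral_count_space_finite)
    also have "\<dots> \<le> H x"
      unfolding H_def using F by (auto simp: nn_integral_count_space_indicator indicator_def intro!: nn_integral_mono)
    finally show ?thesis by (simp add: add_left_mono)
  qed
  \<comment> \<open>Finitely many coordinates recover the squared norm up to 1, which costs the factor \<open>exp t\<close>.\<close>
  have bound: "ennreal (exp (t * (norm x)\<^sup>2)) \<le> exp t * (1 + H x)" for x
  proof -
    obtain F where F: "finite F" "F \<subseteq> E" "(norm x)\<^sup>2 \<le> (\<Sum>e\<in>F. (inner e x)\<^sup>2) + 1"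
      using norm_sq_le_finite_coefficients[OF E(1), of 1 x] by auto
    have "t * (norm x)\<^sup>2 \<le> t + t * (\<Sum>e\<in>F. (inner e x)\<^sup>2)"
      using mult_left_mono[OF F(3), of t] t by (simp add: algebra_simps)
    then have "exp (t * (norm x)\<^sup>2) \<le> exp t * exp (t * (\<Sum>e\<in>F. (inner e x)\<^sup>2))"
      by (simp add: exp_add[symmetric])
    then have "ennreal (exp (t * (norm x)\<^sup>2)) \<le> ennreal (exp t) * ennreal (exp (t * (\<Sum>e\<in>F. (inner e x)\<^sup>2)))"
      by (simp add: ennreal_mult[symmetric] ennreal_leI)
    also have "\<dots> \<le> ennreal (exp t) * (1 + H x)"
      by (intro mult_left_mono finite_bound F) auto
    finally show ?thesis .
  qed
  have sf: "sigma_finite_measure (count_space E)"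
    using cE by (rule sigma_finite_measure_count_space_countable)
  have meas: "(\<lambda>(e, x). G e x) \<in> borel_measurable (count_space E \<Otimes>\<^sub>M \<mu>)"
    by (rule measurable_pair_measure_countable1[OF cE]) simp
  interpret P: pair_sigma_finite "count_space E" \<mu>
    using sf sigma_finite_measure_axioms by (simp add: pair_sigma_finite_def)
  have [measurable]: "H \<in> borel_measurable borel"
  proof -
    have "(\<lambda>x. \<integral>\<^sup>+e. G e x \<partial>count_space E) \<in> borel_measurable \<mu>"
      using sigma_finite_measure.borel_measurable_nn_integral_fst[OF sf measurable_pair_swap[OF meas]] by simp
    then show ?thesis unfolding H_def[abs_def] by measurable
  qed
  have "(\<integral>\<^sup>+x. H x \<partial>\<mu>) = (\<integral>\<^sup>+e. (\<integral>\<^sup>+x. G e x \<partial>\<mu>) \<partial>count_space E)"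
    unfolding H_def using P.Fubini'[OF meas] by simp
  also have "\<dots> = (\<integral>\<^sup>+e. ennreal (sqrt 2) * ennreal (w e) \<partial>count_space E)"
  proof (rule nn_integral_cong)
    fix e assume "e \<in> space (count_space E)"
    then have "inner (C e) e > 0" using l_pos by (simp add: l_def)
    from gaussian_marginal_exp_moment[OF g this] show "(\<integral>\<^sup>+x. G e x \<partial>\<mu>) = ennreal (sqrt 2) * ennreal (w e)"
      unfolding G_def by (subst nn_integral_cmult) (auto simp: l_def mult_ac)
  qed
  also have "\<dots> = ennreal (sqrt 2) * (\<integral>\<^sup>+e. ennreal (w e) \<partial>count_space E)"
    by (rule nn_integral_cmult) auto
  also have "(\<integral>\<^sup>+e. ennreal (w e) \<partial>count_space E) \<le> 1"
  proof -
    have ws: "w summable_on E"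
      unfolding w_def[abs_def] divide_inverse by (intro summable_on_cmult_left sm)
    from ws have wa: "Infinite_Set_Sum.abs_summable_on w E"
      using abs_summable_equivalent summable_on_iff_abs_summable_on_real by blast
    have "(\<integral>\<^sup>+e. ennreal (w e) \<partial>count_space E) = ennreal (infsum w E)"
      using nn_integral_conv_infsetsum[OF wa] w_pos by (auto simp: infsetsum_infsum[OF wa] intro: less_imp_le)
    also have "infsum w E \<le> 1"
      using ws w_sum by (intro infsum_le_finite_sums)
    finally show ?thesis by (simp add: ennreal_leI)
  qed
  finally have H_int: "(\<integral>\<^sup>+x. H x \<partial>\<mu>) \<le> ennreal (sqrt 2)" by (simp add: mult_left_mono)
  have "(\<integral>\<^sup>+x. ennreal (exp (t * (norm x)\<^sup>2)) \<partial>\<mu>) \<le> (\<integral>\<^sup>+x. exp t * (1 + H x) \<partial>\<mu>)"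
    by (intro nn_integral_mono bound)
  also have "\<dots> = exp t * (1 + (\<integral>\<^sup>+x. H x \<partial>\<mu>))"
    by (simp add: nn_integral_cmult nn_integral_add emeasure_space_1)
  also have "\<dots> \<le> exp t * (1 + ennreal (sqrt 2))"
    by (intro mult_left_mono add_left_mono H_int) auto
  also have "\<dots> < top" by (simp add: ennreal_mult_less_top)
  finally show ?thesis using t that by blast
qed


section \<open>Integral inequalities\<close>

lemma nn_integral_affine_le:
  fixes f :: "'a \<Rightarrow> real"
  assumes "prob_space M" and [measurable]: "f \<in> borel_measurable M" and "\<And>x. 0 \<le> f x"
    and "(\<integral>\<^sup>+x. ennreal (f x) \<partial>M) \<le> ennreal B" and "0 \<le> B" "0 \<le> a" "0 \<le> r"
  shows "(\<integral>\<^sup>+x. ennreal (r + a * f x) \<partial>M) \<le> ennreal (r + a * B)"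
proof -
  interpret prob_space M by fact
  have "(\<integral>\<^sup>+x. ennreal (r + a * f x) \<partial>M) = (\<integral>\<^sup>+x. ennreal r + ennreal a * ennreal (f x) \<partial>M)"
    using assms by (intro nn_integral_cong) (simp add: ennreal_mult)
  also have "\<dots> = ennreal r + ennreal a * (\<integral>\<^sup>+x. ennreal (f x) \<partial>M)"
    by (simp add: nn_integral_add nn_integral_cmult emeasure_space_1)
  also have "\<dots> \<le> ennreal r + ennreal a * ennreal B"
    using assms by (intro add_left_mono mult_left_mono) auto
  also have "\<dots> = ennreal (r + a * B)" using assms by (simp add: ennreal_mult)
  finally show ?thesis .
qed

text \<open>
  Cauchy-Schwarz, from \<open>sqrt (f * g) \<le> (t * f + g / t) / 2\<close> with the best constant \<open>t = sqrt (B / A)\<close>.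
\<close>

lemma nn_integral_sqrt_mult_le:
  fixes f g :: "'a \<Rightarrow> real"
  assumes [measurable]: "f \<in> borel_measurable M" "g \<in> borel_measurable M"
    and f: "\<And>x. 0 \<le> f x" and g: "\<And>x. 0 \<le> g x"
    and A: "(\<integral>\<^sup>+x. ennreal (f x) \<partial>M) \<le> ennreal A" "0 \<le> A"
    and B: "(\<integral>\<^sup>+x. ennreal (g x) \<partial>M) \<le> ennreal B" "0 < B"
  shows "(\<integral>\<^sup>+x. ennreal (sqrt (f x * g x)) \<partial>M) \<le> ennreal (sqrt (A * B))"
proof (cases "A = 0")
  case True
  then have "(\<integral>\<^sup>+x. ennreal (f x) \<partial>M) = 0" using A by simp
  then have "AE x in M. ennreal (f x) = 0" by (subst (asm) nn_integral_0_iff_AE) auto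
  then have "AE x in M. ennreal (sqrt (f x * g x)) = 0"
    by eventually_elim (simp add: ennreal_eq_0_iff mult_nonpos_nonneg g)
  then have "(\<integral>\<^sup>+x. ennreal (sqrt (f x * g x)) \<partial>M) = 0"
    by (subst nn_integral_0_iff_AE) auto
  then show ?thesis by simp
next
  case False
  then have A0: "A > 0" using A by simp
  define t where "t = sqrt (B / A)"
  have t: "t > 0" using A0 B by (simp add: t_def)
  have amgm: "sqrt (f x * g x) \<le> t / 2 * f x + 1 / (2 * t) * g x" for x
  proof -
    have "sqrt (f x * g x) = sqrt ((t * f x) * (g x / t))" using t by simp
    also have "\<dots> \<le> (t * f x + g x / t) / 2"
      using t f g by (intro arith_geo_mean_sqrt) auto
    finally show ?thesis by (simp add: field_simps)
  qed
  have "(\<integral>\<^sup>+x. ennreal (sqrt (f x * g x)) \<partial>M)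
      \<le> (\<integral>\<^sup>+x. ennreal (t / 2) * ennreal (f x) + ennreal (1 / (2 * t)) * ennreal (g x) \<partial>M)"
  proof (rule nn_integral_mono)
    fix x
    have "ennreal (sqrt (f x * g x)) \<le> ennreal (t / 2 * f x + 1 / (2 * t) * g x)"
      by (rule ennreal_leI[OF amgm])
    also have "\<dots> = ennreal (t / 2) * ennreal (f x) + ennreal (1 / (2 * t)) * ennreal (g x)"
      using t f[of x] g[of x] by (subst ennreal_plus) (auto simp: ennreal_mult[symmetric])
    finally show "ennreal (sqrt (f x * g x)) \<le> \<dots>" .
  qed
  also have "\<dots> = ennreal (t / 2) * (\<integral>\<^sup>+x. ennreal (f x) \<partial>M) + ennreal (1 / (2 * t)) * (\<integral>\<^sup>+x. ennreal (g x) \<partial>M)"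
    by (simp add: nn_integral_add nn_integral_cmult)
  also have "\<dots> \<le> ennreal (t / 2) * ennreal A + ennreal (1 / (2 * t)) * ennreal B"
    by (intro add_mono mult_left_mono A B) auto
  also have "\<dots> = ennreal (t / 2 * A + 1 / (2 * t) * B)"
    using t A0 B by (simp add: ennreal_mult[symmetric] ennreal_plus[symmetric] del: ennreal_plus)
  also have "t / 2 * A + 1 / (2 * t) * B = sqrt (A * B)"
  proof -
    have "t * A = sqrt (A * B)" using A0 B
      by (simp add: t_def real_sqrt_divide real_sqrt_mult real_div_sqrt field_simps)
    moreover have "B / t = sqrt (A * B)" using A0 B
      by (simp add: t_def real_sqrt_divide real_sqrt_mult real_div_sqrt field_simps)
    ultimately show ?thesis using t by (simp add: field_simps)
  qed
  finally show ?thesis .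
qed

section \<open>Powers of Markov kernels\<close>

lemma kernel_power_measurable [measurable]:
  assumes "P \<in> borel \<rightarrow>\<^sub>M prob_algebra borel"
  shows "kernel_power P n \<in> borel \<rightarrow>\<^sub>M prob_algebra borel"
proof (induction n)
  case 0
  then show ?case by simp
next
  case (Suc n)
  then show ?case using assms by (simp add: measurable_bind_prob_space)
qed

lemma prob_kernel:
  assumes "P \<in> borel \<rightarrow>\<^sub>M prob_algebra borel"
  shows "prob_space (P x)" and "sets (P x) = sets borel"
  using measurable_space[OF assms, of x] by (auto simp: space_prob_algebra)

lemma nn_integral_kernel_power_Suc:
  assumes P: "P \<in> borel \<rightarrow>\<^sub>M prob_algebra borel" and [measurable]: "f \<in> borel_measurable borel"
  shows "(\<integral>\<^sup>+y. f y \<partial>kernel_power P (Suc n) x) = (\<integral>\<^sup>+z. (\<integral>\<^sup>+y. f y \<partial>P z) \<partial>kernel_power P n x)"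
proof -
  have "P \<in> kernel_power P n x \<rightarrow>\<^sub>M subprob_algebra borel"
    using measurable_prob_algebraD[OF P]
    by (simp cong: measurable_cong_sets add: prob_kernel[OF kernel_power_measurable[OF P]])
  then show ?thesis by (simp add: nn_integral_bind[where B = borel])
qed

lemma kernel_integral_measurable:
  assumes P: "P \<in> borel \<rightarrow>\<^sub>M prob_algebra borel" and f: "f \<in> borel_measurable borel"
  shows "(\<lambda>z. \<integral>\<^sup>+y. f y \<partial>P z) \<in> borel_measurable borel"
  using measurable_compose[OF measurable_prob_algebraD[OF P] nn_integral_measurable_subprob_algebra[OF f]] .

lemma nn_integral_kernel_power_add:
  assumes P: "P \<in> borel \<rightarrow>\<^sub>M prob_algebra borel" and "f \<in> borel_measurable borel"
  shows "(\<integral>\<^sup>+y. f y \<partial>kernel_power P (m + n) x) = (\<integral>\<^sup>+z. (\<integral>\<^sup>+y. f y \<partial>kernel_power P n z) \<partial>kernel_power P m x)"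
  using assms(2)
proof (induction n arbitrary: f)
  case 0
  then show ?case by (simp add: nn_integral_return)
next
  case (Suc n)
  have "(\<integral>\<^sup>+y. f y \<partial>kernel_power P (m + Suc n) x) = (\<integral>\<^sup>+z. (\<integral>\<^sup>+y. f y \<partial>P z) \<partial>kernel_power P (m + n) x)"
    using nn_integral_kernel_power_Suc[OF P Suc.prems] by simp
  also have "\<dots> = (\<integral>\<^sup>+w. (\<integral>\<^sup>+z. (\<integral>\<^sup>+y. f y \<partial>P z) \<partial>kernel_power P n w) \<partial>kernel_power P m x)"
    by (rule Suc.IH) (rule kernel_integral_measurable[OF P Suc.prems])
  finally show ?case
    by (simp only: nn_integral_kernel_power_Suc[OF P Suc.prems])
qed

text \<open>
  If \<open>g\<close> carries one step of \<open>K\<close> to one step of \<open>P\<close>, then the image under \<open>g\<close> of a chain with kernel \<open>K\<close> is a chain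
  with kernel \<open>P\<close>. A kernel on pairs that couples \<open>P\<close> with itself has this property for \<open>fst\<close> and for \<open>snd\<close>.
\<close>

lemma nn_integral_lumped_kernel_power:
  fixes P :: "'b::topological_space \<Rightarrow> 'b measure" and K :: "'c::topological_space \<Rightarrow> 'c measure"
  assumes P: "P \<in> borel \<rightarrow>\<^sub>M prob_algebra borel" and K: "K \<in> borel \<rightarrow>\<^sub>M prob_algebra borel"
    and [measurable]: "g \<in> borel \<rightarrow>\<^sub>M borel"
    and lump: "\<And>s. distr (K s) borel g = P (g s)"
    and f: "f \<in> borel_measurable borel"
  shows "(\<integral>\<^sup>+t. f (g t) \<partial>kernel_power K n s) = (\<integral>\<^sup>+y. f y \<partial>kernel_power P n (g s))"
  using f
proof (induction n arbitrary: f)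
  case 0
  then have [measurable]: "f \<in> borel_measurable borel" .
  show ?case by (simp add: nn_integral_return)
next
  case (Suc n)
  note [measurable] = Suc.prems
  have step: "(\<integral>\<^sup>+t. f (g t) \<partial>K s) = (\<integral>\<^sup>+y. f y \<partial>P (g s))" for s
    unfolding lump[symmetric] using prob_kernel[OF K]
    by (subst nn_integral_distr) (auto cong: measurable_cong_sets)
  have "(\<integral>\<^sup>+t. f (g t) \<partial>kernel_power K (Suc n) s) = (\<integral>\<^sup>+w. (\<integral>\<^sup>+y. f y \<partial>P (g w)) \<partial>kernel_power K n s)"
    by (subst nn_integral_kernel_power_Suc[OF K]) (auto simp: step)
  also have "\<dots> = (\<integral>\<^sup>+z. (\<integral>\<^sup>+y. f y \<partial>P z) \<partial>kernel_power P n (g s))"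
    by (rule Suc.IH) (rule kernel_integral_measurable[OF P Suc.prems])
  finally show ?case by (simp only: nn_integral_kernel_power_Suc[OF P Suc.prems])
qed

lemma distr_bind_lumped_kernel:
  fixes P :: "'b::topological_space \<Rightarrow> 'b measure" and K :: "'c::topological_space \<Rightarrow> 'c measure"
  assumes P: "P \<in> borel \<rightarrow>\<^sub>M prob_algebra borel" and K: "K \<in> borel \<rightarrow>\<^sub>M prob_algebra borel"
    and g[measurable]: "g \<in> borel \<rightarrow>\<^sub>M borel"
    and lump: "\<And>s. distr (K s) borel g = P (g s)"
    and pi: "prob_space \<pi>" "sets \<pi> = sets borel"
  shows "distr (bind \<pi> (kernel_power K n)) borel g = bind (distr \<pi> borel g) (kernel_power P n)"
proof (rule measure_eqI)
  have pi_in: "\<pi> \<in> space (prob_algebra borel)" using pi by (simp add: space_prob_algebra)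
  note Kn = kernel_power_measurable[OF K, of n] and Pn = kernel_power_measurable[OF P, of n]
  have gpi[measurable]: "g \<in> \<pi> \<rightarrow>\<^sub>M borel" using g pi(2) by (simp cong: measurable_cong_sets)
  have d_in: "distr \<pi> borel g \<in> space (prob_algebra borel)"
    using prob_space.prob_space_distr[OF pi(1) gpi] by (simp add: space_prob_algebra)
  have sb: "sets (bind \<pi> (kernel_power K n)) = sets borel" by (rule sets_bind'[OF pi_in Kn])
  show "sets (distr (bind \<pi> (kernel_power K n)) borel g) = sets (bind (distr \<pi> borel g) (kernel_power P n))"
    using sets_bind'[OF d_in Pn] by simp
  fix A assume "A \<in> sets (distr (bind \<pi> (kernel_power K n)) borel g)"
  then have A[measurable]: "A \<in> sets borel" by simp
  have gA: "g -` A \<in> sets borel" using measurable_sets[OF g A] by simp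
  have gb: "g \<in> bind \<pi> (kernel_power K n) \<rightarrow>\<^sub>M borel" using g sb by (simp cong: measurable_cong_sets)
  have "emeasure (distr (bind \<pi> (kernel_power K n)) borel g) A = emeasure (bind \<pi> (kernel_power K n)) (g -` A)"
    using emeasure_distr[OF gb A] sets_eq_imp_space_eq[OF sb] by simp
  also have "\<dots> = (\<integral>\<^sup>+s. emeasure (kernel_power K n s) (g -` A) \<partial>\<pi>)"
    by (rule emeasure_bind_prob_algebra[OF pi_in Kn gA])
  also have "\<dots> = (\<integral>\<^sup>+s. emeasure (kernel_power P n (g s)) A \<partial>\<pi>)"
  proof (rule nn_integral_cong)
    fix s
    have "emeasure (kernel_power K n s) (g -` A) = (\<integral>\<^sup>+t. indicator A (g t) \<partial>kernel_power K n s)"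
    proof -
      have "indicator (g -` A) = (\<lambda>t. indicator A (g t) :: ennreal)" by (auto simp: indicator_def)
      then show ?thesis
        using nn_integral_indicator[of "g -` A" "kernel_power K n s"] gA prob_kernel(2)[OF Kn] by simp
    qed
    also have "\<dots> = (\<integral>\<^sup>+y. indicator A y \<partial>kernel_power P n (g s))"
      by (rule nn_integral_lumped_kernel_power[OF P K g lump]) auto
    also have "\<dots> = emeasure (kernel_power P n (g s)) A"
      using prob_kernel(2)[OF Pn] by (intro nn_integral_indicator) auto
    finally show "emeasure (kernel_power K n s) (g -` A) = emeasure (kernel_power P n (g s)) A" .
  qed
  also have "\<dots> = (\<integral>\<^sup>+y. emeasure (kernel_power P n y) A \<partial>distr \<pi> borel g)"
  proof (rule nn_integral_distr[symmetric, OF gpi])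
    have "(\<lambda>y. emeasure (kernel_power P n y) A) \<in> borel_measurable borel"
      using measurable_compose[OF measurable_prob_algebraD[OF Pn] measurable_emeasure_subprob_algebra[OF A]] .
    then show "(\<lambda>y. emeasure (kernel_power P n y) A) \<in> borel_measurable (distr \<pi> borel g)"
      by simp
  qed
  also have "\<dots> = emeasure (bind (distr \<pi> borel g) (kernel_power P n)) A"
    by (rule emeasure_bind_prob_algebra[symmetric, OF d_in Pn A])
  finally show "emeasure (distr (bind \<pi> (kernel_power K n)) borel g) A = \<dots>" .
qed

section \<open>A weak Harris theorem for coupling kernels\<close>

text \<open>
  The weight \<open>\<delta>\<close> interpolates between \<open>sqrt (dist_eps \<epsilon> x y)\<close> and \<open>dist_eps_V V \<epsilon> x y\<close>, which is the case
  \<open>\<delta> = 1\<close>. For small \<open>\<delta>\<close> the factor with \<open>V\<close> cannot destroy the contraction of \<open>dist_eps\<close>; since for positive \<open>\<delta>\<close> these functions are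
  comparable, a contraction for one \<open>\<delta>\<close> suffices.
\<close>

definition weighted_dist :: "('a::real_normed_vector \<Rightarrow> real) \<Rightarrow> real \<Rightarrow> real \<Rightarrow> 'a \<times> 'a \<Rightarrow> real" where
  "weighted_dist V \<epsilon> \<delta> s = sqrt (dist_eps \<epsilon> (fst s) (snd s) * (1 + \<delta> * (V (fst s) + V (snd s))))"

text \<open>
  The hypotheses of the weak Harris theorem, in terms of one kernel \<open>K\<close> that couples \<open>P\<close> with itself. The assumption
  \<open>closer\<close> says that, on every scale, the distance is multiplied by \<open>\<rho>\<close> with probability at least \<open>\<gamma>\<close>; iterated, it
  makes bounded sets small in the sense of Harris, with constants that do not refer to \<open>P\<close>.
\<close>

locale contracting_coupling =
  fixes V :: "'a::{real_normed_vector, second_countable_topology} \<Rightarrow> real"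
    and \<epsilon> \<kappa> b \<gamma> \<rho> c :: real
    and P :: "'a \<Rightarrow> 'a measure" and K :: "'a \<times> 'a \<Rightarrow> ('a \<times> 'a) measure"
  assumes V_measurable [measurable]: "V \<in> borel_measurable borel"
    and V_nonneg: "\<And>x. 0 \<le> V x"
    and constants: "0 < \<epsilon>" "0 \<le> \<kappa>" "\<kappa> < 1" "0 \<le> b" "0 < \<gamma>" "\<gamma> \<le> 1" "0 \<le> \<rho>" "\<rho> < 1" "0 \<le> c" "c < 1"
    and P_kernel: "P \<in> borel \<rightarrow>\<^sub>M prob_algebra borel"
    and K_kernel: "K \<in> borel \<rightarrow>\<^sub>M prob_algebra borel"
    and K_fst: "\<And>s. distr (K s) borel fst = P (fst s)"
    and K_snd: "\<And>s. distr (K s) borel snd = P (snd s)"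
    and drift: "\<And>x. (\<integral>\<^sup>+y. ennreal (V y) \<partial>P x) \<le> ennreal (\<kappa> * V x + b)"
    and closer: "\<And>a s. 0 \<le> a \<Longrightarrow> (\<integral>\<^sup>+t. ennreal (min 1 (a * norm (fst t - snd t))) \<partial>K s)
        \<le> ennreal (1 - \<gamma> + \<gamma> * min 1 (\<rho> * a * norm (fst s - snd s)))"
    and local_contraction: "\<And>s. norm (fst s - snd s) < \<epsilon> \<Longrightarrow>
        (\<integral>\<^sup>+t. ennreal (dist_eps \<epsilon> (fst t) (snd t)) \<partial>K s) \<le> ennreal (c * dist_eps \<epsilon> (fst s) (snd s))"
begin

lemma fst_snd_borel [measurable]:
  "fst \<in> borel_measurable (borel :: ('a \<times> 'a) measure)" "snd \<in> borel_measurable (borel :: ('a \<times> 'a) measure)"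
  by (simp_all add: borel_prod[symmetric])

lemma dist_measurable [measurable]:
  "(\<lambda>t::'a \<times> 'a. dist_eps \<epsilon> (fst t) (snd t)) \<in> borel_measurable borel"
  unfolding dist_eps_def by measurable

lemma dist_bounds: "0 \<le> dist_eps \<epsilon> x y" "dist_eps \<epsilon> x y \<le> 1"
  using constants by (auto simp: dist_eps_def)

lemma dist_eps_V_measurable: "(\<lambda>t::'a \<times> 'a. dist_eps_V V \<epsilon> (fst t) (snd t)) \<in> borel_measurable borel"
  unfolding dist_eps_V_def by measurable

lemma dist_eps_V_nonneg: "0 \<le> dist_eps_V V \<epsilon> x y"
  unfolding dist_eps_V_def using dist_bounds V_nonneg[of x] V_nonneg[of y]
  by (intro real_sqrt_ge_zero mult_nonneg_nonneg) auto

lemma Kn_prob: "prob_space (kernel_power K n s)" "sets (kernel_power K n s) = sets borel"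
  by (rule prob_kernel[OF kernel_power_measurable[OF K_kernel]])+

lemma dist_le_one: "(\<integral>\<^sup>+t. ennreal (dist_eps \<epsilon> (fst t) (snd t)) \<partial>kernel_power K n s) \<le> 1"
proof -
  interpret prob_space "kernel_power K n s" by (rule Kn_prob)
  have "(\<integral>\<^sup>+t. ennreal (dist_eps \<epsilon> (fst t) (snd t)) \<partial>kernel_power K n s) \<le> (\<integral>\<^sup>+t. 1 \<partial>kernel_power K n s)"
    by (intro nn_integral_mono) (simp add: dist_bounds)
  then show ?thesis by (simp add: emeasure_space_1)
qed

lemma one_step_dist:
  "(\<integral>\<^sup>+t. ennreal (dist_eps \<epsilon> (fst t) (snd t)) \<partial>K s) \<le> ennreal (dist_eps \<epsilon> (fst s) (snd s))"
proof (cases "norm (fst s - snd s) < \<epsilon>")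
  case True
  have "c * dist_eps \<epsilon> (fst s) (snd s) \<le> 1 * dist_eps \<epsilon> (fst s) (snd s)"
    using constants dist_bounds by (intro mult_right_mono) auto
  then show ?thesis using local_contraction[OF True] by (auto intro: order_trans ennreal_leI)
next
  case False
  then have "dist_eps \<epsilon> (fst s) (snd s) = 1" using constants by (simp add: dist_eps_def)
  moreover have "(\<integral>\<^sup>+t. ennreal (dist_eps \<epsilon> (fst t) (snd t)) \<partial>K s) \<le> (\<integral>\<^sup>+t. 1 \<partial>K s)"
    by (intro nn_integral_mono) (simp add: dist_bounds)
  ultimately show ?thesis
    using prob_space.emeasure_space_1[OF prob_kernel(1)[OF K_kernel]] by simp
qed

lemma power_dist_nonincreasing:
  "(\<integral>\<^sup>+t. ennreal (dist_eps \<epsilon> (fst t) (snd t)) \<partial>kernel_power K n s) \<le> ennreal (dist_eps \<epsilon> (fst s) (snd s))"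
proof (induction n)
  case 0
  then show ?case by (simp add: nn_integral_return)
next
  case (Suc n)
  have "(\<integral>\<^sup>+t. ennreal (dist_eps \<epsilon> (fst t) (snd t)) \<partial>kernel_power K (Suc n) s)
      \<le> (\<integral>\<^sup>+t. ennreal (dist_eps \<epsilon> (fst t) (snd t)) \<partial>kernel_power K n s)"
    by (subst nn_integral_kernel_power_Suc[OF K_kernel]) (auto intro!: nn_integral_mono one_step_dist)
  with Suc show ?case by (rule order_trans[rotated])
qed

lemma power_local_contraction:
  assumes "norm (fst s - snd s) < \<epsilon>" "1 \<le> n"
  shows "(\<integral>\<^sup>+t. ennreal (dist_eps \<epsilon> (fst t) (snd t)) \<partial>kernel_power K n s)
    \<le> ennreal (c * dist_eps \<epsilon> (fst s) (snd s))"
proof -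
  obtain m where n: "n = 1 + m" using assms(2) le_Suc_ex by blast
  have "(\<integral>\<^sup>+t. ennreal (dist_eps \<epsilon> (fst t) (snd t)) \<partial>kernel_power K n s)
      = (\<integral>\<^sup>+u. (\<integral>\<^sup>+t. ennreal (dist_eps \<epsilon> (fst t) (snd t)) \<partial>kernel_power K m u) \<partial>kernel_power K 1 s)"
    unfolding n by (rule nn_integral_kernel_power_add[OF K_kernel]) simp
  also have "\<dots> \<le> (\<integral>\<^sup>+u. ennreal (dist_eps \<epsilon> (fst u) (snd u)) \<partial>kernel_power K 1 s)"
    by (intro nn_integral_mono power_dist_nonincreasing)
  also have "\<dots> = (\<integral>\<^sup>+u. ennreal (dist_eps \<epsilon> (fst u) (snd u)) \<partial>K s)"
    using nn_integral_kernel_power_Suc[OF K_kernel, of "\<lambda>u. ennreal (dist_eps \<epsilon> (fst u) (snd u))" 0 s]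
    by (simp add: nn_integral_return kernel_integral_measurable[OF K_kernel])
  also have "\<dots> \<le> ennreal (c * dist_eps \<epsilon> (fst s) (snd s))" by (rule local_contraction[OF assms(1)])
  finally show ?thesis .
qed

text \<open>
  A step on the scale \<open>a\<close> leaves a cost on the scale \<open>\<rho> * a\<close>, to which the induction hypothesis applies.
\<close>

lemma power_closer:
  assumes "0 \<le> a"
  shows "(\<integral>\<^sup>+t. ennreal (min 1 (a * norm (fst t - snd t))) \<partial>kernel_power K n s)
    \<le> ennreal (1 - \<gamma> ^ n + \<gamma> ^ n * min 1 (\<rho> ^ n * a * norm (fst s - snd s)))"
  using assms
proof (induction n arbitrary: a)
  case 0
  then show ?case by (simp add: nn_integral_return)
next
  case (Suc n)
  have g: "0 \<le> \<gamma> ^ n" "\<gamma> ^ n \<le> 1" using constants by (auto simp: power_le_one)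
  have "(\<integral>\<^sup>+t. ennreal (min 1 (a * norm (fst t - snd t))) \<partial>kernel_power K (Suc n) s)
      \<le> (\<integral>\<^sup>+t. ennreal (1 - \<gamma> + \<gamma> * min 1 (\<rho> * a * norm (fst t - snd t))) \<partial>kernel_power K n s)"
    using Suc.prems by (subst nn_integral_kernel_power_Suc[OF K_kernel]) (auto intro!: nn_integral_mono closer)
  also have "\<dots> \<le> ennreal (1 - \<gamma> + \<gamma> * (1 - \<gamma> ^ n + \<gamma> ^ n * min 1 (\<rho> ^ n * (\<rho> * a) * norm (fst s - snd s))))"
  proof (rule nn_integral_affine_le[OF Kn_prob(1)])
    show "(\<lambda>t. min 1 (\<rho> * a * norm (fst t - snd t))) \<in> borel_measurable (kernel_power K n s)"
      using Kn_prob(2) by (simp cong: measurable_cong_sets)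
  qed (use Suc constants g in auto)
  also have "1 - \<gamma> + \<gamma> * (1 - \<gamma> ^ n + \<gamma> ^ n * min 1 (\<rho> ^ n * (\<rho> * a) * norm (fst s - snd s)))
      = 1 - \<gamma> ^ Suc n + \<gamma> ^ Suc n * min 1 (\<rho> ^ Suc n * a * norm (fst s - snd s))"
    by (simp add: algebra_simps)
  finally show ?case .
qed

lemma power_drift_single:
  "(\<integral>\<^sup>+y. ennreal (V y) \<partial>kernel_power P n x) \<le> ennreal (\<kappa> ^ n * V x + b / (1 - \<kappa>))"
proof (induction n)
  case 0
  then show ?case using constants V_nonneg[of x] by (simp add: nn_integral_return ennreal_leI)
next
  case (Suc n)
  have "(\<integral>\<^sup>+y. ennreal (V y) \<partial>kernel_power P (Suc n) x)
      \<le> (\<integral>\<^sup>+y. ennreal (b + \<kappa> * V y) \<partial>kernel_power P n x)"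
    using drift by (subst nn_integral_kernel_power_Suc[OF P_kernel]) (auto intro!: nn_integral_mono simp: add.commute)
  also have "\<dots> \<le> ennreal (b + \<kappa> * (\<kappa> ^ n * V x + b / (1 - \<kappa>)))"
    using prob_kernel[OF kernel_power_measurable[OF P_kernel, of n]] constants V_nonneg
    by (intro nn_integral_affine_le Suc) (auto cong: measurable_cong_sets)
  also have "b + \<kappa> * (\<kappa> ^ n * V x + b / (1 - \<kappa>)) = \<kappa> ^ Suc n * V x + b / (1 - \<kappa>)"
    using constants by (simp add: field_simps)
  finally show ?case .
qed

lemma power_drift:
  "(\<integral>\<^sup>+t. ennreal (V (fst t) + V (snd t)) \<partial>kernel_power K n s)
    \<le> ennreal (\<kappa> ^ n * (V (fst s) + V (snd s)) + 2 * b / (1 - \<kappa>))"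
proof -
  have pos: "0 \<le> \<kappa> ^ n * V x + b / (1 - \<kappa>)" for x using constants V_nonneg[of x] by auto
  have m: "(\<lambda>t. ennreal (V (fst t))) \<in> borel_measurable (kernel_power K n s)"
    "(\<lambda>t. ennreal (V (snd t))) \<in> borel_measurable (kernel_power K n s)"
    using Kn_prob(2) by (simp_all cong: measurable_cong_sets)
  have "(\<integral>\<^sup>+t. ennreal (V (fst t) + V (snd t)) \<partial>kernel_power K n s)
     = (\<integral>\<^sup>+t. ennreal (V (fst t)) \<partial>kernel_power K n s) + (\<integral>\<^sup>+t. ennreal (V (snd t)) \<partial>kernel_power K n s)"
    using V_nonneg m by (simp add: nn_integral_add)
  also have "(\<integral>\<^sup>+t. ennreal (V (fst t)) \<partial>kernel_power K n s) = (\<integral>\<^sup>+y. ennreal (V y) \<partial>kernel_power P n (fst s))"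
    by (rule nn_integral_lumped_kernel_power[OF P_kernel K_kernel _ K_fst]) auto
  also have "(\<integral>\<^sup>+t. ennreal (V (snd t)) \<partial>kernel_power K n s) = (\<integral>\<^sup>+y. ennreal (V y) \<partial>kernel_power P n (snd s))"
    by (rule nn_integral_lumped_kernel_power[OF P_kernel K_kernel _ K_snd]) auto
  also have "(\<integral>\<^sup>+y. ennreal (V y) \<partial>kernel_power P n (fst s)) + (\<integral>\<^sup>+y. ennreal (V y) \<partial>kernel_power P n (snd s))
     \<le> ennreal (\<kappa> ^ n * V (fst s) + b / (1 - \<kappa>)) + ennreal (\<kappa> ^ n * V (snd s) + b / (1 - \<kappa>))"
    by (intro add_mono power_drift_single)
  also have "\<dots> = ennreal (\<kappa> ^ n * (V (fst s) + V (snd s)) + 2 * b / (1 - \<kappa>))"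
  proof -
    have "\<kappa> ^ n * (V (fst s) + V (snd s)) + 2 * b / (1 - \<kappa>)
        = (\<kappa> ^ n * V (fst s) + b / (1 - \<kappa>)) + (\<kappa> ^ n * V (snd s) + b / (1 - \<kappa>))"
      by (simp add: distrib_left)
    then show ?thesis using pos by (simp only: ennreal_plus)
  qed
  finally show ?thesis .
qed

text \<open>
  Cauchy-Schwarz separates the distance from the Lyapunov function, for which the drift holds.
\<close>

lemma weighted_dist_power_le:
  assumes \<delta>: "0 < \<delta>" and A: "0 \<le> A"
    and d: "(\<integral>\<^sup>+t. ennreal (dist_eps \<epsilon> (fst t) (snd t)) \<partial>kernel_power K n s) \<le> ennreal A"
  shows "(\<integral>\<^sup>+t. ennreal (weighted_dist V \<epsilon> \<delta> t) \<partial>kernel_power K n s)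
    \<le> ennreal (sqrt (A * (1 + \<delta> * (\<kappa> ^ n * (V (fst s) + V (snd s)) + 2 * b / (1 - \<kappa>)))))"
proof -
  have pos: "0 \<le> \<kappa> ^ n * (V (fst s) + V (snd s)) + 2 * b / (1 - \<kappa>)" using constants V_nonneg by auto
  show ?thesis unfolding weighted_dist_def
  proof (rule nn_integral_sqrt_mult_le[OF _ _ _ _ d A])
    show "(\<integral>\<^sup>+t. ennreal (1 + \<delta> * (V (fst t) + V (snd t))) \<partial>kernel_power K n s)
      \<le> ennreal (1 + \<delta> * (\<kappa> ^ n * (V (fst s) + V (snd s)) + 2 * b / (1 - \<kappa>)))"
      using \<delta> V_nonneg pos Kn_prob(2)
      by (intro nn_integral_affine_le Kn_prob power_drift) (auto cong: measurable_cong_sets)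
    show "0 < 1 + \<delta> * (\<kappa> ^ n * (V (fst s) + V (snd s)) + 2 * b / (1 - \<kappa>))"
      using pos \<delta> by (simp add: add_pos_nonneg)
  qed (use \<delta> V_nonneg dist_bounds Kn_prob(2) in \<open>auto cong: measurable_cong_sets simp: add_nonneg_nonneg\<close>)
qed

end

text \<open>
  The constants of the Harris argument. Here \<open>\<beta>\<close> is the additive term of the drift, \<open>q\<close> the contraction of the distance,
  and \<open>B\<close> a value of \<open>S = V x + V y\<close> above which the drift alone decreases \<open>1 + \<delta> * S\<close> by a fixed factor. The weight \<open>\<delta>\<close>
  is so small that the growth \<open>1 + \<delta> * (B + \<beta>)\<close> allowed below \<open>B\<close> does not use up the gain \<open>q\<close>.
\<close>

lemma harris_constants:
  fixes \<kappa> \<beta> c q B :: real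
  assumes "0 \<le> \<kappa>" "\<kappa> < 1" "0 \<le> \<beta>" "0 \<le> q" "q < 1"
    and B: "B = (\<beta> + 1) / (1 - \<kappa>)"
  obtains \<delta> \<alpha> where "0 < \<delta>" "\<delta> \<le> 1" "0 < \<alpha>" "\<alpha> < 1"
    "q * (1 + \<delta> * (B + \<beta>)) \<le> \<alpha>"
    "\<And>S. B \<le> S \<Longrightarrow> 1 + \<delta> * (\<kappa> * S + \<beta>) \<le> \<alpha> * (1 + \<delta> * S)"
proof -
  have B_pos: "B > 0" using assms by (simp add: add_nonneg_pos)
  define \<delta> where "\<delta> = min 1 ((1 - q) / (2 * (B + \<beta>)))"
  have \<delta>: "0 < \<delta>" "\<delta> \<le> 1" using assms(3-5) B_pos by (auto simp: \<delta>_def)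
  have "\<delta> * (B + \<beta>) \<le> (1 - q) / (2 * (B + \<beta>)) * (B + \<beta>)"
    using B_pos assms by (intro mult_right_mono) (auto simp: \<delta>_def)
  also have "\<dots> = (1 - q) / 2" using B_pos assms(3) by (simp add: field_simps)
  finally have "q * (1 + \<delta> * (B + \<beta>)) \<le> q * (1 + (1 - q) / 2)"
    using assms(4) by (intro mult_left_mono) auto
  also have "\<dots> \<le> q + (1 - q) / 2"
  proof -
    have "q * ((1 - q) / 2) \<le> 1 * ((1 - q) / 2)" using assms(4,5) by (intro mult_right_mono) auto
    then show ?thesis by (simp add: distrib_left)
  qed
  also have "\<dots> < 1" using assms(5) by (simp add: field_simps)
  finally have a1: "q * (1 + \<delta> * (B + \<beta>)) < 1" .
  define a2 where "a2 = (1 + \<delta> * (\<kappa> * B + \<beta>)) / (1 + \<delta> * B)"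
  have den: "0 < 1 + \<delta> * B" using \<delta> B_pos by (simp add: add_pos_pos)
  have kB: "\<kappa> * B + \<beta> < B"
  proof -
    have "(1 - \<kappa>) * B = \<beta> + 1" unfolding B using assms(2) by simp
    then show ?thesis by (simp add: algebra_simps)
  qed
  have a2: "a2 < 1" using kB \<delta> den by (simp add: a2_def divide_less_eq)
  have big: "1 + \<delta> * (\<kappa> * S + \<beta>) \<le> a2 * (1 + \<delta> * S)" if "B \<le> S" for S
  proof -
    have "(1 + \<delta> * (\<kappa> * B + \<beta>)) * (1 + \<delta> * S) - (1 + \<delta> * (\<kappa> * S + \<beta>)) * (1 + \<delta> * B)
        = \<delta> * (S - B) * ((1 - \<kappa>) + \<delta> * \<beta>)"
      by (simp add: algebra_simps)
    also have "\<dots> \<ge> 0" using \<delta> that assms by simp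
    finally show ?thesis using den by (simp add: a2_def pos_le_divide_eq)
  qed
  define \<alpha> where "\<alpha> = max (1/2) (max (q * (1 + \<delta> * (B + \<beta>))) a2)"
  show ?thesis
  proof (rule that[OF \<delta>, of \<alpha>])
    fix S assume S: "B \<le> S"
    have "a2 * (1 + \<delta> * S) \<le> \<alpha> * (1 + \<delta> * S)"
      using S B_pos \<delta> by (intro mult_right_mono) (auto simp: \<alpha>_def intro!: add_nonneg_nonneg)
    with big[OF S] show "1 + \<delta> * (\<kappa> * S + \<beta>) \<le> \<alpha> * (1 + \<delta> * S)" by linarith
  qed (use a1 a2 in \<open>auto simp: \<alpha>_def\<close>)
qed

text \<open>
  Three cases. Points closer than \<open>\<epsilon>\<close> gain from the local contraction, and the weight \<open>\<delta>\<close> is too small to undo this.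
  Distant points with \<open>V x + V y \<ge> B\<close> gain from the drift. Distant points with \<open>V x + V y < B\<close> lie in a ball of
  radius \<open>R\<close>; after \<open>N\<close> steps, where \<open>\<rho> ^ N\<close> times the diameter is at most \<open>\<epsilon> / 2\<close>, their mean distance is at
  most \<open>1 - \<gamma> ^ N / 2\<close>.
\<close>

lemma weak_Harris_block:
  fixes V :: "'a::{real_normed_vector, second_countable_topology} \<Rightarrow> real"
  assumes const: "0 < \<epsilon>" "0 \<le> \<kappa>" "\<kappa> < 1" "0 \<le> b" "0 < \<gamma>" "\<gamma> \<le> 1" "0 \<le> \<rho>" "\<rho> < 1" "0 \<le> c" "c < 1"
    and sublevel: "\<And>r. \<exists>R. \<forall>x. V x \<le> r \<longrightarrow> norm x \<le> R"
  obtains \<delta> \<alpha> :: real and N :: nat where "0 < \<delta>" "\<delta> \<le> 1" "0 < \<alpha>" "\<alpha> < 1" "1 \<le> N"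
    "\<And>P K s. contracting_coupling V \<epsilon> \<kappa> b \<gamma> \<rho> c P K \<Longrightarrow>
      (\<integral>\<^sup>+t. ennreal (weighted_dist V \<epsilon> \<delta> t) \<partial>kernel_power K N s) \<le> ennreal (\<alpha> * weighted_dist V \<epsilon> \<delta> s)"
proof -
  define \<beta> where "\<beta> = 2 * b / (1 - \<kappa>)"
  have \<beta>: "0 \<le> \<beta>" using const by (simp add: \<beta>_def)
  define B where "B = (\<beta> + 1) / (1 - \<kappa>)"
  have B: "0 < B" using \<beta> const by (simp add: B_def add_nonneg_pos)
  obtain R0 where R0: "\<And>x. V x \<le> B \<Longrightarrow> norm x \<le> R0" using sublevel by blast
  define R where "R = max R0 1"
  have R: "\<And>x. V x \<le> B \<Longrightarrow> norm x \<le> R" "0 < R"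
    using R0 by (auto simp: R_def intro: max.coboundedI1)
  obtain m where m: "\<rho> ^ m < \<epsilon> / (4 * R)"
    using real_arch_pow_inv[of "\<epsilon> / (4 * R)" \<rho>] const R by auto
  define N where "N = Suc m"
  have "\<rho> ^ N \<le> \<rho> ^ m" using const unfolding N_def by (intro power_decreasing) auto
  with m have "\<rho> ^ N \<le> \<epsilon> / (4 * R)" by simp
  then have N: "\<rho> ^ N * (1 / \<epsilon>) * (2 * R) \<le> 1 / 2" using R const by (simp add: field_simps)
  define q where "q = max c (1 - \<gamma> ^ N / 2)"
  have gN: "0 < \<gamma> ^ N" "\<gamma> ^ N \<le> 1" using const by (auto simp: power_le_one)
  have q: "0 \<le> q" "q < 1" "c \<le> q" "1 - \<gamma> ^ N / 2 \<le> q" using const gN by (auto simp: q_def)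
  obtain \<delta> \<alpha> where da: "0 < \<delta>" "\<delta> \<le> 1" "0 < \<alpha>" "\<alpha> < 1" and small: "q * (1 + \<delta> * (B + \<beta>)) \<le> \<alpha>"
    and large: "\<And>S. B \<le> S \<Longrightarrow> 1 + \<delta> * (\<kappa> * S + \<beta>) \<le> \<alpha> * (1 + \<delta> * S)"
    by (rule harris_constants[OF const(2,3) \<beta> q(1,2) B_def]) (rule that; (assumption | blast))
  show ?thesis
  proof (rule that[of \<delta> "sqrt \<alpha>" N])
    fix P K and s :: "'a \<times> 'a"
    assume "contracting_coupling V \<epsilon> \<kappa> b \<gamma> \<rho> c P K"
    then interpret contracting_coupling V \<epsilon> \<kappa> b \<gamma> \<rho> c P K .
    define S where "S = V (fst s) + V (snd s)"
    define d where "d = dist_eps \<epsilon> (fst s) (snd s)"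
    have S: "0 \<le> S" using V_nonneg by (simp add: S_def)
    have d: "0 \<le> d" "d \<le> 1" using dist_bounds by (auto simp: d_def)
    have kN: "0 \<le> \<kappa> ^ N" "\<kappa> ^ N \<le> 1" "\<kappa> ^ N \<le> \<kappa>"
      using const power_decreasing[of 1 N \<kappa>] by (auto simp: power_le_one N_def)
    have *: "(\<integral>\<^sup>+t. ennreal (weighted_dist V \<epsilon> \<delta> t) \<partial>kernel_power K N s) \<le> ennreal (sqrt \<alpha> * weighted_dist V \<epsilon> \<delta> s)"
      if A: "0 \<le> A" "(\<integral>\<^sup>+t. ennreal (dist_eps \<epsilon> (fst t) (snd t)) \<partial>kernel_power K N s) \<le> ennreal A"
        and le: "A * (1 + \<delta> * (\<kappa> ^ N * S + \<beta>)) \<le> \<alpha> * (d * (1 + \<delta> * S))" for A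
    proof -
      have "sqrt (A * (1 + \<delta> * (\<kappa> ^ N * S + \<beta>))) \<le> sqrt (\<alpha> * (d * (1 + \<delta> * S)))"
        using le by (rule real_sqrt_le_mono)
      also have "\<dots> = sqrt \<alpha> * weighted_dist V \<epsilon> \<delta> s"
        by (simp add: weighted_dist_def real_sqrt_mult S_def d_def)
      finally show ?thesis
        using weighted_dist_power_le[OF da(1) A] by (auto simp: S_def \<beta>_def intro: order_trans ennreal_leI)
    qed
    have dS: "0 \<le> \<delta> * S" using da S by simp
    have mono: "1 + \<delta> * (\<kappa> ^ N * S + \<beta>) \<le> (1 + \<delta> * (B + \<beta>)) * (1 + \<delta> * S)"
    proof -
      have "\<kappa> ^ N * S \<le> 1 * S" using kN S by (intro mult_right_mono) auto
      then have "\<delta> * (\<kappa> ^ N * S + \<beta>) \<le> \<delta> * (S + \<beta>)" using da by (intro mult_left_mono) auto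
      moreover have "0 \<le> \<delta> * B" "0 \<le> \<delta> * (B + \<beta>) * (\<delta> * S)" using da B \<beta> dS by auto
      ultimately show ?thesis by (simp add: algebra_simps)
    qed
    show "(\<integral>\<^sup>+t. ennreal (weighted_dist V \<epsilon> \<delta> t) \<partial>kernel_power K N s) \<le> ennreal (sqrt \<alpha> * weighted_dist V \<epsilon> \<delta> s)"
    proof (cases "norm (fst s - snd s) < \<epsilon>")
      case True
      show ?thesis
      proof (rule *)
        show "(\<integral>\<^sup>+t. ennreal (dist_eps \<epsilon> (fst t) (snd t)) \<partial>kernel_power K N s) \<le> ennreal (c * d)"
          unfolding d_def by (rule power_local_contraction[OF True]) (simp add: N_def)
        have "c * d * (1 + \<delta> * (\<kappa> ^ N * S + \<beta>)) \<le> q * d * ((1 + \<delta> * (B + \<beta>)) * (1 + \<delta> * S))"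
          using mono q d const da kN S \<beta> by (intro mult_mono) auto
        also have "\<dots> = (q * (1 + \<delta> * (B + \<beta>))) * (d * (1 + \<delta> * S))" by (simp add: mult_ac)
        also have "\<dots> \<le> \<alpha> * (d * (1 + \<delta> * S))" using small d dS by (intro mult_right_mono) auto
        finally show "c * d * (1 + \<delta> * (\<kappa> ^ N * S + \<beta>)) \<le> \<dots>" .
      qed (use const d in auto)
    next
      case far: False
      then have d1: "d = 1" using const by (simp add: d_def dist_eps_def)
      show ?thesis
      proof (cases "B \<le> S")
        case True
        show ?thesis
        proof (rule *)
          show "(\<integral>\<^sup>+t. ennreal (dist_eps \<epsilon> (fst t) (snd t)) \<partial>kernel_power K N s) \<le> ennreal 1"
            using dist_le_one by simp
          have "\<delta> * (\<kappa> ^ N * S + \<beta>) \<le> \<delta> * (\<kappa> * S + \<beta>)"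
            using da kN S by (intro mult_left_mono add_right_mono mult_right_mono) auto
          then show "1 * (1 + \<delta> * (\<kappa> ^ N * S + \<beta>)) \<le> \<alpha> * (d * (1 + \<delta> * S))"
            using large[OF True] d1 by simp
        qed simp
      next
        case False
        then have "V (fst s) \<le> B" "V (snd s) \<le> B"
          using V_nonneg[of "fst s"] V_nonneg[of "snd s"] by (auto simp: S_def)
        then have "norm (fst s) \<le> R" "norm (snd s) \<le> R" using R by auto
        then have "norm (fst s - snd s) \<le> 2 * R" using norm_triangle_ineq4[of "fst s" "snd s"] by simp
        then have "\<rho> ^ N * (1 / \<epsilon>) * norm (fst s - snd s) \<le> \<rho> ^ N * (1 / \<epsilon>) * (2 * R)"
          using const by (intro mult_left_mono) auto
        from order_trans[OF this N] have half: "\<rho> ^ N * (1 / \<epsilon>) * norm (fst s - snd s) \<le> 1 / 2" .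
        show ?thesis
        proof (rule *)
          have "(\<integral>\<^sup>+t. ennreal (dist_eps \<epsilon> (fst t) (snd t)) \<partial>kernel_power K N s)
             = (\<integral>\<^sup>+t. ennreal (min 1 (1 / \<epsilon> * norm (fst t - snd t))) \<partial>kernel_power K N s)"
            by (simp add: dist_eps_def)
          also have "\<dots> \<le> ennreal (1 - \<gamma> ^ N + \<gamma> ^ N * min 1 (\<rho> ^ N * (1 / \<epsilon>) * norm (fst s - snd s)))"
            using const by (intro power_closer) auto
          also have "\<dots> \<le> ennreal (1 - \<gamma> ^ N / 2)"
          proof (rule ennreal_leI)
            have "\<gamma> ^ N * min 1 (\<rho> ^ N * (1 / \<epsilon>) * norm (fst s - snd s)) \<le> \<gamma> ^ N * (1 / 2)"
              using gN by (intro mult_left_mono min.coboundedI2 half) auto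
            then show "1 - \<gamma> ^ N + \<gamma> ^ N * min 1 (\<rho> ^ N * (1 / \<epsilon>) * norm (fst s - snd s)) \<le> 1 - \<gamma> ^ N / 2"
              by simp
          qed
          finally show "(\<integral>\<^sup>+t. ennreal (dist_eps \<epsilon> (fst t) (snd t)) \<partial>kernel_power K N s) \<le> ennreal (1 - \<gamma> ^ N / 2)" .
          have "\<kappa> ^ N * S \<le> 1 * B" using kN S False by (intro mult_mono) auto
          then have "1 + \<delta> * (\<kappa> ^ N * S + \<beta>) \<le> 1 + \<delta> * (B + \<beta>)"
            using da by (intro add_left_mono mult_left_mono) auto
          then have "(1 - \<gamma> ^ N / 2) * (1 + \<delta> * (\<kappa> ^ N * S + \<beta>)) \<le> q * (1 + \<delta> * (B + \<beta>))"
            using q gN da kN S \<beta> by (intro mult_mono) auto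
          also have "\<dots> \<le> \<alpha>" by (rule small)
          also have "\<alpha> \<le> \<alpha> * (d * (1 + \<delta> * S))" using da dS d1 by simp
          finally show "(1 - \<gamma> ^ N / 2) * (1 + \<delta> * (\<kappa> ^ N * S + \<beta>)) \<le> \<alpha> * (d * (1 + \<delta> * S))" .
        qed (use gN in auto)
      qed
    qed
  qed (use da in \<open>auto simp: N_def\<close>)
qed

text \<open>
  Blocks of \<open>N\<close> steps contract the distance with weight \<open>\<delta>\<close>, and the remaining steps as well as the change from
  \<open>\<delta>\<close> to weight 1 cost a constant factor. Enlarging the rate per step from \<open>\<theta>\<close> to its square root absorbs this
  factor once \<open>n\<close> is large.
\<close>

lemma weak_Harris_pointwise:
  fixes V :: "'a::{real_normed_vector, second_countable_topology} \<Rightarrow> real"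
  assumes const: "0 < \<epsilon>" "0 \<le> \<kappa>" "\<kappa> < 1" "0 \<le> b" "0 < \<gamma>" "\<gamma> \<le> 1" "0 \<le> \<rho>" "\<rho> < 1" "0 \<le> c" "c < 1"
    and sublevel: "\<And>r. \<exists>R. \<forall>x. V x \<le> r \<longrightarrow> norm x \<le> R"
  obtains \<eta> :: real and n1 :: nat where "0 < \<eta>" "\<eta> < 1"
    "\<And>P K s n. contracting_coupling V \<epsilon> \<kappa> b \<gamma> \<rho> c P K \<Longrightarrow> n1 \<le> n \<Longrightarrow>
      (\<integral>\<^sup>+t. ennreal (dist_eps_V V \<epsilon> (fst t) (snd t)) \<partial>kernel_power K n s)
        \<le> ennreal (\<eta> ^ n * dist_eps_V V \<epsilon> (fst s) (snd s))"
proof -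
  obtain \<delta> \<alpha> :: real and N :: nat where da: "0 < \<delta>" "\<delta> \<le> 1" "0 < \<alpha>" "\<alpha> < 1" "1 \<le> N"
    and block: "\<And>P K s. contracting_coupling V \<epsilon> \<kappa> b \<gamma> \<rho> c P K \<Longrightarrow>
      (\<integral>\<^sup>+t. ennreal (weighted_dist V \<epsilon> \<delta> t) \<partial>kernel_power K N s) \<le> ennreal (\<alpha> * weighted_dist V \<epsilon> \<delta> s)"
    by (rule weak_Harris_block[OF assms]) (rule that; (assumption | blast))
  define \<beta> where "\<beta> = 2 * b / (1 - \<kappa>)"
  have \<beta>: "0 \<le> \<beta>" using const by (simp add: \<beta>_def)
  define G where "G = sqrt (1 + \<delta> * \<beta>)"
  have G: "0 < G" using da \<beta> by (simp add: G_def add_pos_nonneg)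
  define C where "C = G / (sqrt \<delta> * \<alpha>)"
  have C: "0 < C" using G da by (simp add: C_def)
  define \<theta> where "\<theta> = root N \<alpha>"
  have \<theta>: "0 < \<theta>" "\<theta> < 1" "\<theta> ^ N = \<alpha>" using da by (auto simp: \<theta>_def)
  define \<eta> where "\<eta> = sqrt \<theta>"
  have \<eta>: "0 < \<eta>" "\<eta> < 1" "\<eta> * \<eta> = \<theta>" using \<theta> by (auto simp: \<eta>_def)
  obtain n1 where n1: "\<eta> ^ n1 < 1 / C" using real_arch_pow_inv[of "1 / C" \<eta>] C \<eta> by auto
  have rate: "G * \<alpha> ^ (n div N) / sqrt \<delta> \<le> \<eta> ^ n" if "n1 \<le> n" for n
  proof -
    have "n \<le> N * (n div N) + N" using da(5) mod_less_divisor[of N n] mult_div_mod_eq[of N n] by linarith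
    then have "\<theta> ^ (N * (n div N) + N) \<le> \<theta> ^ n" using \<theta> by (intro power_decreasing) auto
    then have "\<alpha> ^ (n div N) * \<alpha> \<le> \<theta> ^ n" by (simp add: power_add power_mult \<theta>(3))
    then have "\<alpha> ^ (n div N) \<le> \<theta> ^ n / \<alpha>" using da by (simp add: field_simps)
    then have "G * \<alpha> ^ (n div N) / sqrt \<delta> \<le> G * (\<theta> ^ n / \<alpha>) / sqrt \<delta>"
      using G da by (intro divide_right_mono mult_left_mono) auto
    also have "\<dots> = (C * \<eta> ^ n) * \<eta> ^ n" by (simp add: C_def \<eta>(3)[symmetric] power_mult_distrib mult_ac)
    also have "\<dots> \<le> 1 * \<eta> ^ n"
    proof (rule mult_right_mono)
      have "\<eta> ^ n \<le> \<eta> ^ n1" using \<eta> that by (intro power_decreasing) auto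
      then have "C * \<eta> ^ n \<le> C * \<eta> ^ n1" using C by simp
      also have "\<dots> \<le> 1" using n1 C by (simp add: field_simps)
      finally show "C * \<eta> ^ n \<le> 1" .
    qed (use \<eta> in auto)
    finally show ?thesis by simp
  qed
  show ?thesis
  proof (rule that[OF \<eta>(1,2), of n1])
    fix P K n and s :: "'a \<times> 'a"
    assume cc: "contracting_coupling V \<epsilon> \<kappa> b \<gamma> \<rho> c P K" and n: "n1 \<le> n"
    interpret contracting_coupling V \<epsilon> \<kappa> b \<gamma> \<rho> c P K by (rule cc)
    define D where "D = weighted_dist V \<epsilon> \<delta>"
    have D_meas [measurable]: "D \<in> borel_measurable borel" unfolding D_def weighted_dist_def by measurable
    have W: "0 \<le> V x + V y" for x y using V_nonneg by simp
    have D_nonneg: "0 \<le> D s" for s unfolding D_def weighted_dist_def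
      using dist_bounds da W by (intro real_sqrt_ge_zero mult_nonneg_nonneg add_nonneg_nonneg[of 1]) auto
    have lower: "D s \<le> dist_eps_V V \<epsilon> (fst s) (snd s)" for s
    proof -
      have "\<delta> * (V (fst s) + V (snd s)) \<le> 1 * (V (fst s) + V (snd s))" using da W by (intro mult_right_mono) auto
      then show ?thesis unfolding D_def weighted_dist_def dist_eps_V_def
        using dist_bounds by (intro real_sqrt_le_mono mult_left_mono) auto
    qed
    have upper: "dist_eps_V V \<epsilon> (fst s) (snd s) \<le> 1 / sqrt \<delta> * D s" for s
    proof -
      have "1 + V (fst s) + V (snd s) \<le> 1 / \<delta> * (1 + \<delta> * (V (fst s) + V (snd s)))"
        using da by (simp add: field_simps)
      then have "dist_eps \<epsilon> (fst s) (snd s) * (1 + V (fst s) + V (snd s))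
          \<le> dist_eps \<epsilon> (fst s) (snd s) * (1 / \<delta> * (1 + \<delta> * (V (fst s) + V (snd s))))"
        using dist_bounds by (intro mult_left_mono) auto
      then have "dist_eps_V V \<epsilon> (fst s) (snd s) \<le> sqrt (1 / \<delta> * (dist_eps \<epsilon> (fst s) (snd s) * (1 + \<delta> * (V (fst s) + V (snd s)))))"
        unfolding dist_eps_V_def by (intro real_sqrt_le_mono) (simp add: mult_ac)
      then show ?thesis by (simp add: D_def weighted_dist_def real_sqrt_mult real_sqrt_divide)
    qed
    have few: "(\<integral>\<^sup>+t. ennreal (D t) \<partial>kernel_power K r s) \<le> ennreal (G * D s)" for r s
    proof -
      define S where "S = V (fst s) + V (snd s)"
      have S: "0 \<le> S" using W by (simp add: S_def)
      have "\<kappa> ^ r * S \<le> 1 * S" using const S by (intro mult_right_mono power_le_one) auto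
      then have "\<delta> * (\<kappa> ^ r * S + \<beta>) \<le> \<delta> * (S + \<beta>)" using da by (intro mult_left_mono) auto
      moreover have "0 \<le> \<delta> * \<beta> * (\<delta> * S)" using da \<beta> S by auto
      ultimately have "1 + \<delta> * (\<kappa> ^ r * S + \<beta>) \<le> (1 + \<delta> * \<beta>) * (1 + \<delta> * S)" by (simp add: algebra_simps)
      then have "dist_eps \<epsilon> (fst s) (snd s) * (1 + \<delta> * (\<kappa> ^ r * S + \<beta>))
          \<le> dist_eps \<epsilon> (fst s) (snd s) * ((1 + \<delta> * \<beta>) * (1 + \<delta> * S))"
        by (rule mult_left_mono) (rule dist_bounds)
      then have "dist_eps \<epsilon> (fst s) (snd s) * (1 + \<delta> * (\<kappa> ^ r * S + \<beta>))
          \<le> (1 + \<delta> * \<beta>) * (dist_eps \<epsilon> (fst s) (snd s) * (1 + \<delta> * S))"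
        by (simp only: mult.left_commute)
      then have "sqrt (dist_eps \<epsilon> (fst s) (snd s) * (1 + \<delta> * (\<kappa> ^ r * S + \<beta>))) \<le> G * D s"
        unfolding G_def D_def weighted_dist_def S_def real_sqrt_mult[symmetric] by (rule real_sqrt_le_mono)
      moreover have "(\<integral>\<^sup>+t. ennreal (D t) \<partial>kernel_power K r s)
          \<le> ennreal (sqrt (dist_eps \<epsilon> (fst s) (snd s) * (1 + \<delta> * (\<kappa> ^ r * S + \<beta>))))"
        unfolding D_def S_def \<beta>_def
        by (rule weighted_dist_power_le[OF da(1) dist_bounds(1) power_dist_nonincreasing])
      ultimately show ?thesis by (auto intro: order_trans ennreal_leI)
    qed
    have blocks: "(\<integral>\<^sup>+t. ennreal (D t) \<partial>kernel_power K (k * N + r) s) \<le> ennreal (\<alpha> ^ k * (G * D s))" for k r s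
    proof (induction k arbitrary: s)
      case 0
      then show ?case using few by simp
    next
      case (Suc k)
      have "(\<integral>\<^sup>+t. ennreal (D t) \<partial>kernel_power K (Suc k * N + r) s)
          = (\<integral>\<^sup>+u. (\<integral>\<^sup>+t. ennreal (D t) \<partial>kernel_power K (k * N + r) u) \<partial>kernel_power K N s)"
        using nn_integral_kernel_power_add[OF K_kernel, of "\<lambda>t. ennreal (D t)" N "k * N + r" s]
        by (simp add: add.assoc)
      also have "\<dots> \<le> (\<integral>\<^sup>+u. ennreal (\<alpha> ^ k * G) * ennreal (D u) \<partial>kernel_power K N s)"
        using Suc.IH G da D_nonneg by (intro nn_integral_mono) (simp add: ennreal_mult[symmetric] mult.assoc)
      also have "\<dots> = ennreal (\<alpha> ^ k * G) * (\<integral>\<^sup>+u. ennreal (D u) \<partial>kernel_power K N s)"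
        using Kn_prob(2) by (intro nn_integral_cmult) (simp cong: measurable_cong_sets)
      also have "\<dots> \<le> ennreal (\<alpha> ^ k * G) * ennreal (\<alpha> * D s)"
        unfolding D_def by (intro mult_left_mono block[OF cc]) auto
      also have "\<dots> = ennreal (\<alpha> ^ Suc k * (G * D s))"
        using da G D_nonneg by (simp add: ennreal_mult[symmetric] mult_ac)
      finally show ?case .
    qed
    have "(\<integral>\<^sup>+t. ennreal (dist_eps_V V \<epsilon> (fst t) (snd t)) \<partial>kernel_power K n s)
        \<le> (\<integral>\<^sup>+t. ennreal (1 / sqrt \<delta>) * ennreal (D t) \<partial>kernel_power K n s)"
      using upper D_nonneg da by (intro nn_integral_mono) (simp add: ennreal_mult[symmetric] ennreal_leI)
    also have "\<dots> = ennreal (1 / sqrt \<delta>) * (\<integral>\<^sup>+t. ennreal (D t) \<partial>kernel_power K n s)"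
      using Kn_prob(2) by (intro nn_integral_cmult) (simp cong: measurable_cong_sets)
    also have "\<dots> \<le> ennreal (1 / sqrt \<delta>) * ennreal (\<alpha> ^ (n div N) * (G * D s))"
      using blocks[of "n div N" "n mod N" s] by (intro mult_left_mono) auto
    also have "\<dots> = ennreal (G * \<alpha> ^ (n div N) / sqrt \<delta> * D s)"
      using da G D_nonneg by (simp add: ennreal_mult[symmetric] mult_ac)
    also have "\<dots> \<le> ennreal (\<eta> ^ n * dist_eps_V V \<epsilon> (fst s) (snd s))"
      using rate[OF n] lower[of s] D_nonneg[of s] \<eta> by (intro ennreal_leI mult_mono) auto
    finally show "(\<integral>\<^sup>+t. ennreal (dist_eps_V V \<epsilon> (fst t) (snd t)) \<partial>kernel_power K n s)
        \<le> ennreal (\<eta> ^ n * dist_eps_V V \<epsilon> (fst s) (snd s))" .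
  qed
qed

text \<open>
  If \<open>\<pi>\<close> couples the initial laws, then \<open>bind \<pi> (kernel_power K n)\<close> couples the laws after \<open>n\<close> steps; take the
  infimum over \<open>\<pi>\<close>.
\<close>

lemma wasserstein_le_coupling_kernel:
  fixes P :: "'a::second_countable_topology \<Rightarrow> 'a measure"
  assumes P: "P \<in> borel \<rightarrow>\<^sub>M prob_algebra borel" and K: "K \<in> borel \<rightarrow>\<^sub>M prob_algebra borel"
    and K_fst: "\<And>s. distr (K s) borel fst = P (fst s)" and K_snd: "\<And>s. distr (K s) borel snd = P (snd s)"
    and d_meas: "(\<lambda>t. d (fst t) (snd t)) \<in> borel_measurable borel" and d: "\<And>x y. 0 \<le> d x y"
    and r: "0 < r"
    and contr: "\<And>s. (\<integral>\<^sup>+t. ennreal (d (fst t) (snd t)) \<partial>kernel_power K n s) \<le> ennreal (r * d (fst s) (snd s))"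
  shows "wasserstein d (bind \<nu>1 (kernel_power P n)) (bind \<nu>2 (kernel_power P n)) \<le> ennreal r * wasserstein d \<nu>1 \<nu>2"
proof -
  have fs [measurable]: "fst \<in> borel_measurable (borel :: ('a \<times> 'a) measure)"
    "snd \<in> borel_measurable (borel :: ('a \<times> 'a) measure)"
    by (simp_all add: borel_prod[symmetric])
  note Kn = kernel_power_measurable[OF K, of n]
  have ed: "(\<lambda>t. ennreal (d (fst t) (snd t))) \<in> borel_measurable borel"
    by (rule measurable_compose[OF d_meas measurable_ennreal])
  have step: "wasserstein d (bind \<nu>1 (kernel_power P n)) (bind \<nu>2 (kernel_power P n))
      \<le> ennreal r * (\<integral>\<^sup>+ (x, y). ennreal (d x y) \<partial>\<pi>)" if "\<pi> \<in> couplings \<nu>1 \<nu>2" for \<pi>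
  proof -
    have pi: "prob_space \<pi>" "sets \<pi> = sets borel" "distr \<pi> borel fst = \<nu>1" "distr \<pi> borel snd = \<nu>2"
      using that unfolding couplings_def borel_prod by blast+
    have pi_in: "\<pi> \<in> space (prob_algebra borel)" using pi(1,2) by (simp add: space_prob_algebra)
    have Kn': "kernel_power K n \<in> \<pi> \<rightarrow>\<^sub>M subprob_algebra borel"
      using measurable_prob_algebraD[OF Kn] pi(2) by (simp cong: measurable_cong_sets)
    have "bind \<pi> (kernel_power K n) \<in> couplings (bind \<nu>1 (kernel_power P n)) (bind \<nu>2 (kernel_power P n))"
      unfolding couplings_def borel_prod
    proof (intro CollectI conjI)
      show "prob_space (bind \<pi> (kernel_power K n))" by (rule prob_space_bind'[OF pi_in Kn])
      show "sets (bind \<pi> (kernel_power K n)) = sets borel" by (rule sets_bind'[OF pi_in Kn])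
      show "distr (bind \<pi> (kernel_power K n)) borel fst = bind \<nu>1 (kernel_power P n)"
        unfolding pi(3)[symmetric] by (rule distr_bind_lumped_kernel[OF P K fs(1) K_fst pi(1,2)])
      show "distr (bind \<pi> (kernel_power K n)) borel snd = bind \<nu>2 (kernel_power P n)"
        unfolding pi(4)[symmetric] by (rule distr_bind_lumped_kernel[OF P K fs(2) K_snd pi(1,2)])
    qed
    then have "wasserstein d (bind \<nu>1 (kernel_power P n)) (bind \<nu>2 (kernel_power P n))
        \<le> (\<integral>\<^sup>+ (x, y). ennreal (d x y) \<partial>bind \<pi> (kernel_power K n))"
      unfolding wasserstein_def by (rule INF_lower)
    also have "\<dots> = (\<integral>\<^sup>+s. (\<integral>\<^sup>+t. ennreal (d (fst t) (snd t)) \<partial>kernel_power K n s) \<partial>\<pi>)"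
      unfolding case_prod_unfold by (rule nn_integral_bind[OF ed Kn'])
    also have "\<dots> \<le> (\<integral>\<^sup>+s. ennreal r * ennreal (d (fst s) (snd s)) \<partial>\<pi>)"
      using contr r d by (intro nn_integral_mono) (simp add: ennreal_mult[symmetric])
    also have "\<dots> = ennreal r * (\<integral>\<^sup>+s. ennreal (d (fst s) (snd s)) \<partial>\<pi>)"
      using ed pi(2) by (intro nn_integral_cmult) (simp cong: measurable_cong_sets)
    finally show ?thesis by (simp add: case_prod_unfold)
  qed
  have "wasserstein d (bind \<nu>1 (kernel_power P n)) (bind \<nu>2 (kernel_power P n)) / ennreal r \<le> wasserstein d \<nu>1 \<nu>2"
    unfolding wasserstein_def[of d \<nu>1 \<nu>2]
    using step r by (intro INF_greatest divide_le_posI_ennreal) (auto simp: mult.commute)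
  then have "ennreal r * (wasserstein d (bind \<nu>1 (kernel_power P n)) (bind \<nu>2 (kernel_power P n)) / ennreal r)
      \<le> ennreal r * wasserstein d \<nu>1 \<nu>2"
    by (rule mult_left_mono) simp
  moreover have "ennreal r * (w / ennreal r) = w" for w
  proof -
    have "ennreal r * (w / ennreal r) = w * ennreal r / ennreal r"
      by (simp only: ennreal_times_divide mult.commute)
    also have "\<dots> = w" using r by (intro ennreal_mult_divide_eq) auto
    finally show ?thesis .
  qed
  ultimately show ?thesis by simp
qed


section \<open>Finite mixtures of random maps\<close>

text \<open>
  The law of \<open>F \<omega> i\<close>, where \<open>\<omega>\<close> is drawn from \<open>M\<close> and then the index \<open>i\<close> with probability \<open>w \<omega> i\<close>. Both kernels, and the
  coupling of a kernel with itself, have this form.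
\<close>

definition mixture ::
    "'w measure \<Rightarrow> 'i set \<Rightarrow> ('w \<Rightarrow> 'i \<Rightarrow> real) \<Rightarrow> ('w \<Rightarrow> 'i \<Rightarrow> 's::topological_space) \<Rightarrow> 's measure" where
  "mixture M I w F =
     distr (density (count_space I \<Otimes>\<^sub>M M) (\<lambda>(i, \<omega>). ennreal (w \<omega> i))) borel (\<lambda>(i, \<omega>). F \<omega> i)"

lemma sets_mixture [simp]: "sets (mixture M I w F) = sets borel"
  by (simp add: mixture_def)

lemma nn_integral_mixture:
  assumes M: "prob_space M" and I: "finite I"
    and w: "\<And>i. i \<in> I \<Longrightarrow> (\<lambda>\<omega>. w \<omega> i) \<in> borel_measurable M"
    and F: "\<And>i. i \<in> I \<Longrightarrow> (\<lambda>\<omega>. F \<omega> i) \<in> M \<rightarrow>\<^sub>M borel"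
    and h [measurable]: "h \<in> borel_measurable borel"
  shows "(\<integral>\<^sup>+y. h y \<partial>mixture M I w F) = (\<Sum>i\<in>I. \<integral>\<^sup>+\<omega>. ennreal (w \<omega> i) * h (F \<omega> i) \<partial>M)"
proof -
  interpret prob_space M by fact
  have cI: "countable I" using I by (rule countable_finite)
  have wm [measurable]: "(\<lambda>(i, \<omega>). ennreal (w \<omega> i)) \<in> borel_measurable (count_space I \<Otimes>\<^sub>M M)"
    using w by (intro measurable_pair_measure_countable1[OF cI]) simp
  have Fm [measurable]: "(\<lambda>(i, \<omega>). F \<omega> i) \<in> count_space I \<Otimes>\<^sub>M M \<rightarrow>\<^sub>M borel"
    using F by (intro measurable_pair_measure_countable1[OF cI]) simp
  have "(\<integral>\<^sup>+y. h y \<partial>mixture M I w F)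
      = (\<integral>\<^sup>+z. (case z of (i, \<omega>) \<Rightarrow> ennreal (w \<omega> i)) * h (case z of (i, \<omega>) \<Rightarrow> F \<omega> i) \<partial>(count_space I \<Otimes>\<^sub>M M))"
    unfolding mixture_def by (subst nn_integral_distr) (auto simp: nn_integral_density)
  also have "\<dots> = (\<integral>\<^sup>+i. \<integral>\<^sup>+\<omega>. ennreal (w \<omega> i) * h (F \<omega> i) \<partial>M \<partial>count_space I)"
    by (subst nn_integral_fst[symmetric]) auto
  also have "\<dots> = (\<Sum>i\<in>I. \<integral>\<^sup>+\<omega>. ennreal (w \<omega> i) * h (F \<omega> i) \<partial>M)"
    using I by (rule nn_integral_count_space_finite)
  finally show ?thesis .
qed

lemma prob_space_mixture:
  assumes M: "prob_space M" and I: "finite I"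
    and w: "\<And>i. i \<in> I \<Longrightarrow> (\<lambda>\<omega>. w \<omega> i) \<in> borel_measurable M"
    and F: "\<And>i. i \<in> I \<Longrightarrow> (\<lambda>\<omega>. F \<omega> i) \<in> M \<rightarrow>\<^sub>M borel"
    and nonneg: "\<And>\<omega> i. i \<in> I \<Longrightarrow> 0 \<le> w \<omega> i" and total: "\<And>\<omega>. (\<Sum>i\<in>I. w \<omega> i) = 1"
  shows "prob_space (mixture M I w F)"
proof
  interpret prob_space M by fact
  have "emeasure (mixture M I w F) (space (mixture M I w F)) = (\<integral>\<^sup>+y. 1 \<partial>mixture M I w F)"
    by simp
  also have "\<dots> = (\<Sum>i\<in>I. \<integral>\<^sup>+\<omega>. ennreal (w \<omega> i) \<partial>M)"
    by (subst nn_integral_mixture[OF M I w F]) auto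
  also have "\<dots> = (\<integral>\<^sup>+\<omega>. (\<Sum>i\<in>I. ennreal (w \<omega> i)) \<partial>M)"
    using w by (intro nn_integral_sum[symmetric]) auto
  also have "\<dots> = 1"
    using nonneg total by (simp add: sum_ennreal emeasure_space_1)
  finally show "emeasure (mixture M I w F) (space (mixture M I w F)) = 1" .
qed

lemma mixture_kernel:
  fixes w :: "'c::topological_space \<Rightarrow> 'w \<Rightarrow> 'i \<Rightarrow> real" and F :: "'c \<Rightarrow> 'w \<Rightarrow> 'i \<Rightarrow> 's::topological_space"
  assumes M: "prob_space M" and I: "finite I"
    and w: "\<And>i. i \<in> I \<Longrightarrow> (\<lambda>(s, \<omega>). w s \<omega> i) \<in> borel_measurable (borel \<Otimes>\<^sub>M M)"
    and F: "\<And>i. i \<in> I \<Longrightarrow> (\<lambda>(s, \<omega>). F s \<omega> i) \<in> borel \<Otimes>\<^sub>M M \<rightarrow>\<^sub>M borel"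
    and nonneg: "\<And>s \<omega> i. i \<in> I \<Longrightarrow> 0 \<le> w s \<omega> i" and total: "\<And>s \<omega>. (\<Sum>i\<in>I. w s \<omega> i) = 1"
  shows "(\<lambda>s. mixture M I (w s) (F s)) \<in> borel \<rightarrow>\<^sub>M prob_algebra borel"
proof (rule measurable_prob_algebraI)
  interpret prob_space M by fact
  have wm: "(\<lambda>\<omega>. w s \<omega> i) \<in> borel_measurable M" if "i \<in> I" for s i
    using measurable_compose_Pair1[OF _ w[OF that], of s] by simp
  have Fm: "(\<lambda>\<omega>. F s \<omega> i) \<in> M \<rightarrow>\<^sub>M borel" if "i \<in> I" for s i
    using measurable_compose_Pair1[OF _ F[OF that], of s] by simp
  show p: "prob_space (mixture M I (w s) (F s))" for s
    by (rule prob_space_mixture[OF M I wm Fm nonneg total])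
  show "(\<lambda>s. mixture M I (w s) (F s)) \<in> borel \<rightarrow>\<^sub>M subprob_algebra borel"
  proof (rule measurable_subprob_algebra)
    show "subprob_space (mixture M I (w s) (F s))" for s
      using p by (rule prob_space_imp_subprob_space)
    fix A :: "'s set" assume A[measurable]: "A \<in> sets borel"
    have "emeasure (mixture M I (w s) (F s)) A = (\<Sum>i\<in>I. \<integral>\<^sup>+\<omega>. ennreal (w s \<omega> i) * indicator A (F s \<omega> i) \<partial>M)" for s
      using nn_integral_mixture[OF M I wm Fm, where h = "indicator A"] by simp
    moreover have "(\<lambda>s. \<Sum>i\<in>I. \<integral>\<^sup>+\<omega>. ennreal (w s \<omega> i) * indicator A (F s \<omega> i) \<partial>M) \<in> borel_measurable borel"
    proof (rule borel_measurable_sum)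
      fix i assume "i \<in> I"
      note [measurable] = w[OF this] F[OF this]
      show "(\<lambda>s. \<integral>\<^sup>+\<omega>. ennreal (w s \<omega> i) * indicator A (F s \<omega> i) \<partial>M) \<in> borel_measurable borel"
        by measurable
    qed
    ultimately show "(\<lambda>s. emeasure (mixture M I (w s) (F s)) A) \<in> borel_measurable borel" by simp
  qed simp
qed

text \<open>
  Indices with the same image can be merged if the image under \<open>g\<close> only depends on the merged index. With \<open>g = k = fst\<close>
  or \<open>g = k = snd\<close> this computes the marginals of a coupling.
\<close>

lemma distr_mixture_lump:
  fixes g :: "'s::topological_space \<Rightarrow> 't::topological_space"
  assumes M: "prob_space M" and fin: "finite J" "finite I"
    and w: "\<And>j. j \<in> J \<Longrightarrow> (\<lambda>\<omega>. w \<omega> j) \<in> borel_measurable M"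
    and F: "\<And>j. j \<in> J \<Longrightarrow> (\<lambda>\<omega>. F \<omega> j) \<in> M \<rightarrow>\<^sub>M borel"
    and w': "\<And>i. i \<in> I \<Longrightarrow> (\<lambda>\<omega>. w' \<omega> i) \<in> borel_measurable M"
    and F': "\<And>i. i \<in> I \<Longrightarrow> (\<lambda>\<omega>. F' \<omega> i) \<in> M \<rightarrow>\<^sub>M borel"
    and nonneg: "\<And>\<omega> j. j \<in> J \<Longrightarrow> 0 \<le> w \<omega> j"
    and g: "g \<in> borel \<rightarrow>\<^sub>M borel" and k: "k ` J \<subseteq> I"
    and map: "\<And>\<omega> j. j \<in> J \<Longrightarrow> g (F \<omega> j) = F' \<omega> (k j)"
    and total: "\<And>\<omega> i. i \<in> I \<Longrightarrow> (\<Sum>j | j \<in> J \<and> k j = i. w \<omega> j) = w' \<omega> i"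
  shows "distr (mixture M J w F) borel g = mixture M I w' F'"
proof (rule measure_eqI)
  fix A assume "A \<in> sets (distr (mixture M J w F) borel g)"
  then have A: "A \<in> sets borel" by simp
  have gm: "g \<in> mixture M J w F \<rightarrow>\<^sub>M borel" using g by (simp cong: measurable_cong_sets)
  have gA: "(\<lambda>y. indicator A (g y) :: ennreal) \<in> borel_measurable borel"
    by (rule measurable_compose[OF g borel_measurable_indicator[OF A]])
  have "emeasure (distr (mixture M J w F) borel g) A = (\<integral>\<^sup>+y. indicator A (g y) \<partial>mixture M J w F)"
    using nn_integral_distr[OF gm, of "indicator A"] A by simp
  also have "\<dots> = (\<Sum>j\<in>J. \<integral>\<^sup>+\<omega>. ennreal (w \<omega> j) * indicator A (F' \<omega> (k j)) \<partial>M)"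
    by (subst nn_integral_mixture[OF M fin(1) w F gA]) (auto simp: map)
  also have "\<dots> = (\<Sum>i\<in>I. \<Sum>j | j \<in> J \<and> k j = i. \<integral>\<^sup>+\<omega>. ennreal (w \<omega> j) * indicator A (F' \<omega> (k j)) \<partial>M)"
    by (rule sum.group[OF fin k, symmetric])
  also have "\<dots> = (\<Sum>i\<in>I. \<integral>\<^sup>+\<omega>. ennreal (w' \<omega> i) * indicator A (F' \<omega> i) \<partial>M)"
  proof (rule sum.cong[OF refl])
    fix i assume i: "i \<in> I"
    have "(\<Sum>j | j \<in> J \<and> k j = i. \<integral>\<^sup>+\<omega>. ennreal (w \<omega> j) * indicator A (F' \<omega> (k j)) \<partial>M)
        = (\<Sum>j | j \<in> J \<and> k j = i. \<integral>\<^sup>+\<omega>. ennreal (w \<omega> j) * indicator A (F' \<omega> i) \<partial>M)"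
      by (intro sum.cong refl) simp
    also have "\<dots> = (\<integral>\<^sup>+\<omega>. (\<Sum>j | j \<in> J \<and> k j = i. ennreal (w \<omega> j) * indicator A (F' \<omega> i)) \<partial>M)"
      using w by (intro nn_integral_sum[symmetric] borel_measurable_times_ennreal
        measurable_compose[OF F'[OF i] borel_measurable_indicator[OF A]]) auto
    also have "\<dots> = (\<integral>\<^sup>+\<omega>. ennreal (w' \<omega> i) * indicator A (F' \<omega> i) \<partial>M)"
      unfolding sum_distrib_right[symmetric] total[OF i, symmetric]
      using nonneg by (intro nn_integral_cong arg_cong2[where f = "(*)"] sum_ennreal) auto
    finally show "(\<Sum>j | j \<in> J \<and> k j = i. \<integral>\<^sup>+\<omega>. ennreal (w \<omega> j) * indicator A (F' \<omega> (k j)) \<partial>M)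
        = (\<integral>\<^sup>+\<omega>. ennreal (w' \<omega> i) * indicator A (F' \<omega> i) \<partial>M)" .
  qed
  also have "\<dots> = emeasure (mixture M I w' F') A"
    using nn_integral_mixture[OF M fin(2) w' F', where h = "indicator A"] A by simp
  finally show "emeasure (distr (mixture M J w F) borel g) A = emeasure (mixture M I w' F') A" .
qed simp

section \<open>Maximal couplings of finite distributions\<close>

text \<open>
  The overlap of the two distributions sits on the diagonal, and the remaining masses are coupled independently. For equal
  distributions there is no remaining mass, and the convention \<open>0 / 0 = 0\<close> gives the right value.
\<close>

definition maximal_coupling :: "'i set \<Rightarrow> ('i \<Rightarrow> real) \<Rightarrow> ('i \<Rightarrow> real) \<Rightarrow> 'i \<times> 'i \<Rightarrow> real" where
  "maximal_coupling I a b = (\<lambda>(i, j). (if i = j then min (a i) (b i) else 0) +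
     (a i - min (a i) (b i)) * (b j - min (a j) (b j)) / (1 - (\<Sum>k\<in>I. min (a k) (b k))))"

context
  fixes I :: "'i set" and a b :: "'i \<Rightarrow> real"
  assumes I: "finite I" and a: "(\<Sum>i\<in>I. a i) = 1" "\<And>i. i \<in> I \<Longrightarrow> 0 \<le> a i"
    and b: "(\<Sum>i\<in>I. b i) = 1" "\<And>i. i \<in> I \<Longrightarrow> 0 \<le> b i"
begin

lemma min_sum_le_1: "(\<Sum>k\<in>I. min (a k) (b k)) \<le> 1"
  using sum_mono[of I "\<lambda>k. min (a k) (b k)" a] a(1) by simp

lemma maximal_coupling_nonneg: "i \<in> I \<Longrightarrow> j \<in> I \<Longrightarrow> 0 \<le> maximal_coupling I a b (i, j)"
  using min_sum_le_1 a(2) b(2) by (auto simp: maximal_coupling_def intro!: add_nonneg_nonneg divide_nonneg_nonneg mult_nonneg_nonneg)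

lemma maximal_coupling_fst: "i \<in> I \<Longrightarrow> (\<Sum>j\<in>I. maximal_coupling I a b (i, j)) = a i"
proof -
  assume i: "i \<in> I"
  define q where "q = 1 - (\<Sum>k\<in>I. min (a k) (b k))"
  have "(\<Sum>j\<in>I. maximal_coupling I a b (i, j)) = min (a i) (b i) + (a i - min (a i) (b i)) * (\<Sum>j\<in>I. b j - min (a j) (b j)) / q"
    using I i by (simp add: maximal_coupling_def sum.distrib sum_distrib_left sum_divide_distrib q_def)
  also have "(\<Sum>j\<in>I. b j - min (a j) (b j)) = q" using b(1) by (simp add: sum_subtractf q_def)
  also have "min (a i) (b i) + (a i - min (a i) (b i)) * q / q = a i"
  proof (cases "q = 0")
    case True
    then have "(\<Sum>j\<in>I. a j - min (a j) (b j)) = 0" using a(1) by (simp add: sum_subtractf q_def)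
    then have "a i - min (a i) (b i) = 0"
      using I i by (subst (asm) sum_nonneg_eq_0_iff) auto
    then show ?thesis by simp
  qed simp
  finally show ?thesis .
qed

lemma maximal_coupling_snd: "j \<in> I \<Longrightarrow> (\<Sum>i\<in>I. maximal_coupling I a b (i, j)) = b j"
proof -
  assume j: "j \<in> I"
  define q where "q = 1 - (\<Sum>k\<in>I. min (a k) (b k))"
  have "(\<Sum>i\<in>I. maximal_coupling I a b (i, j)) = min (a j) (b j) + (\<Sum>i\<in>I. a i - min (a i) (b i)) * (b j - min (a j) (b j)) / q"
    using I j by (simp add: maximal_coupling_def sum.distrib sum_distrib_right sum_divide_distrib q_def)
  also have "(\<Sum>i\<in>I. a i - min (a i) (b i)) = q" using a(1) by (simp add: sum_subtractf q_def)
  also have "min (a j) (b j) + q * (b j - min (a j) (b j)) / q = b j"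
  proof (cases "q = 0")
    case True
    then have "(\<Sum>j\<in>I. b j - min (a j) (b j)) = 0" using b(1) by (simp add: sum_subtractf q_def)
    then have "b j - min (a j) (b j) = 0"
      using I j by (subst (asm) sum_nonneg_eq_0_iff) auto
    then show ?thesis by simp
  qed simp
  finally show ?thesis .
qed

text \<open>
  The part off the overlap has total mass one minus the overlap.
\<close>

lemma maximal_coupling_cost_le:
  assumes h: "\<And>i j. i \<in> I \<Longrightarrow> j \<in> I \<Longrightarrow> h (i, j) \<le> 1"
  shows "(\<Sum>z\<in>I \<times> I. maximal_coupling I a b z * h z)
    \<le> (\<Sum>i\<in>I. min (a i) (b i) * h (i, i)) + (1 - (\<Sum>k\<in>I. min (a k) (b k)))"
proof -
  define q where "q = 1 - (\<Sum>k\<in>I. min (a k) (b k))"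
  define r where "r i j = (a i - min (a i) (b i)) * (b j - min (a j) (b j)) / q" for i j
  have q: "0 \<le> q" using min_sum_le_1 by (simp add: q_def)
  have "(\<Sum>z\<in>I \<times> I. maximal_coupling I a b z * h z)
      = (\<Sum>i\<in>I. \<Sum>j\<in>I. (if i = j then min (a i) (b i) * h (i, i) else 0) + r i j * h (i, j))"
    unfolding sum.cartesian_product
    by (intro sum.cong refl) (auto simp: maximal_coupling_def r_def q_def distrib_right)
  also have "\<dots> = (\<Sum>i\<in>I. min (a i) (b i) * h (i, i)) + (\<Sum>i\<in>I. \<Sum>j\<in>I. r i j * h (i, j))"
    using I by (simp add: sum.distrib)
  also have "(\<Sum>i\<in>I. \<Sum>j\<in>I. r i j * h (i, j)) \<le> (\<Sum>i\<in>I. \<Sum>j\<in>I. r i j)"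
    using h q by (intro sum_mono mult_left_le) (auto simp: r_def)
  also have "(\<Sum>i\<in>I. \<Sum>j\<in>I. r i j) = (\<Sum>i\<in>I. a i - min (a i) (b i)) * (\<Sum>j\<in>I. b j - min (a j) (b j)) / q"
    by (simp add: r_def sum_product sum_divide_distrib)
  also have "\<dots> = q * q / q" using a(1) b(1) by (simp add: sum_subtractf q_def)
  also have "\<dots> = q" by simp
  finally show ?thesis by (simp add: q_def)
qed

end

section \<open>Random contractions with the option to stay\<close>

text \<open>
  One step of a chain that draws a noise \<open>\<omega>\<close> and then either stays, which is index 0, or applies one of the \<open>p\<close>
  contractions \<open>F _ \<omega> j\<close>. A single weight is only of order \<open>1 / p\<close>; what counts is that the weights of the moves
  add up to at least \<open>\<gamma>\<close> for every \<open>p\<close>. The weight of staying is controlled through the other weights.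
\<close>

locale lazy_random_contraction = prob_space M for M :: "'w measure" +
  fixes p :: nat and w :: "'a::{real_normed_vector, second_countable_topology} \<Rightarrow> 'w \<Rightarrow> nat \<Rightarrow> real"
    and F :: "'a \<Rightarrow> 'w \<Rightarrow> nat \<Rightarrow> 'a" and \<rho> \<gamma> l :: real
  assumes constants: "1 \<le> p" "0 \<le> \<rho>" "\<rho> < 1" "0 < \<gamma>" "\<gamma> \<le> 1" "0 \<le> l"
    and w_measurable: "\<And>j. j \<in> {0..p} \<Longrightarrow> (\<lambda>(x, \<omega>). w x \<omega> j) \<in> borel_measurable (borel \<Otimes>\<^sub>M M)"
    and F_measurable: "\<And>j. j \<in> {0..p} \<Longrightarrow> (\<lambda>(x, \<omega>). F x \<omega> j) \<in> borel \<Otimes>\<^sub>M M \<rightarrow>\<^sub>M borel"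
    and w_nonneg: "\<And>x \<omega> j. j \<in> {0..p} \<Longrightarrow> 0 \<le> w x \<omega> j"
    and w_total: "\<And>x \<omega>. (\<Sum>j\<in>{0..p}. w x \<omega> j) = 1"
    and F_stay: "\<And>x \<omega>. F x \<omega> 0 = x"
    and F_contraction: "\<And>x y \<omega> j. j \<in> {1..p} \<Longrightarrow> norm (F x \<omega> j - F y \<omega> j) \<le> \<rho> * norm (x - y)"
    and w_log_Lipschitz: "\<And>x y \<omega> j. j \<in> {1..p} \<Longrightarrow> w x \<omega> j \<le> exp (l * norm (x - y)) * w y \<omega> j"
    and w_lower: "\<And>x \<omega> j. j \<in> {1..p} \<Longrightarrow> \<gamma> / p \<le> w x \<omega> j"
begin

abbreviation "idx \<equiv> {0..p}"

abbreviation "overlap x y \<omega> i \<equiv> min (w x \<omega> i) (w y \<omega> i)"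

abbreviation "coupled_weight s \<omega> \<equiv> maximal_coupling idx (w (fst s) \<omega>) (w (snd s) \<omega>)"

abbreviation "coupled_map s \<omega> z \<equiv> (F (fst s) \<omega> (fst z), F (snd s) \<omega> (snd z))"

definition kernel :: "'a \<Rightarrow> 'a measure" where
  "kernel x = mixture M idx (w x) (F x)"

text \<open>Both chains use the same noise, and the indices are drawn from a maximal coupling.\<close>

definition coupled :: "'a \<times> 'a \<Rightarrow> ('a \<times> 'a) measure" where
  "coupled s = mixture M (idx \<times> idx) (coupled_weight s) (coupled_map s)"

lemma idx_split: "(\<Sum>j\<in>idx. f j) = f 0 + (\<Sum>j=1..p. f j)" for f :: "nat \<Rightarrow> real"
  by (simp add: sum.atLeast_Suc_atMost)

lemma w_slice: "j \<in> idx \<Longrightarrow> (\<lambda>\<omega>. w x \<omega> j) \<in> borel_measurable M"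
  using measurable_compose_Pair1[OF _ w_measurable, of x j] by simp

lemma F_slice: "j \<in> idx \<Longrightarrow> (\<lambda>\<omega>. F x \<omega> j) \<in> M \<rightarrow>\<^sub>M borel"
  using measurable_compose_Pair1[OF _ F_measurable, of x j] by simp

lemma kernel_measurable: "kernel \<in> borel \<rightarrow>\<^sub>M prob_algebra borel"
  unfolding kernel_def[abs_def]
  by (rule mixture_kernel[OF prob_space_axioms _ w_measurable F_measurable w_nonneg w_total]) auto

lemma coupled_weights_nonneg: "z \<in> idx \<times> idx \<Longrightarrow> 0 \<le> maximal_coupling idx (w x \<omega>) (w y \<omega>) z"
  using maximal_coupling_nonneg[OF _ w_total w_nonneg w_total w_nonneg] by (cases z) auto

lemma coupled_weights_fst: "i \<in> idx \<Longrightarrow> (\<Sum>j\<in>idx. maximal_coupling idx (w x \<omega>) (w y \<omega>) (i, j)) = w x \<omega> i"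
  by (rule maximal_coupling_fst[OF _ w_total w_nonneg w_total w_nonneg]) auto

lemma coupled_weights_snd: "j \<in> idx \<Longrightarrow> (\<Sum>i\<in>idx. maximal_coupling idx (w x \<omega>) (w y \<omega>) (i, j)) = w y \<omega> j"
  by (rule maximal_coupling_snd[OF _ w_total w_nonneg w_total w_nonneg]) auto

lemma coupled_weights_total: "(\<Sum>z\<in>idx \<times> idx. maximal_coupling idx (w x \<omega>) (w y \<omega>) z) = 1"
proof -
  have "(\<Sum>z\<in>idx \<times> idx. maximal_coupling idx (w x \<omega>) (w y \<omega>) z) = (\<Sum>i\<in>idx. \<Sum>j\<in>idx. maximal_coupling idx (w x \<omega>) (w y \<omega>) (i, j))"
    by (simp add: sum.cartesian_product)
  also have "\<dots> = (\<Sum>i\<in>idx. w x \<omega> i)" by (intro sum.cong refl coupled_weights_fst)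
  finally show ?thesis by (simp only: w_total)
qed

lemma pair_borel [measurable]:
  "fst \<in> borel_measurable (borel :: ('a \<times> 'a) measure)" "snd \<in> borel_measurable (borel :: ('a \<times> 'a) measure)"
  by (simp_all add: borel_prod[symmetric])

lemma w_pair_measurable [measurable]:
  assumes "j \<in> idx"
  shows "(\<lambda>(s, \<omega>). w (fst s) \<omega> j) \<in> borel_measurable ((borel :: ('a \<times> 'a) measure) \<Otimes>\<^sub>M M)"
    "(\<lambda>(s, \<omega>). w (snd s) \<omega> j) \<in> borel_measurable ((borel :: ('a \<times> 'a) measure) \<Otimes>\<^sub>M M)"
proof -
  have f: "(\<lambda>z. (fst (fst z), snd z)) \<in> (borel :: ('a \<times> 'a) measure) \<Otimes>\<^sub>M M \<rightarrow>\<^sub>M borel \<Otimes>\<^sub>M M"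
    "(\<lambda>z. (snd (fst z), snd z)) \<in> (borel :: ('a \<times> 'a) measure) \<Otimes>\<^sub>M M \<rightarrow>\<^sub>M borel \<Otimes>\<^sub>M M"
    by measurable
  from measurable_compose[OF f(1) w_measurable[OF assms]] measurable_compose[OF f(2) w_measurable[OF assms]]
  show "(\<lambda>(s, \<omega>). w (fst s) \<omega> j) \<in> borel_measurable ((borel :: ('a \<times> 'a) measure) \<Otimes>\<^sub>M M)"
    "(\<lambda>(s, \<omega>). w (snd s) \<omega> j) \<in> borel_measurable ((borel :: ('a \<times> 'a) measure) \<Otimes>\<^sub>M M)"
    by (simp_all add: case_prod_unfold)
qed

lemma F_pair_measurable:
  assumes "i \<in> idx" "j \<in> idx"
  shows "(\<lambda>(s, \<omega>). (F (fst s) \<omega> i, F (snd s) \<omega> j)) \<in> (borel :: ('a \<times> 'a) measure) \<Otimes>\<^sub>M M \<rightarrow>\<^sub>M borel"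
proof -
  have f: "(\<lambda>z. (fst (fst z), snd z)) \<in> (borel :: ('a \<times> 'a) measure) \<Otimes>\<^sub>M M \<rightarrow>\<^sub>M borel \<Otimes>\<^sub>M M"
    "(\<lambda>z. (snd (fst z), snd z)) \<in> (borel :: ('a \<times> 'a) measure) \<Otimes>\<^sub>M M \<rightarrow>\<^sub>M borel \<Otimes>\<^sub>M M"
    by measurable
  have "(\<lambda>z. (F (fst (fst z)) (snd z) i, F (snd (fst z)) (snd z) j)) \<in> (borel :: ('a \<times> 'a) measure) \<Otimes>\<^sub>M M \<rightarrow>\<^sub>M borel \<Otimes>\<^sub>M borel"
    using measurable_compose[OF f(1) F_measurable[OF assms(1)]] measurable_compose[OF f(2) F_measurable[OF assms(2)]]
    by (intro measurable_Pair) (simp_all add: case_prod_unfold)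
  then show ?thesis by (simp only: borel_prod case_prod_unfold)
qed

lemma coupled_weights_measurable:
  assumes "z \<in> idx \<times> idx"
  shows "(\<lambda>(s, \<omega>). coupled_weight s \<omega> z)
    \<in> borel_measurable ((borel :: ('a \<times> 'a) measure) \<Otimes>\<^sub>M M)"
proof -
  have m: "(\<lambda>z. w (fst (fst z)) (snd z) j) \<in> borel_measurable ((borel :: ('a \<times> 'a) measure) \<Otimes>\<^sub>M M)"
    "(\<lambda>z. w (snd (fst z)) (snd z) j) \<in> borel_measurable ((borel :: ('a \<times> 'a) measure) \<Otimes>\<^sub>M M)" if "j \<in> idx" for j
    using w_pair_measurable[OF that] by (simp_all add: case_prod_unfold)
  obtain i j where z: "z = (i, j)" "i \<in> idx" "j \<in> idx" using assms by auto
  note [measurable] = m[OF z(2)] m[OF z(3)]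
  have [measurable]: "(\<lambda>z. \<Sum>k\<in>idx. min (w (fst (fst z)) (snd z) k) (w (snd (fst z)) (snd z) k))
      \<in> borel_measurable ((borel :: ('a \<times> 'a) measure) \<Otimes>\<^sub>M M)"
    by (intro borel_measurable_sum borel_measurable_min m)
  show ?thesis unfolding z(1) maximal_coupling_def case_prod_unfold fst_conv snd_conv
    by measurable
qed

lemma coupled_measurable: "coupled \<in> borel \<rightarrow>\<^sub>M prob_algebra borel"
  unfolding coupled_def[abs_def]
proof (rule mixture_kernel[OF prob_space_axioms])
  fix z assume z: "z \<in> idx \<times> idx"
  then show "(\<lambda>(s, \<omega>). coupled_map s \<omega> z) \<in> borel \<Otimes>\<^sub>M M \<rightarrow>\<^sub>M borel"
    by (intro F_pair_measurable) auto
qed (use coupled_weights_measurable coupled_weights_nonneg coupled_weights_total in auto)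

lemma coupled_weights_slice:
  assumes z: "z \<in> idx \<times> idx"
  shows "(\<lambda>\<omega>. maximal_coupling idx (w x \<omega>) (w y \<omega>) z) \<in> borel_measurable M"
  using measurable_compose_Pair1[OF _ coupled_weights_measurable[OF z], of "(x, y)"] by simp

lemma coupled_map_slice:
  "z \<in> idx \<times> idx \<Longrightarrow> (\<lambda>\<omega>. (F x \<omega> (fst z), F y \<omega> (snd z))) \<in> M \<rightarrow>\<^sub>M borel"
  using measurable_compose_Pair1[OF _ F_pair_measurable, of "(x, y)"] by auto

lemma nn_integral_coupled:
  assumes "h \<in> borel_measurable borel"
  shows "(\<integral>\<^sup>+t. h t \<partial>coupled s) = (\<Sum>z\<in>idx \<times> idx. \<integral>\<^sup>+\<omega>.
      ennreal (coupled_weight s \<omega> z) * h (coupled_map s \<omega> z) \<partial>M)"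
  unfolding coupled_def
  by (rule nn_integral_mixture[OF prob_space_axioms _ coupled_weights_slice coupled_map_slice assms]) auto

lemma nn_integral_kernel:
  assumes "h \<in> borel_measurable borel"
  shows "(\<integral>\<^sup>+y. h y \<partial>kernel x) = (\<Sum>j\<in>idx. \<integral>\<^sup>+\<omega>. ennreal (w x \<omega> j) * h (F x \<omega> j) \<partial>M)"
  unfolding kernel_def by (rule nn_integral_mixture[OF prob_space_axioms _ w_slice F_slice assms]) auto

lemma coupled_fst: "distr (coupled s) borel fst = kernel (fst s)"
  unfolding coupled_def kernel_def
proof (rule distr_mixture_lump[where k = fst])
  fix \<omega> i assume i: "i \<in> idx"
  then have "{z. z \<in> idx \<times> idx \<and> fst z = i} = Pair i ` idx" by auto
  then show "(\<Sum>z | z \<in> idx \<times> idx \<and> fst z = i. coupled_weight s \<omega> z) = w (fst s) \<omega> i"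
    using coupled_weights_fst[OF i] by (simp add: sum.reindex inj_on_def)
qed (use prob_space_axioms coupled_weights_slice coupled_map_slice w_slice F_slice coupled_weights_nonneg in auto)

lemma coupled_snd: "distr (coupled s) borel snd = kernel (snd s)"
  unfolding coupled_def kernel_def
proof (rule distr_mixture_lump[where k = snd])
  fix \<omega> j assume j: "j \<in> idx"
  then have "{z. z \<in> idx \<times> idx \<and> snd z = j} = (\<lambda>i. (i, j)) ` idx" by auto
  then show "(\<Sum>z | z \<in> idx \<times> idx \<and> snd z = j. coupled_weight s \<omega> z) = w (snd s) \<omega> j"
    using coupled_weights_snd[OF j] by (simp add: sum.reindex inj_on_def)
qed (use prob_space_axioms coupled_weights_slice coupled_map_slice w_slice F_slice coupled_weights_nonneg in auto)

lemma coupled_cost_le: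
  fixes h :: "'a \<times> 'a \<Rightarrow> real"
  assumes h [measurable]: "h \<in> borel_measurable borel" and h01: "\<And>t. 0 \<le> h t" "\<And>t. h t \<le> 1"
    and bound: "\<And>\<omega>. (\<Sum>i\<in>idx. overlap (fst s) (snd s) \<omega> i * h (F (fst s) \<omega> i, F (snd s) \<omega> i))
        + (1 - (\<Sum>i\<in>idx. overlap (fst s) (snd s) \<omega> i)) \<le> B"
  shows "(\<integral>\<^sup>+t. ennreal (h t) \<partial>coupled s) \<le> ennreal B"
proof -
  have "(\<integral>\<^sup>+t. ennreal (h t) \<partial>coupled s) = (\<Sum>z\<in>idx \<times> idx. \<integral>\<^sup>+\<omega>. ennreal (coupled_weight s \<omega> z) * ennreal (h (coupled_map s \<omega> z)) \<partial>M)"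
    by (rule nn_integral_coupled) simp
  also have "\<dots> = (\<integral>\<^sup>+\<omega>. (\<Sum>z\<in>idx \<times> idx. ennreal (coupled_weight s \<omega> z) * ennreal (h (coupled_map s \<omega> z))) \<partial>M)"
    by (intro nn_integral_sum[symmetric] borel_measurable_times_ennreal measurable_compose[OF coupled_weights_slice measurable_ennreal]
      measurable_compose[OF coupled_map_slice measurable_compose[OF h measurable_ennreal]]) auto
  also have "\<dots> \<le> (\<integral>\<^sup>+\<omega>. ennreal B \<partial>M)"
  proof (rule nn_integral_mono)
    fix \<omega>
    have "(\<Sum>z\<in>idx \<times> idx. ennreal (coupled_weight s \<omega> z) * ennreal (h (coupled_map s \<omega> z))) = (\<Sum>z\<in>idx \<times> idx. ennreal (coupled_weight s \<omega> z * h (coupled_map s \<omega> z)))"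
      using coupled_weights_nonneg h01 by (intro sum.cong refl) (simp add: ennreal_mult)
    also have "\<dots> = ennreal (\<Sum>z\<in>idx \<times> idx. coupled_weight s \<omega> z * h (coupled_map s \<omega> z))"
      using coupled_weights_nonneg h01 by (intro sum_ennreal) auto
    also have "\<dots> \<le> ennreal B"
    proof (rule ennreal_leI)
      have "(\<Sum>z\<in>idx \<times> idx. coupled_weight s \<omega> z * h (coupled_map s \<omega> z))
        \<le> (\<Sum>i\<in>idx. overlap (fst s) (snd s) \<omega> i * h (coupled_map s \<omega> (i, i)))
          + (1 - (\<Sum>i\<in>idx. overlap (fst s) (snd s) \<omega> i))"
        by (rule maximal_coupling_cost_le[OF _ w_total w_nonneg w_total w_nonneg]) (use h01 in auto)
      with bound[of \<omega>] show "(\<Sum>z\<in>idx \<times> idx. coupled_weight s \<omega> z * h (coupled_map s \<omega> z)) \<le> B" by simp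
    qed
    finally show "(\<Sum>z\<in>idx \<times> idx. ennreal (coupled_weight s \<omega> z) * ennreal (h (coupled_map s \<omega> z))) \<le> ennreal B" .
  qed
  also have "\<dots> = ennreal B" by (simp add: emeasure_space_1)
  finally show ?thesis .
qed

lemma overlap_ge: "\<gamma> \<le> (\<Sum>i=1..p. overlap x y \<omega> i)"
proof -
  have "\<gamma> = (\<Sum>i=1..p. \<gamma> / p)" using constants by simp
  also have "\<dots> \<le> (\<Sum>i=1..p. overlap x y \<omega> i)"
    using w_lower by (intro sum_mono) auto
  finally show ?thesis .
qed

text \<open>
  The probability of different indices is the total variation distance of the weights. For the moves the logarithmic
  Lipschitz bound gives a change of at most \<open>l * norm (x - y)\<close> in sum, and the weight of staying is one minus the sum of
  the others.
\<close>

lemma mismatch_le: "1 - (\<Sum>i\<in>idx. overlap x y \<omega> i) \<le> 2 * l * norm (x - y)"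
proof -
  define r where "r = l * norm (x - y)"
  have r: "0 \<le> r" using constants by (simp add: r_def)
  have moves: "(\<Sum>i=1..p. max 0 (w x \<omega> i - w y \<omega> i)) \<le> r" if "r = l * norm (x - y)" for x y
  proof -
    have "(\<Sum>i=1..p. max 0 (w x \<omega> i - w y \<omega> i)) \<le> (\<Sum>i=1..p. r * w x \<omega> i)"
    proof (rule sum_mono)
      fix i assume i: "i \<in> {1..p}"
      have wx: "0 \<le> w x \<omega> i" using w_nonneg i by auto
      have "(1 - r) * w x \<omega> i \<le> exp (- r) * w x \<omega> i"
        using exp_ge_add_one_self[of "- r"] wx by (intro mult_right_mono) auto
      also have "\<dots> \<le> exp (- r) * (exp r * w y \<omega> i)"
        using w_log_Lipschitz[OF i, of x \<omega> y] that by (intro mult_left_mono) auto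
      also have "\<dots> = w y \<omega> i" by (simp add: mult.assoc[symmetric] exp_add[symmetric])
      finally show "max 0 (w x \<omega> i - w y \<omega> i) \<le> r * w x \<omega> i" using wx r by (simp add: algebra_simps)
    qed
    also have "\<dots> = r * (\<Sum>i=1..p. w x \<omega> i)" by (simp add: sum_distrib_left)
    also have "\<dots> \<le> r * 1"
      using w_total[of x \<omega>] w_nonneg[of 0 x \<omega>] r by (intro mult_left_mono) (auto simp: idx_split)
    finally show ?thesis by simp
  qed
  have "1 - (\<Sum>i\<in>idx. overlap x y \<omega> i) = (\<Sum>i\<in>idx. w x \<omega> i - overlap x y \<omega> i)"
    by (simp add: sum_subtractf w_total)
  also have "\<dots> = (\<Sum>i\<in>idx. max 0 (w x \<omega> i - w y \<omega> i))"
    by (intro sum.cong refl) auto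
  also have "\<dots> = max 0 (w x \<omega> 0 - w y \<omega> 0) + (\<Sum>i=1..p. max 0 (w x \<omega> i - w y \<omega> i))"
    by (rule idx_split)
  also have "max 0 (w x \<omega> 0 - w y \<omega> 0) \<le> r"
  proof -
    have "w x \<omega> 0 - w y \<omega> 0 = (\<Sum>i=1..p. w y \<omega> i - w x \<omega> i)"
      using w_total[of x \<omega>] w_total[of y \<omega>] by (simp add: idx_split sum_subtractf)
    also have "\<dots> \<le> (\<Sum>i=1..p. max 0 (w y \<omega> i - w x \<omega> i))" by (intro sum_mono) auto
    also have "\<dots> \<le> r" by (rule moves) (simp add: r_def norm_minus_commute)
    finally show ?thesis using r by simp
  qed
  also have "(\<Sum>i=1..p. max 0 (w x \<omega> i - w y \<omega> i)) \<le> r" by (rule moves) (simp add: r_def)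
  finally show ?thesis by (simp add: r_def)
qed

text \<open>
  A common move brings the points closer by the factor \<open>\<rho>\<close> and has probability at least \<open>\<gamma>\<close>; in all other events the
  cost is bounded by 1.
\<close>

lemma coupled_closer:
  assumes a: "0 \<le> a"
  shows "(\<integral>\<^sup>+t. ennreal (min 1 (a * norm (fst t - snd t))) \<partial>coupled s)
    \<le> ennreal (1 - \<gamma> + \<gamma> * min 1 (\<rho> * a * norm (fst s - snd s)))"
proof (rule coupled_cost_le)
  fix \<omega>
  define m where "m i = overlap (fst s) (snd s) \<omega> i" for i
  define e where "e = min 1 (\<rho> * a * norm (fst s - snd s))"
  have m: "0 \<le> m i" if "i \<in> idx" for i using w_nonneg that by (auto simp: m_def)
  have e: "0 \<le> e" "e \<le> 1" using a constants by (auto simp: e_def)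
  let ?h = "\<lambda>i. min 1 (a * norm (F (fst s) \<omega> i - F (snd s) \<omega> i))"
  have "(\<Sum>i\<in>idx. m i * ?h i) = m 0 * ?h 0 + (\<Sum>i=1..p. m i * ?h i)" by (rule idx_split)
  also have "m 0 * ?h 0 \<le> m 0" using m[of 0] by (intro mult_left_le) auto
  also have "(\<Sum>i=1..p. m i * ?h i) \<le> (\<Sum>i=1..p. m i * e)"
  proof (intro sum_mono mult_left_mono)
    fix i assume i: "i \<in> {1..p}"
    show "?h i \<le> e" unfolding e_def
      using mult_left_mono[OF F_contraction[OF i, of "fst s" \<omega> "snd s"] a]
      by (intro min.mono order_refl) (simp add: mult_ac)
    show "0 \<le> m i" using m i by auto
  qed
  also have "(\<Sum>i=1..p. m i * e) = (\<Sum>i=1..p. m i) * e" by (simp add: sum_distrib_right)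
  finally have "(\<Sum>i\<in>idx. m i * ?h i) + (1 - (\<Sum>i\<in>idx. m i)) \<le> 1 - (1 - e) * (\<Sum>i=1..p. m i)"
    unfolding idx_split[of m] by (simp add: algebra_simps)
  also have "\<dots> \<le> 1 - (1 - e) * \<gamma>"
    using mult_left_mono[OF overlap_ge[of "fst s" \<omega> "snd s"], of "1 - e"] e by (simp add: m_def)
  finally show "(\<Sum>i\<in>idx. overlap (fst s) (snd s) \<omega> i * min 1 (a * norm (fst (F (fst s) \<omega> i, F (snd s) \<omega> i) - snd (F (fst s) \<omega> i, F (snd s) \<omega> i))))
      + (1 - (\<Sum>i\<in>idx. overlap (fst s) (snd s) \<omega> i)) \<le> 1 - \<gamma> + \<gamma> * min 1 (\<rho> * a * norm (fst s - snd s))"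
    by (simp add: m_def e_def algebra_simps)
qed (use a in auto)

text \<open>
  Below distance \<open>\<epsilon>\<close>, common moves gain \<open>\<gamma> * (1 - \<rho>)\<close> relative to \<open>dist_eps\<close>, common stays gain nothing, and different
  indices have probability at most \<open>2 * l * \<epsilon>\<close> times \<open>dist_eps\<close>. For small \<open>\<epsilon>\<close> this loss is at most half of the gain.
\<close>

lemma coupled_local_contraction:
  assumes \<epsilon>: "0 < \<epsilon>" "4 * l * \<epsilon> \<le> \<gamma> * (1 - \<rho>)" and near: "norm (fst s - snd s) < \<epsilon>"
  shows "(\<integral>\<^sup>+t. ennreal (dist_eps \<epsilon> (fst t) (snd t)) \<partial>coupled s)
    \<le> ennreal ((1 - \<gamma> * (1 - \<rho>) / 2) * dist_eps \<epsilon> (fst s) (snd s))"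
proof (rule coupled_cost_le)
  show "(\<lambda>t. dist_eps \<epsilon> (fst t) (snd t)) \<in> borel_measurable (borel :: ('a \<times> 'a) measure)"
    unfolding dist_eps_def by measurable
  fix \<omega>
  define m where "m i = overlap (fst s) (snd s) \<omega> i" for i
  define d where "d = norm (fst s - snd s) / \<epsilon>"
  have d: "0 \<le> d" "dist_eps \<epsilon> (fst s) (snd s) = d" using near \<epsilon> by (auto simp: d_def dist_eps_def)
  have m: "0 \<le> m i" if "i \<in> idx" for i using w_nonneg that by (auto simp: m_def)
  let ?h = "\<lambda>i. dist_eps \<epsilon> (F (fst s) \<omega> i) (F (snd s) \<omega> i)"
  define q where "q = 1 - (\<Sum>i\<in>idx. m i)"
  have q: "0 \<le> q" using min_sum_le_1[OF _ w_total w_nonneg w_total w_nonneg] by (simp add: q_def m_def)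
  have "(\<Sum>i\<in>idx. m i * ?h i) = m 0 * ?h 0 + (\<Sum>i=1..p. m i * ?h i)" by (rule idx_split)
  also have "m 0 * ?h 0 = m 0 * d" by (simp add: F_stay d)
  also have "(\<Sum>i=1..p. m i * ?h i) \<le> (\<Sum>i=1..p. m i * (\<rho> * d))"
  proof (intro sum_mono mult_left_mono)
    fix i assume i: "i \<in> {1..p}"
    have "norm (F (fst s) \<omega> i - F (snd s) \<omega> i) / \<epsilon> \<le> \<rho> * norm (fst s - snd s) / \<epsilon>"
      using F_contraction[OF i] \<epsilon> by (intro divide_right_mono) auto
    then show "?h i \<le> \<rho> * d" unfolding dist_eps_def d_def by simp
    show "0 \<le> m i" using m i by auto
  qed
  also have "(\<Sum>i=1..p. m i * (\<rho> * d)) = (\<Sum>i=1..p. m i) * (\<rho> * d)" by (simp add: sum_distrib_right)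
  also have "m 0 = 1 - q - (\<Sum>i=1..p. m i)" by (simp add: q_def idx_split)
  finally have "(\<Sum>i\<in>idx. m i * ?h i) + q \<le> d - (1 - \<rho>) * d * (\<Sum>i=1..p. m i) + q - q * d"
    by (simp add: algebra_simps)
  also have "\<dots> \<le> d - (1 - \<rho>) * d * \<gamma> + 2 * l * norm (fst s - snd s)"
  proof -
    have "(1 - \<rho>) * d * \<gamma> \<le> (1 - \<rho>) * d * (\<Sum>i=1..p. m i)"
      using overlap_ge constants d unfolding m_def by (intro mult_left_mono) auto
    moreover have "q \<le> 2 * l * norm (fst s - snd s)" unfolding q_def m_def by (rule mismatch_le)
    moreover have "0 \<le> q * d" using q d by simp
    ultimately show ?thesis by linarith
  qed
  also have "2 * l * norm (fst s - snd s) = (4 * l * \<epsilon>) * d / 2" using \<epsilon> by (simp add: d_def)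
  also have "(4 * l * \<epsilon>) * d / 2 \<le> (\<gamma> * (1 - \<rho>)) * d / 2"
    using \<epsilon> d by (intro divide_right_mono mult_right_mono) auto
  also have "d - (1 - \<rho>) * d * \<gamma> + (\<gamma> * (1 - \<rho>)) * d / 2 = (1 - \<gamma> * (1 - \<rho>) / 2) * d"
    by (simp add: field_simps)
  finally show "(\<Sum>i\<in>idx. overlap (fst s) (snd s) \<omega> i * dist_eps \<epsilon> (fst (F (fst s) \<omega> i, F (snd s) \<omega> i)) (snd (F (fst s) \<omega> i, F (snd s) \<omega> i)))
      + (1 - (\<Sum>i\<in>idx. overlap (fst s) (snd s) \<omega> i)) \<le> (1 - \<gamma> * (1 - \<rho>) / 2) * dist_eps \<epsilon> (fst s) (snd s)"
    by (simp add: m_def q_def d)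
qed (use \<epsilon> in \<open>auto simp: dist_eps_def\<close>)

text \<open>
  The factor \<open>\<rho>\<close> in front of \<open>V x\<close> is the same for all moves, so it survives the random selection without a change of
  measure. Only the noise terms \<open>Z j\<close> are compared with a uniform selection, at the price of the factor \<open>u\<close>.
\<close>

lemma kernel_drift:
  assumes V [measurable]: "V \<in> borel_measurable borel" and V_nonneg: "\<And>x. 0 \<le> V x"
    and upper: "\<And>x \<omega> j. j \<in> {1..p} \<Longrightarrow> w x \<omega> j \<le> u / p" and u: "0 \<le> u"
    and Z_meas: "\<And>j. j \<in> {1..p} \<Longrightarrow> Z j \<in> borel_measurable M" and Z_nonneg: "\<And>j \<omega>. 0 \<le> Z j \<omega>"
    and Z_int: "\<And>j. j \<in> {1..p} \<Longrightarrow> (\<integral>\<^sup>+\<omega>. ennreal (Z j \<omega>) \<partial>M) \<le> ennreal z" and z: "0 \<le> z"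
    and step: "\<And>x \<omega> j. j \<in> {1..p} \<Longrightarrow> V (F x \<omega> j) \<le> \<rho> * V x + Z j \<omega>"
  shows "(\<integral>\<^sup>+y. ennreal (V y) \<partial>kernel x) \<le> ennreal ((1 - \<gamma> * (1 - \<rho>)) * V x + u * z)"
proof -
  define k where "k = (1 - \<gamma> * (1 - \<rho>)) * V x"
  have k: "0 \<le> k"
  proof -
    have "\<gamma> * (1 - \<rho>) \<le> 1 * 1" using constants by (intro mult_mono) auto
    then show ?thesis using V_nonneg[of x] by (simp add: k_def)
  qed
  have pointwise: "(\<Sum>j\<in>idx. w x \<omega> j * V (F x \<omega> j)) \<le> k + (\<Sum>j=1..p. u / p * Z j \<omega>)" for \<omega>
  proof -
    define s where "s = (\<Sum>j=1..p. w x \<omega> j)"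
    have s: "w x \<omega> 0 = 1 - s" using w_total[of x \<omega>] by (simp add: idx_split s_def)
    have "\<gamma> \<le> s" using overlap_ge[of x \<omega> x] by (simp add: s_def)
    have "(\<Sum>j\<in>idx. w x \<omega> j * V (F x \<omega> j)) = (1 - s) * V x + (\<Sum>j=1..p. w x \<omega> j * V (F x \<omega> j))"
      by (simp add: idx_split F_stay s)
    also have "(\<Sum>j=1..p. w x \<omega> j * V (F x \<omega> j)) \<le> (\<Sum>j=1..p. w x \<omega> j * (\<rho> * V x) + u / p * Z j \<omega>)"
    proof (rule sum_mono)
      fix j assume j: "j \<in> {1..p}"
      have "w x \<omega> j * V (F x \<omega> j) \<le> w x \<omega> j * (\<rho> * V x + Z j \<omega>)"
        using step[OF j] w_nonneg j by (intro mult_left_mono) auto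
      also have "\<dots> \<le> w x \<omega> j * (\<rho> * V x) + u / p * Z j \<omega>"
        using mult_right_mono[OF upper[OF j, of x \<omega>] Z_nonneg[of j \<omega>]] by (simp add: distrib_left)
      finally show "w x \<omega> j * V (F x \<omega> j) \<le> w x \<omega> j * (\<rho> * V x) + u / p * Z j \<omega>" .
    qed
    also have "\<dots> = s * (\<rho> * V x) + (\<Sum>j=1..p. u / p * Z j \<omega>)"
      by (simp add: sum.distrib s_def sum_distrib_right)
    also have "(1 - s) * V x + (s * (\<rho> * V x) + (\<Sum>j=1..p. u / p * Z j \<omega>))
        = V x - s * ((1 - \<rho>) * V x) + (\<Sum>j=1..p. u / p * Z j \<omega>)" by (simp add: algebra_simps)
    finally have "(\<Sum>j\<in>idx. w x \<omega> j * V (F x \<omega> j))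
        \<le> V x - s * ((1 - \<rho>) * V x) + (\<Sum>j=1..p. u / p * Z j \<omega>)" by simp
    moreover have "\<gamma> * ((1 - \<rho>) * V x) \<le> s * ((1 - \<rho>) * V x)"
      using \<open>\<gamma> \<le> s\<close> V_nonneg[of x] constants by (intro mult_right_mono) auto
    moreover have "k = V x - \<gamma> * ((1 - \<rho>) * V x)" by (simp add: k_def algebra_simps)
    ultimately show ?thesis by linarith
  qed
  have Fm: "(\<lambda>\<omega>. ennreal (V (F x \<omega> j))) \<in> borel_measurable M" if "j \<in> idx" for j
    using measurable_compose[OF F_slice[OF that] V] by simp
  have wm: "(\<lambda>\<omega>. ennreal (w x \<omega> j)) \<in> borel_measurable M" if "j \<in> idx" for j
    using w_slice[OF that] by simp
  have "(\<integral>\<^sup>+y. ennreal (V y) \<partial>kernel x) = (\<Sum>j\<in>idx. \<integral>\<^sup>+\<omega>. ennreal (w x \<omega> j) * ennreal (V (F x \<omega> j)) \<partial>M)"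
    by (rule nn_integral_kernel) simp
  also have "\<dots> = (\<integral>\<^sup>+\<omega>. (\<Sum>j\<in>idx. ennreal (w x \<omega> j) * ennreal (V (F x \<omega> j))) \<partial>M)"
    by (intro nn_integral_sum[symmetric] borel_measurable_times_ennreal Fm wm)
  also have "\<dots> \<le> (\<integral>\<^sup>+\<omega>. ennreal k + (\<Sum>j=1..p. ennreal (u / p) * ennreal (Z j \<omega>)) \<partial>M)"
  proof (rule nn_integral_mono)
    fix \<omega>
    have "(\<Sum>j\<in>idx. ennreal (w x \<omega> j) * ennreal (V (F x \<omega> j))) = ennreal (\<Sum>j\<in>idx. w x \<omega> j * V (F x \<omega> j))"
      using w_nonneg V_nonneg by (subst sum_ennreal[symmetric]) (auto simp: ennreal_mult)
    also have "\<dots> \<le> ennreal (k + (\<Sum>j=1..p. u / p * Z j \<omega>))" by (rule ennreal_leI[OF pointwise])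
    also have "\<dots> = ennreal k + ennreal (\<Sum>j=1..p. u / p * Z j \<omega>)"
      using k u Z_nonneg by (intro ennreal_plus sum_nonneg) auto
    also have "ennreal (\<Sum>j=1..p. u / p * Z j \<omega>) = (\<Sum>j=1..p. ennreal (u / p) * ennreal (Z j \<omega>))"
    proof -
      have "ennreal (\<Sum>j=1..p. u / p * Z j \<omega>) = (\<Sum>j=1..p. ennreal (u / p * Z j \<omega>))"
        using u Z_nonneg by (intro sum_ennreal[symmetric]) auto
      also have "\<dots> = (\<Sum>j=1..p. ennreal (u / p) * ennreal (Z j \<omega>))"
        using u Z_nonneg by (intro sum.cong refl ennreal_mult) auto
      finally show ?thesis .
    qed
    finally show "(\<Sum>j\<in>idx. ennreal (w x \<omega> j) * ennreal (V (F x \<omega> j))) \<le> ennreal k + \<dots>" .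
  qed
  also have "\<dots> = ennreal k + (\<Sum>j=1..p. ennreal (u / p) * (\<integral>\<^sup>+\<omega>. ennreal (Z j \<omega>) \<partial>M))"
  proof -
    have Zm: "(\<lambda>\<omega>. ennreal (Z j \<omega>)) \<in> borel_measurable M" if "j \<in> {1..p}" for j
      using Z_meas[OF that] by simp
    have "(\<integral>\<^sup>+\<omega>. ennreal k + (\<Sum>j=1..p. ennreal (u / p) * ennreal (Z j \<omega>)) \<partial>M)
        = (\<integral>\<^sup>+\<omega>. ennreal k \<partial>M) + (\<integral>\<^sup>+\<omega>. (\<Sum>j=1..p. ennreal (u / p) * ennreal (Z j \<omega>)) \<partial>M)"
      by (intro nn_integral_add borel_measurable_sum borel_measurable_times_ennreal borel_measurable_const Zm)
    also have "(\<integral>\<^sup>+\<omega>. (\<Sum>j=1..p. ennreal (u / p) * ennreal (Z j \<omega>)) \<partial>M)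
        = (\<Sum>j=1..p. \<integral>\<^sup>+\<omega>. ennreal (u / p) * ennreal (Z j \<omega>) \<partial>M)"
      by (intro nn_integral_sum borel_measurable_times_ennreal borel_measurable_const Zm)
    also have "\<dots> = (\<Sum>j=1..p. ennreal (u / p) * (\<integral>\<^sup>+\<omega>. ennreal (Z j \<omega>) \<partial>M))"
      by (intro sum.cong refl nn_integral_cmult Zm)
    finally show ?thesis by (simp add: emeasure_space_1)
  qed
  also have "\<dots> \<le> ennreal k + (\<Sum>j=1..p. ennreal (u / p) * ennreal z)"
    using Z_int by (intro add_left_mono sum_mono mult_left_mono) auto
  also have "(\<Sum>j=1..p. ennreal (u / p) * ennreal z) = ennreal (\<Sum>j=1..p. u / p * z)"
  proof -
    have "ennreal (u / p) * ennreal z = ennreal (u / p * z)"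
      using u z by (intro ennreal_mult[symmetric]) auto
    then show ?thesis using u z by (simp only:) (intro sum_ennreal, auto)
  qed
  also have "(\<Sum>j=1..p. u / p * z) = u * z"
  proof -
    have "real p \<noteq> 0" using constants(1) by simp
    then show ?thesis by simp
  qed
  also have "ennreal k + ennreal (u * z) = ennreal (k + u * z)" using k u z by simp
  finally show ?thesis by (simp add: k_def)
qed

theorem contracting_coupling_coupled:
  assumes V: "V \<in> borel_measurable borel" and V_nonneg: "\<And>x. 0 \<le> V x"
    and upper: "\<And>x \<omega> j. j \<in> {1..p} \<Longrightarrow> w x \<omega> j \<le> u / p" and u: "0 \<le> u"
    and Z_meas: "\<And>j. j \<in> {1..p} \<Longrightarrow> Z j \<in> borel_measurable M" and Z_nonneg: "\<And>j \<omega>. 0 \<le> Z j \<omega>"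
    and Z_int: "\<And>j. j \<in> {1..p} \<Longrightarrow> (\<integral>\<^sup>+\<omega>. ennreal (Z j \<omega>) \<partial>M) \<le> ennreal z" and z: "0 \<le> z"
    and step: "\<And>x \<omega> j. j \<in> {1..p} \<Longrightarrow> V (F x \<omega> j) \<le> \<rho> * V x + Z j \<omega>"
    and \<epsilon>: "0 < \<epsilon>" "4 * l * \<epsilon> \<le> \<gamma> * (1 - \<rho>)"
  shows "contracting_coupling V \<epsilon> (1 - \<gamma> * (1 - \<rho>)) (u * z) \<gamma> \<rho> (1 - \<gamma> * (1 - \<rho>) / 2) kernel coupled"
proof
  have g: "0 < \<gamma> * (1 - \<rho>)" "\<gamma> * (1 - \<rho>) \<le> 1 * 1"
    using constants by (simp, intro mult_mono, auto)
  show "0 \<le> 1 - \<gamma> * (1 - \<rho>)" "1 - \<gamma> * (1 - \<rho>) < 1" "0 \<le> 1 - \<gamma> * (1 - \<rho>) / 2" "1 - \<gamma> * (1 - \<rho>) / 2 < 1"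
    using g by auto
  show "(\<integral>\<^sup>+y. ennreal (V y) \<partial>kernel x) \<le> ennreal ((1 - \<gamma> * (1 - \<rho>)) * V x + u * z)" for x
    by (rule kernel_drift[OF V V_nonneg upper u Z_meas Z_nonneg Z_int z step])
  show "0 \<le> u * z" using u z by simp
qed (use V V_nonneg \<epsilon> constants kernel_measurable coupled_measurable coupled_fst coupled_snd
    coupled_closer coupled_local_contraction in auto)

end


section \<open>Gibbs weights, acceptance probabilities and Gaussian proposals\<close>

lemma gibbs_weight_cong: "(\<And>i. i \<in> I \<Longrightarrow> x i = y i) \<Longrightarrow> j \<in> I \<Longrightarrow> gibbs_weight \<Phi> I x j = gibbs_weight \<Phi> I y j"
  unfolding gibbs_weight_def by (metis (no_types, lifting) sum.cong)

lemma mt_accept_cong: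
  "(\<And>i. i \<in> {1..p} \<Longrightarrow> x i = y i) \<Longrightarrow> (\<And>i. i \<in> {1..<p} \<Longrightarrow> z i = u i) \<Longrightarrow>
    mt_accept \<Phi> p x0 x z = mt_accept \<Phi> p x0 y u"
  unfolding mt_accept_def by simp

lemma gibbs_weight_nonneg: "finite I \<Longrightarrow> 0 \<le> gibbs_weight \<Phi> I x j"
  unfolding gibbs_weight_def by (intro divide_nonneg_nonneg sum_nonneg) auto

lemma gibbs_weight_total: "finite I \<Longrightarrow> I \<noteq> {} \<Longrightarrow> (\<Sum>j\<in>I. gibbs_weight \<Phi> I x j) = 1"
  unfolding gibbs_weight_def sum_divide_distrib[symmetric]
  using sum_pos[of I "\<lambda>l. exp (- \<Phi> (x l))"] by simp

locale pCN_target =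
  fixes \<rho> :: real and \<mu>0 :: "'a::{real_inner, polish_space} measure" and \<Phi> :: "'a \<Rightarrow> real" and B L :: real
    and p :: nat
  assumes \<rho>: "0 \<le> \<rho>" "\<rho> < 1" and prob_\<mu>0: "prob_space \<mu>0" and sets_\<mu>0 [measurable_cong]: "sets \<mu>0 = sets borel"
    and \<Phi>_bounded: "\<And>x. \<bar>\<Phi> x\<bar> \<le> B" and \<Phi>_Lipschitz: "L-lipschitz_on UNIV \<Phi>" and p: "1 \<le> p"
begin

abbreviation "noise I \<equiv> PiM I (\<lambda>_. \<mu>0)"

definition "\<sigma> = sqrt (1 - \<rho>\<^sup>2)"

text \<open>
  A lower bound for the probability of a move, for both kernels and all \<open>p\<close>. A factor \<open>exp (- 2 * B)\<close> comes from the Gibbs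
  weights and another one from the acceptance probability; one half is a lower bound for \<open>p / (p + 1)\<close>, as the
  current state competes with the \<open>p\<close> proposals in mpCN.
\<close>

definition "move_min = exp (- 4 * B) / 2"

lemma \<sigma>: "0 \<le> \<sigma>" "\<sigma> \<le> 1"
  using \<rho> by (auto simp: \<sigma>_def power_le_one)

lemma B_nonneg: "0 \<le> B" using \<Phi>_bounded[of undefined] by linarith

lemma L_nonneg: "0 \<le> L" using \<Phi>_Lipschitz by (rule lipschitz_on_nonneg)

lemma move_min: "0 < move_min" "move_min \<le> 1"
proof -
  have "exp (- 4 * B) \<le> 1" using B_nonneg by simp
  moreover have "0 < exp (- 4 * B)" by simp
  ultimately show "0 < move_min" "move_min \<le> 1" unfolding move_min_def by linarith+
qed

lemma \<Phi>_measurable [measurable]: "\<Phi> \<in> borel_measurable borel"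
  using lipschitz_on_continuous_on[OF \<Phi>_Lipschitz] by (rule borel_measurable_continuous_onI)

lemma exp_\<Phi>_bounds: "exp (- B) \<le> exp (- \<Phi> x)" "exp (- \<Phi> x) \<le> exp B"
  using \<Phi>_bounded[of x] by auto

lemma exp_\<Phi>_Lipschitz: "norm (x - y) \<le> r \<Longrightarrow> exp (- \<Phi> x) \<le> exp (L * r) * exp (- \<Phi> y)"
proof -
  assume r: "norm (x - y) \<le> r"
  have "\<Phi> y - \<Phi> x \<le> L * norm (x - y)"
    using lipschitz_onD[OF \<Phi>_Lipschitz, of y x] by (simp add: dist_norm norm_minus_commute)
  also have "\<dots> \<le> L * r" using r L_nonneg by (rule mult_left_mono)
  finally show ?thesis by (simp add: exp_add[symmetric])
qed

lemma sum_exp_bounds: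
  assumes "finite I"
  shows "card I * exp (- B) \<le> (\<Sum>l\<in>I. exp (- \<Phi> (x l)))" "(\<Sum>l\<in>I. exp (- \<Phi> (x l))) \<le> card I * exp B"
  using sum_bounded_below[of I "exp (- B)" "\<lambda>l. exp (- \<Phi> (x l))"] sum_bounded_above[of I "\<lambda>l. exp (- \<Phi> (x l))" "exp B"]
    exp_\<Phi>_bounds by auto

lemma sum_exp_Lipschitz:
  assumes "\<And>i. i \<in> I \<Longrightarrow> norm (x i - y i) \<le> r"
  shows "(\<Sum>l\<in>I. exp (- \<Phi> (x l))) \<le> exp (L * r) * (\<Sum>l\<in>I. exp (- \<Phi> (y l)))"
  unfolding sum_distrib_left using assms exp_\<Phi>_Lipschitz by (intro sum_mono) auto

lemma gibbs_weight_bounds: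
  assumes I: "finite I" "j \<in> I"
  shows "exp (- 2 * B) / card I \<le> gibbs_weight \<Phi> I x j" "gibbs_weight \<Phi> I x j \<le> exp (2 * B) / card I"
proof -
  have c: "0 < real (card I)" using I by (auto simp: card_gt_0_iff)
  have pos: "0 < (\<Sum>l\<in>I. exp (- \<Phi> (x l)))" using I by (intro sum_pos) auto
  have "exp (- 2 * B) / card I = exp (- B) / (card I * exp B)"
    using c by (simp add: field_simps exp_add[symmetric])
  also have "\<dots> \<le> gibbs_weight \<Phi> I x j"
    unfolding gibbs_weight_def using exp_\<Phi>_bounds sum_exp_bounds[OF I(1)] pos by (intro frac_le) auto
  finally show "exp (- 2 * B) / card I \<le> gibbs_weight \<Phi> I x j" .
  have "gibbs_weight \<Phi> I x j \<le> exp B / (card I * exp (- B))"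
    unfolding gibbs_weight_def using exp_\<Phi>_bounds sum_exp_bounds[OF I(1)] c by (intro frac_le) auto
  also have "\<dots> = exp (2 * B) / card I" using c by (simp add: field_simps exp_add[symmetric])
  finally show "gibbs_weight \<Phi> I x j \<le> exp (2 * B) / card I" .
qed

text \<open>
  Numerator and denominator both change at most by the factor \<open>exp (L * r)\<close>.
\<close>

lemma gibbs_weight_log_Lipschitz:
  assumes I: "finite I" "j \<in> I" and r: "\<And>i. i \<in> I \<Longrightarrow> norm (x i - y i) \<le> r"
  shows "gibbs_weight \<Phi> I x j \<le> exp (2 * L * r) * gibbs_weight \<Phi> I y j"
proof -
  have pos: "0 < (\<Sum>l\<in>I. exp (- \<Phi> (x l)))" "0 < (\<Sum>l\<in>I. exp (- \<Phi> (y l)))" using I by (auto intro!: sum_pos)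
  have "(\<Sum>l\<in>I. exp (- \<Phi> (y l))) \<le> exp (L * r) * (\<Sum>l\<in>I. exp (- \<Phi> (x l)))"
    using r by (intro sum_exp_Lipschitz) (simp add: norm_minus_commute)
  then have "exp (- (L * r)) * (\<Sum>l\<in>I. exp (- \<Phi> (y l))) \<le> exp (- (L * r)) * (exp (L * r) * (\<Sum>l\<in>I. exp (- \<Phi> (x l))))"
    by (intro mult_left_mono) auto
  also have "\<dots> = (\<Sum>l\<in>I. exp (- \<Phi> (x l)))" by (simp add: mult.assoc[symmetric] exp_add[symmetric])
  finally have "gibbs_weight \<Phi> I x j \<le> (exp (L * r) * exp (- \<Phi> (y j))) / (exp (- (L * r)) * (\<Sum>l\<in>I. exp (- \<Phi> (y l))))"
    unfolding gibbs_weight_def using I r pos exp_\<Phi>_Lipschitz by (intro frac_le) auto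
  also have "\<dots> = exp (2 * L * r) * gibbs_weight \<Phi> I y j"
  proof -
    have "exp (2 * L * r) = exp (L * r) / exp (- (L * r))" by (simp add: exp_diff[symmetric])
    then show ?thesis by (simp add: gibbs_weight_def)
  qed
  finally show ?thesis .
qed

lemma gibbs_weight_measurable:
  assumes "\<And>i. i \<in> I \<Longrightarrow> (\<lambda>s. g s i) \<in> N \<rightarrow>\<^sub>M borel" and "j \<in> I"
  shows "(\<lambda>s. gibbs_weight \<Phi> I (g s) j) \<in> borel_measurable N"
proof -
  have "(\<lambda>s. exp (- \<Phi> (g s i))) \<in> borel_measurable N" if "i \<in> I" for i
    using assms(1)[OF that] by measurable
  then show ?thesis unfolding gibbs_weight_def
    using assms(2) by (intro borel_measurable_divide borel_measurable_sum)
qed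

lemma mt_accept_measurable:
  assumes "\<And>i. i \<in> {1..p} \<Longrightarrow> (\<lambda>s. g s i) \<in> N \<rightarrow>\<^sub>M borel" and "\<And>i. i \<in> {1..<p} \<Longrightarrow> (\<lambda>s. h s i) \<in> N \<rightarrow>\<^sub>M borel"
    and "f \<in> N \<rightarrow>\<^sub>M borel"
  shows "(\<lambda>s. mt_accept \<Phi> p (f s) (g s) (h s)) \<in> borel_measurable N"
proof -
  have "(\<lambda>s. exp (- \<Phi> (g s i))) \<in> borel_measurable N" if "i \<in> {1..p}" for i
    using assms(1)[OF that] by measurable
  moreover have "(\<lambda>s. exp (- \<Phi> (h s i))) \<in> borel_measurable N" if "i \<in> {1..<p}" for i
    using assms(2)[OF that] by measurable
  moreover have "(\<lambda>s. exp (- \<Phi> (f s))) \<in> borel_measurable N"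
    using assms(3) by measurable
  ultimately show ?thesis unfolding mt_accept_def
    by (intro borel_measurable_min borel_measurable_const borel_measurable_divide borel_measurable_add borel_measurable_sum)
qed

lemma mt_accept_bounds: "exp (- 2 * B) \<le> mt_accept \<Phi> p x0 x z" "mt_accept \<Phi> p x0 x z \<le> 1" "0 \<le> mt_accept \<Phi> p x0 x z"
proof -
  have pp: "0 < real p" using p by simp
  have den: "0 < exp (- \<Phi> x0) + (\<Sum>l=1..<p. exp (- \<Phi> (z l)))" by (intro add_pos_nonneg sum_nonneg) auto
  have "exp (- \<Phi> x0) + (\<Sum>l=1..<p. exp (- \<Phi> (z l))) \<le> exp B + real (p - 1) * exp B"
    using sum_exp_bounds(2)[of "{1..<p}" z] by (intro add_mono exp_\<Phi>_bounds) simp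
  also have "\<dots> = p * exp B" using p by (simp add: algebra_simps of_nat_diff)
  finally have "(p * exp (- B)) / (p * exp B) \<le> (\<Sum>l=1..p. exp (- \<Phi> (x l))) / (exp (- \<Phi> x0) + (\<Sum>l=1..<p. exp (- \<Phi> (z l))))"
    using sum_exp_bounds(1)[of "{1..p}" x] den by (intro frac_le sum_nonneg) auto
  moreover have "(p * exp (- B)) / (p * exp B) = exp (- 2 * B)"
    using pp by (simp add: field_simps exp_add[symmetric])
  moreover have "exp (- 2 * B) \<le> 1" using B_nonneg by simp
  ultimately show "exp (- 2 * B) \<le> mt_accept \<Phi> p x0 x z" unfolding mt_accept_def by simp
  then show "0 \<le> mt_accept \<Phi> p x0 x z" by (rule order_trans[rotated]) simp
  show "mt_accept \<Phi> p x0 x z \<le> 1" unfolding mt_accept_def by simp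
qed

text \<open>
  The truncation at 1 preserves the bound for the ratio because the factor \<open>exp (2 * L * r)\<close> is at least 1.
\<close>

lemma mt_accept_log_Lipschitz:
  assumes r: "norm (x0 - y0) \<le> r" "\<And>i. i \<in> {1..p} \<Longrightarrow> norm (x i - y i) \<le> r" "\<And>i. i \<in> {1..<p} \<Longrightarrow> norm (z i - u i) \<le> r"
  shows "mt_accept \<Phi> p x0 x z \<le> exp (2 * L * r) * mt_accept \<Phi> p y0 y u"
proof -
  have r0: "0 \<le> r" using r(1) norm_ge_zero order_trans by blast
  define a where "a x = (\<Sum>l=1..p. exp (- \<Phi> (x l)))" for x
  define b where "b x0 z = exp (- \<Phi> x0) + (\<Sum>l=1..<p. exp (- \<Phi> (z l)))" for x0 z
  have a: "a x \<le> exp (L * r) * a y" "0 \<le> a x" "0 \<le> a y"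
    unfolding a_def using r(2) by (auto intro!: sum_exp_Lipschitz sum_nonneg)
  have b_pos: "0 < b x0 z" "0 < b y0 u" unfolding b_def by (auto intro!: add_pos_nonneg sum_nonneg)
  have "b y0 u \<le> exp (L * r) * b x0 z"
    unfolding b_def distrib_left using r(1,3)
    by (intro add_mono exp_\<Phi>_Lipschitz sum_exp_Lipschitz) (auto simp: norm_minus_commute)
  then have "exp (- (L * r)) * b y0 u \<le> exp (- (L * r)) * (exp (L * r) * b x0 z)"
    by (intro mult_left_mono) auto
  also have "\<dots> = b x0 z" by (simp add: mult.assoc[symmetric] exp_add[symmetric])
  finally have "a x / b x0 z \<le> (exp (L * r) * a y) / (exp (- (L * r)) * b y0 u)"
    using a b_pos by (intro frac_le) auto
  also have "\<dots> = exp (2 * L * r) * (a y / b y0 u)"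
  proof -
    have "exp (2 * L * r) = exp (L * r) / exp (- (L * r))" by (simp add: exp_diff[symmetric])
    then show ?thesis by simp
  qed
  finally have le: "a x / b x0 z \<le> exp (2 * L * r) * (a y / b y0 u)" .
  have e: "1 \<le> exp (2 * L * r)" using L_nonneg r0 by simp
  have "min 1 (a x / b x0 z) \<le> exp (2 * L * r) * min 1 (a y / b y0 u)"
  proof (cases "a y / b y0 u \<le> 1")
    case True
    then show ?thesis using le by (simp only: min_absorb2 min.coboundedI2)
  next
    case False
    then show ?thesis using e by (intro min.coboundedI1) simp
  qed
  then show ?thesis by (simp add: mt_accept_def a_def b_def)
qed

lemma measurable_shift [measurable]: "(\<lambda>\<xi>. \<rho> *\<^sub>R z + \<sigma> *\<^sub>R \<xi>) \<in> \<mu>0 \<rightarrow>\<^sub>M borel"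
  by measurable

lemma pCN_shift: "pCN \<rho> \<mu>0 z = distr \<mu>0 borel (\<lambda>\<xi>. \<rho> *\<^sub>R z + \<sigma> *\<^sub>R \<xi>)"
  by (simp add: pCN_def \<sigma>_def)

lemma sets_PiM_\<mu>0: "sets (noise I) = sets (PiM I (\<lambda>_. borel))"
  by (intro sets_PiM_cong refl sets_\<mu>0)

text \<open>
  Proposals are affine images of independent draws from \<open>\<mu>0\<close>, so that all states can share the same noise.
\<close>

lemma nn_integral_PiM_pCN:
  assumes I: "finite I" and f: "f \<in> borel_measurable (PiM I (\<lambda>_. borel))"
  shows "(\<integral>\<^sup>+x. f x \<partial>PiM I (\<lambda>_. pCN \<rho> \<mu>0 z)) = (\<integral>\<^sup>+\<xi>. f (\<lambda>k\<in>I. \<rho> *\<^sub>R z + \<sigma> *\<^sub>R \<xi> k) \<partial>noise I)"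
proof -
  let ?t = "\<lambda>\<xi>. \<rho> *\<^sub>R z + \<sigma> *\<^sub>R \<xi>"
  have t: "?t \<in> \<mu>0 \<rightarrow>\<^sub>M \<mu>0" by measurable
  have "pCN \<rho> \<mu>0 z = distr \<mu>0 \<mu>0 ?t"
    unfolding pCN_shift by (rule distr_cong) (simp_all add: sets_\<mu>0)
  then have eq: "PiM I (\<lambda>_. pCN \<rho> \<mu>0 z) = distr (noise I) (noise I) (compose I ?t)"
    using distr_PiM_finite_prob_space'[OF I prob_\<mu>0 prob_\<mu>0 t] by simp
  have cm: "compose I ?t \<in> noise I \<rightarrow>\<^sub>M noise I"
    unfolding compose_def by (rule measurable_restrict) measurable
  show ?thesis unfolding eq
    by (subst nn_integral_distr[OF cm]) (use f in \<open>auto simp: compose_def cong: measurable_cong_sets[OF sets_PiM_\<mu>0 refl]\<close>)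
qed

lemma noise_component: "k \<in> I \<Longrightarrow> (\<lambda>\<xi>. \<xi> k) \<in> noise I \<rightarrow>\<^sub>M borel"
  using measurable_component_singleton[of k I "\<lambda>_. \<mu>0"] by (simp cong: measurable_cong_sets add: sets_\<mu>0)

lemma prob_noise: "prob_space (noise I)"
  by (intro prob_space_PiM prob_\<mu>0)

lemma nn_integral_noise_component:
  assumes "finite I" "k \<in> I" and f: "f \<in> borel_measurable borel"
  shows "(\<integral>\<^sup>+\<xi>. f (\<xi> k) \<partial>noise I) = (\<integral>\<^sup>+\<xi>. f \<xi> \<partial>\<mu>0)"
proof -
  interpret product_prob_space "\<lambda>_. \<mu>0" I
    using prob_\<mu>0 by (intro product_prob_spaceI)
  have f': "f \<in> borel_measurable \<mu>0" using f by (simp cong: measurable_cong_sets add: sets_\<mu>0)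
  have "(\<integral>\<^sup>+\<xi>. f \<xi> \<partial>distr (noise I) \<mu>0 (\<lambda>\<xi>. \<xi> k)) = (\<integral>\<^sup>+\<xi>. f (\<xi> k) \<partial>noise I)"
    using f' assms by (subst nn_integral_distr) auto
  then show ?thesis using PiM_component[OF assms(2)] by simp
qed

lemma measure_of_mixture:
  assumes "\<And>A. A \<in> sets borel \<Longrightarrow> \<nu> A = emeasure (mixture M I w F) A"
  shows "measure_of UNIV (sets borel) \<nu> = mixture M I w F"
proof -
  have "measure_of UNIV (sets borel) \<nu> = measure_of UNIV (sets borel) (emeasure (mixture M I w F))"
    using assms sets.sigma_sets_eq[of borel] by (intro measure_of_eq) auto
  also have "\<dots> = mixture M I w F"
  proof -
    have "space (mixture M I w F) = UNIV"
      using sets_eq_imp_space_eq[OF sets_mixture[of M I w F]] by simp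
    then show ?thesis using measure_of_of_measure[of "mixture M I w F"] by simp
  qed
  finally show ?thesis .
qed

section \<open>The mpCN kernel\<close>

text \<open>
  The first component of the noise moves the centre \<open>z\<close>, the second one the proposals around it.
\<close>

definition mp_noise :: "('a \<times> (nat \<Rightarrow> 'a)) measure" where
  "mp_noise = \<mu>0 \<Otimes>\<^sub>M noise {1..p}"

definition mp_state :: "'a \<Rightarrow> 'a \<times> (nat \<Rightarrow> 'a) \<Rightarrow> nat \<Rightarrow> 'a" where
  "mp_state x \<omega> j = (if j = 0 then x else \<rho> *\<^sub>R (\<rho> *\<^sub>R x + \<sigma> *\<^sub>R fst \<omega>) + \<sigma> *\<^sub>R snd \<omega> j)"

definition mp_weight :: "'a \<Rightarrow> 'a \<times> (nat \<Rightarrow> 'a) \<Rightarrow> nat \<Rightarrow> real" where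
  "mp_weight x \<omega> j = gibbs_weight \<Phi> {0..p} (mp_state x \<omega>) j"

lemma prob_mp_noise: "prob_space mp_noise"
  unfolding mp_noise_def by (intro prob_space_pair prob_\<mu>0 prob_noise)

lemma mp_state_measurable:
  assumes "j \<in> {0..p}"
  shows "(\<lambda>(x, \<omega>). mp_state x \<omega> j) \<in> borel \<Otimes>\<^sub>M mp_noise \<rightarrow>\<^sub>M borel"
proof (cases "j = 0")
  case True
  then show ?thesis unfolding mp_state_def if_P[OF True] case_prod_unfold by (intro measurable_fst)
next
  case False
  then have j: "j \<in> {1..p}" using assms by auto
  have "snd \<in> mp_noise \<rightarrow>\<^sub>M noise {1..p}"
    unfolding mp_noise_def by (rule measurable_snd)
  then have proposal: "(\<lambda>s. snd (snd s) j) \<in> (borel :: 'a measure) \<Otimes>\<^sub>M mp_noise \<rightarrow>\<^sub>M borel"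
    by (rule measurable_compose[OF measurable_compose[OF measurable_snd] noise_component[OF j]])
  have "fst \<in> mp_noise \<rightarrow>\<^sub>M \<mu>0" unfolding mp_noise_def by (rule measurable_fst)
  then have "fst \<in> mp_noise \<rightarrow>\<^sub>M borel" by (simp only: measurable_cong_sets[OF refl sets_\<mu>0])
  then have centre: "(\<lambda>s. fst (snd s)) \<in> (borel :: 'a measure) \<Otimes>\<^sub>M mp_noise \<rightarrow>\<^sub>M borel"
    by (rule measurable_compose[OF measurable_snd])
  show ?thesis unfolding mp_state_def if_not_P[OF False] case_prod_unfold
    by (intro borel_measurable_add borel_measurable_scaleR borel_measurable_const measurable_fst proposal centre)
qed

lemma mp_state_contraction: "norm (mp_state x \<omega> j - mp_state y \<omega> j) \<le> norm (x - y)"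
  "j \<noteq> 0 \<Longrightarrow> norm (mp_state x \<omega> j - mp_state y \<omega> j) \<le> \<rho> * norm (x - y)"
proof -
  have eq: "norm (mp_state x \<omega> j - mp_state y \<omega> j) = (if j = 0 then 1 else \<rho> * \<rho>) * norm (x - y)"
  proof (cases "j = 0")
    case False
    have "mp_state x \<omega> j - mp_state y \<omega> j = (\<rho> * \<rho>) *\<^sub>R (x - y)"
      using False by (simp add: mp_state_def scaleR_right_distrib scaleR_right_diff_distrib)
    then show ?thesis using False \<rho> by simp
  qed (simp add: mp_state_def)
  have sq: "\<rho> * \<rho> \<le> \<rho>" using \<rho> by (simp add: mult_left_le)
  show "norm (mp_state x \<omega> j - mp_state y \<omega> j) \<le> norm (x - y)"
    unfolding eq using sq \<rho> by (intro mult_left_le_one_le) auto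
  show "j \<noteq> 0 \<Longrightarrow> norm (mp_state x \<omega> j - mp_state y \<omega> j) \<le> \<rho> * norm (x - y)"
    unfolding eq using sq by (simp add: mult_right_mono)
qed

text \<open>
  Each proposal depends on the current state with the factor \<open>\<rho>\<^sup>2\<close>, through the centre. Since \<open>p + 1 \<le> 2 * p\<close>, a Gibbs weight
  of \<open>p + 1\<close> points is still at least \<open>exp (- 2 * B) / (2 * p)\<close>.
\<close>

lemma mp_lazy_random_contraction:
  "lazy_random_contraction mp_noise p mp_weight mp_state \<rho> move_min (4 * L)"
proof (intro lazy_random_contraction.intro lazy_random_contraction_axioms.intro)
  show "prob_space mp_noise" by (rule prob_mp_noise)
  fix j assume "j \<in> {0..p}"
  then show "(\<lambda>(x, \<omega>). mp_state x \<omega> j) \<in> borel \<Otimes>\<^sub>M mp_noise \<rightarrow>\<^sub>M borel" by (rule mp_state_measurable)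
  show "(\<lambda>(x, \<omega>). mp_weight x \<omega> j) \<in> borel_measurable (borel \<Otimes>\<^sub>M mp_noise)"
    unfolding mp_weight_def case_prod_unfold
    by (rule gibbs_weight_measurable[OF mp_state_measurable[unfolded case_prod_unfold] \<open>j \<in> {0..p}\<close>])
next
  fix x y \<omega> and j :: nat assume j: "j \<in> {1..p}"
  then show "norm (mp_state x \<omega> j - mp_state y \<omega> j) \<le> \<rho> * norm (x - y)"
    by (intro mp_state_contraction(2)) auto
  have "mp_weight x \<omega> j \<le> exp (2 * L * norm (x - y)) * mp_weight y \<omega> j"
    unfolding mp_weight_def using j by (intro gibbs_weight_log_Lipschitz mp_state_contraction(1)) auto
  also have "\<dots> \<le> exp (4 * L * norm (x - y)) * mp_weight y \<omega> j"
  proof (rule mult_right_mono)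
    have "2 * L * norm (x - y) \<le> 4 * L * norm (x - y)" using L_nonneg by (intro mult_right_mono) auto
    then show "exp (2 * L * norm (x - y)) \<le> exp (4 * L * norm (x - y))" by simp
    show "0 \<le> mp_weight y \<omega> j" by (simp add: mp_weight_def gibbs_weight_nonneg)
  qed
  finally show "mp_weight x \<omega> j \<le> exp (4 * L * norm (x - y)) * mp_weight y \<omega> j" .
next
  fix x \<omega> and j :: nat assume j: "j \<in> {1..p}"
  have "move_min / p \<le> exp (- 2 * B) / (2 * p)"
    using B_nonneg by (simp add: move_min_def divide_right_mono)
  also have "\<dots> \<le> exp (- 2 * B) / card {0..p}" using p by (intro divide_left_mono) auto
  also have "\<dots> \<le> mp_weight x \<omega> j" unfolding mp_weight_def using j by (intro gibbs_weight_bounds) auto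
  finally show "move_min / p \<le> mp_weight x \<omega> j" .
next
  show "(\<Sum>j = 0..p. mp_weight x \<omega> j) = 1" for x \<omega>
    unfolding mp_weight_def by (rule gibbs_weight_total) auto
qed (use \<rho> p L_nonneg move_min in \<open>auto simp: mp_weight_def gibbs_weight_nonneg mp_state_def\<close>)

text \<open>
  Written over the common noise, the two nested integrals of the kernel become one integral over \<open>mp_noise\<close>.
\<close>

lemma mpCN_eq_mixture: "mpCN \<rho> \<mu>0 \<Phi> p x0 = mixture mp_noise {0..p} (mp_weight x0) (mp_state x0)"
  unfolding mpCN_def
proof (rule measure_of_mixture)
  fix A :: "'a set" assume A [measurable]: "A \<in> sets borel"
  interpret P: prob_space "noise {1..p}" by (rule prob_noise)
  interpret mp: lazy_random_contraction mp_noise p mp_weight mp_state \<rho> move_min "4 * L"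
    by (rule mp_lazy_random_contraction)
  have "emeasure (mixture mp_noise {0..p} (mp_weight x0) (mp_state x0)) A
      = (\<Sum>j\<in>{0..p}. \<integral>\<^sup>+\<omega>. ennreal (mp_weight x0 \<omega> j) * indicator A (mp_state x0 \<omega> j) \<partial>mp_noise)"
    using mp.nn_integral_kernel[of "indicator A" x0] by (simp add: mp.kernel_def)
  also have "\<dots> = (\<Sum>j\<in>{0..p}. \<integral>\<^sup>+z. (\<integral>\<^sup>+x. ennreal (gibbs_weight \<Phi> {0..p} (x(0 := x0)) j) * indicator A ((x(0 := x0)) j)
        \<partial>PiM {1..p} (\<lambda>k. pCN \<rho> \<mu>0 z)) \<partial>pCN \<rho> \<mu>0 x0)"
  proof (intro sum.cong refl)
    fix j assume j: "j \<in> {0..p}"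
    let ?f = "\<lambda>x. ennreal (gibbs_weight \<Phi> {0..p} (x(0 := x0)) j) * indicator A ((x(0 := x0)) j)"
    let ?x = "\<lambda>z \<xi>. \<lambda>i. if i = 0 then x0 else \<rho> *\<^sub>R z + \<sigma> *\<^sub>R \<xi> i"
    have comp: "(\<lambda>x. (x(0 := x0)) i) \<in> PiM {1..p} (\<lambda>_. borel) \<rightarrow>\<^sub>M borel" if "i \<in> {0..p}" for i
    proof (cases "i = 0")
      case False
      then have eq: "(\<lambda>x :: nat \<Rightarrow> 'a. (x(0 := x0)) i) = (\<lambda>x. x i)" and i: "i \<in> {1..p}" using that by auto
      show ?thesis unfolding eq using measurable_component_singleton[OF i, of "\<lambda>_. borel :: 'a measure"] .
    qed simp
    have f: "?f \<in> borel_measurable (PiM {1..p} (\<lambda>_. borel))"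
      by (intro borel_measurable_times_ennreal measurable_compose[OF gibbs_weight_measurable measurable_ennreal]
          measurable_compose[OF comp borel_measurable_indicator] comp j A)
    have inner: "(\<integral>\<^sup>+x. ?f x \<partial>PiM {1..p} (\<lambda>k. pCN \<rho> \<mu>0 z))
        = (\<integral>\<^sup>+\<xi>. ennreal (gibbs_weight \<Phi> {0..p} (?x z \<xi>) j) * indicator A (?x z \<xi> j) \<partial>noise {1..p})" for z
    proof (subst nn_integral_PiM_pCN[OF _ f], simp, rule nn_integral_cong)
      fix \<xi> :: "nat \<Rightarrow> 'a"
      have e: "((\<lambda>k\<in>{1..p}. \<rho> *\<^sub>R z + \<sigma> *\<^sub>R \<xi> k)(0 := x0)) i = ?x z \<xi> i" if "i \<in> {0..p}" for i
        using that by auto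
      show "?f (\<lambda>k\<in>{1..p}. \<rho> *\<^sub>R z + \<sigma> *\<^sub>R \<xi> k)
          = ennreal (gibbs_weight \<Phi> {0..p} (?x z \<xi>) j) * indicator A (?x z \<xi> j)"
        by (simp only: gibbs_weight_cong[OF e j] e[OF j])
    qed
    have xm: "(\<lambda>(z, \<xi>). ?x z \<xi> i) \<in> borel \<Otimes>\<^sub>M noise {1..p} \<rightarrow>\<^sub>M borel" if "i \<in> {0..p}" for i
    proof (cases "i = 0")
      case False
      then have "i \<in> {1..p}" using that by auto
      then have "(\<lambda>s. snd s i) \<in> (borel :: 'a measure) \<Otimes>\<^sub>M noise {1..p} \<rightarrow>\<^sub>M borel"
        by (intro measurable_compose[OF measurable_snd noise_component])
      then show ?thesis unfolding if_not_P[OF False] case_prod_unfold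
        by (intro borel_measurable_add borel_measurable_scaleR borel_measurable_const measurable_fst)
    qed (simp add: case_prod_unfold)
    have gm: "(\<lambda>(z, \<xi>). ennreal (gibbs_weight \<Phi> {0..p} (?x z \<xi>) j) * indicator A (?x z \<xi> j))
        \<in> borel_measurable (borel \<Otimes>\<^sub>M noise {1..p})"
      unfolding case_prod_unfold
      by (intro borel_measurable_times_ennreal measurable_compose[OF gibbs_weight_measurable measurable_ennreal]
          measurable_compose[OF xm[unfolded case_prod_unfold] borel_measurable_indicator] xm[unfolded case_prod_unfold] j A)
    have "(\<integral>\<^sup>+z. (\<integral>\<^sup>+x. ?f x \<partial>PiM {1..p} (\<lambda>k. pCN \<rho> \<mu>0 z)) \<partial>pCN \<rho> \<mu>0 x0)
      = (\<integral>\<^sup>+\<xi>0. (\<integral>\<^sup>+\<xi>. ennreal (gibbs_weight \<Phi> {0..p} (?x (\<rho> *\<^sub>R x0 + \<sigma> *\<^sub>R \<xi>0) \<xi>) j)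
            * indicator A (?x (\<rho> *\<^sub>R x0 + \<sigma> *\<^sub>R \<xi>0) \<xi> j) \<partial>noise {1..p}) \<partial>\<mu>0)"
      unfolding inner unfolding pCN_shift
      by (rule nn_integral_distr[OF measurable_shift]) (use P.borel_measurable_nn_integral[OF gm] in simp)
    also have "\<dots> = (\<integral>\<^sup>+\<xi>0. (\<integral>\<^sup>+\<xi>. ennreal (mp_weight x0 (\<xi>0, \<xi>) j) * indicator A (mp_state x0 (\<xi>0, \<xi>) j) \<partial>noise {1..p}) \<partial>\<mu>0)"
      by (simp only: mp_weight_def mp_state_def[abs_def] fst_conv snd_conv)
    also have "\<dots> = (\<integral>\<^sup>+\<omega>. ennreal (mp_weight x0 \<omega> j) * indicator A (mp_state x0 \<omega> j) \<partial>mp_noise)"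
    proof -
      have "(\<lambda>\<omega>. ennreal (mp_weight x0 \<omega> j) * indicator A (mp_state x0 \<omega> j)) \<in> borel_measurable mp_noise"
        using mp.w_slice[OF j, of x0] measurable_compose[OF mp.F_slice[OF j, of x0] borel_measurable_indicator[OF A]]
        by (intro borel_measurable_times_ennreal) auto
      then show ?thesis unfolding mp_noise_def by (rule P.nn_integral_fst)
    qed
    finally show "(\<integral>\<^sup>+\<omega>. ennreal (mp_weight x0 \<omega> j) * indicator A (mp_state x0 \<omega> j) \<partial>mp_noise)
      = (\<integral>\<^sup>+z. (\<integral>\<^sup>+x. ?f x \<partial>PiM {1..p} (\<lambda>k. pCN \<rho> \<mu>0 z)) \<partial>pCN \<rho> \<mu>0 x0)" by (rule sym)
  qed
  finally show "(\<Sum>j\<in>{0..p}. \<integral>\<^sup>+z. (\<integral>\<^sup>+x. ennreal (gibbs_weight \<Phi> {0..p} (x(0 := x0)) j) * indicator A ((x(0 := x0)) j)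
        \<partial>PiM {1..p} (\<lambda>k. pCN \<rho> \<mu>0 z)) \<partial>pCN \<rho> \<mu>0 x0)
      = emeasure (mixture mp_noise {0..p} (mp_weight x0) (mp_state x0)) A" by (rule sym)
qed

section \<open>The MTpCN kernel\<close>

text \<open>
  The first component of the noise moves the proposals, the second one the reference points of the acceptance ratio. The
  reference points depend on the selected proposal \<open>j\<close>; using the same noise for every \<open>j\<close> does not change the law, because
  only one \<open>j\<close> is selected.
\<close>

definition mt_noise :: "((nat \<Rightarrow> 'a) \<times> (nat \<Rightarrow> 'a)) measure" where
  "mt_noise = noise {1..p} \<Otimes>\<^sub>M noise {1..<p}"

definition mt_proposal :: "'a \<Rightarrow> (nat \<Rightarrow> 'a) \<times> (nat \<Rightarrow> 'a) \<Rightarrow> nat \<Rightarrow> 'a" where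
  "mt_proposal x \<omega> j = \<rho> *\<^sub>R x + \<sigma> *\<^sub>R fst \<omega> j"

definition mt_reference :: "'a \<Rightarrow> (nat \<Rightarrow> 'a) \<times> (nat \<Rightarrow> 'a) \<Rightarrow> nat \<Rightarrow> nat \<Rightarrow> 'a" where
  "mt_reference x \<omega> j k = \<rho> *\<^sub>R mt_proposal x \<omega> j + \<sigma> *\<^sub>R snd \<omega> k"

definition mt_state :: "'a \<Rightarrow> (nat \<Rightarrow> 'a) \<times> (nat \<Rightarrow> 'a) \<Rightarrow> nat \<Rightarrow> 'a" where
  "mt_state x \<omega> j = (if j = 0 then x else mt_proposal x \<omega> j)"

definition mt_choice :: "'a \<Rightarrow> (nat \<Rightarrow> 'a) \<times> (nat \<Rightarrow> 'a) \<Rightarrow> nat \<Rightarrow> real" where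
  "mt_choice x \<omega> j = gibbs_weight \<Phi> {1..p} (mt_proposal x \<omega>) j"

definition mt_acceptance :: "'a \<Rightarrow> (nat \<Rightarrow> 'a) \<times> (nat \<Rightarrow> 'a) \<Rightarrow> nat \<Rightarrow> real" where
  "mt_acceptance x \<omega> j = mt_accept \<Phi> p x (mt_proposal x \<omega>) (mt_reference x \<omega> j)"

text \<open>
  Index \<open>j > 0\<close> means that proposal \<open>j\<close> is selected and accepted. All rejections are collected in index 0.
\<close>

definition mt_weight :: "'a \<Rightarrow> (nat \<Rightarrow> 'a) \<times> (nat \<Rightarrow> 'a) \<Rightarrow> nat \<Rightarrow> real" where
  "mt_weight x \<omega> j = (if j = 0 then 1 - (\<Sum>i=1..p. mt_choice x \<omega> i * mt_acceptance x \<omega> i)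
     else mt_choice x \<omega> j * mt_acceptance x \<omega> j)"

lemma prob_mt_noise: "prob_space mt_noise"
  unfolding mt_noise_def by (intro prob_space_pair prob_noise)

lemma mt_proposal_measurable:
  assumes j: "j \<in> {1..p}"
  shows "(\<lambda>s. mt_proposal (fst s) (snd s) j) \<in> borel \<Otimes>\<^sub>M mt_noise \<rightarrow>\<^sub>M borel"
proof -
  have "fst \<in> mt_noise \<rightarrow>\<^sub>M noise {1..p}"
    unfolding mt_noise_def by (rule measurable_fst)
  then have "(\<lambda>s. fst (snd s) j) \<in> (borel :: 'a measure) \<Otimes>\<^sub>M mt_noise \<rightarrow>\<^sub>M borel"
    by (rule measurable_compose[OF measurable_compose[OF measurable_snd] noise_component[OF j]])
  then show ?thesis unfolding mt_proposal_def
    by (intro borel_measurable_add borel_measurable_scaleR borel_measurable_const measurable_fst)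
qed

lemma mt_reference_measurable:
  assumes j: "j \<in> {1..p}" and k: "k \<in> {1..<p}"
  shows "(\<lambda>s. mt_reference (fst s) (snd s) j k) \<in> borel \<Otimes>\<^sub>M mt_noise \<rightarrow>\<^sub>M borel"
proof -
  have "snd \<in> mt_noise \<rightarrow>\<^sub>M noise {1..<p}"
    unfolding mt_noise_def by (rule measurable_snd)
  then have "(\<lambda>s. snd (snd s) k) \<in> (borel :: 'a measure) \<Otimes>\<^sub>M mt_noise \<rightarrow>\<^sub>M borel"
    by (rule measurable_compose[OF measurable_compose[OF measurable_snd] noise_component[OF k]])
  then show ?thesis unfolding mt_reference_def
    by (intro borel_measurable_add borel_measurable_scaleR borel_measurable_const mt_proposal_measurable j)
qed

lemma mt_choice_measurable:
  "j \<in> {1..p} \<Longrightarrow> (\<lambda>s. mt_choice (fst s) (snd s) j) \<in> borel_measurable (borel \<Otimes>\<^sub>M mt_noise)"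
  unfolding mt_choice_def by (intro gibbs_weight_measurable mt_proposal_measurable)

lemma mt_acceptance_measurable:
  "j \<in> {1..p} \<Longrightarrow> (\<lambda>s. mt_acceptance (fst s) (snd s) j) \<in> borel_measurable (borel \<Otimes>\<^sub>M mt_noise)"
  unfolding mt_acceptance_def
  by (intro mt_accept_measurable mt_proposal_measurable mt_reference_measurable measurable_fst)

lemma mt_choice_nonneg: "0 \<le> mt_choice x \<omega> j"
  unfolding mt_choice_def by (rule gibbs_weight_nonneg) simp

lemma mt_choice_total: "(\<Sum>j=1..p. mt_choice x \<omega> j) = 1"
  unfolding mt_choice_def using p by (intro gibbs_weight_total) auto

lemma mt_acceptance_bounds: "exp (- 2 * B) \<le> mt_acceptance x \<omega> j" "mt_acceptance x \<omega> j \<le> 1" "0 \<le> mt_acceptance x \<omega> j"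
  unfolding mt_acceptance_def by (rule mt_accept_bounds)+

lemma mt_rejection: "mt_weight x \<omega> 0 = (\<Sum>j=1..p. mt_choice x \<omega> j * (1 - mt_acceptance x \<omega> j))"
  by (simp add: mt_weight_def right_diff_distrib sum_subtractf mt_choice_total[simplified])

lemma mt_weight_nonneg: "0 \<le> mt_weight x \<omega> j"
proof (cases "j = 0")
  case True
  then show ?thesis unfolding True mt_rejection
    using mt_choice_nonneg mt_acceptance_bounds by (intro sum_nonneg mult_nonneg_nonneg) auto
qed (simp add: mt_weight_def mt_choice_nonneg mt_acceptance_bounds)

lemma mt_proposal_contraction: "norm (mt_proposal x \<omega> j - mt_proposal y \<omega> j) = \<rho> * norm (x - y)"
proof -
  have "mt_proposal x \<omega> j - mt_proposal y \<omega> j = \<rho> *\<^sub>R (x - y)"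
    by (simp add: mt_proposal_def scaleR_right_diff_distrib)
  then show ?thesis using \<rho> by simp
qed

lemma mt_reference_contraction: "norm (mt_reference x \<omega> j k - mt_reference y \<omega> j k) = \<rho> * (\<rho> * norm (x - y))"
proof -
  have "mt_reference x \<omega> j k - mt_reference y \<omega> j k = \<rho> *\<^sub>R (mt_proposal x \<omega> j - mt_proposal y \<omega> j)"
    by (simp add: mt_reference_def scaleR_right_diff_distrib)
  then show ?thesis using \<rho> by (simp add: mt_proposal_contraction)
qed

lemma mt_weight_log_Lipschitz:
  assumes j: "j \<in> {1..p}"
  shows "mt_weight x \<omega> j \<le> exp (4 * L * norm (x - y)) * mt_weight y \<omega> j"
proof -
  define r where "r = norm (x - y)"
  have r1: "\<rho> * r \<le> r" using \<rho> by (simp add: r_def mult_left_le_one_le)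
  then have r2: "\<rho> * (\<rho> * r) \<le> r" using \<rho> by (meson mult_left_mono order_trans)
  have "mt_choice x \<omega> j \<le> exp (2 * L * r) * mt_choice y \<omega> j"
    unfolding mt_choice_def using j r1
    by (intro gibbs_weight_log_Lipschitz) (auto simp: mt_proposal_contraction r_def)
  moreover have "mt_acceptance x \<omega> j \<le> exp (2 * L * r) * mt_acceptance y \<omega> j"
    unfolding mt_acceptance_def using r1 r2
    by (intro mt_accept_log_Lipschitz) (auto simp: mt_proposal_contraction mt_reference_contraction r_def)
  ultimately have "mt_choice x \<omega> j * mt_acceptance x \<omega> j
      \<le> (exp (2 * L * r) * mt_choice y \<omega> j) * (exp (2 * L * r) * mt_acceptance y \<omega> j)"
    using mt_choice_nonneg mt_acceptance_bounds(3) by (intro mult_mono mult_nonneg_nonneg) auto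
  also have "\<dots> = exp (4 * L * r) * (mt_choice y \<omega> j * mt_acceptance y \<omega> j)"
  proof -
    have "exp (4 * L * r) = exp (2 * L * r) * exp (2 * L * r)" by (simp add: exp_add[symmetric])
    then show ?thesis by simp
  qed
  finally show ?thesis using j by (simp add: mt_weight_def r_def)
qed

lemma mt_lazy_random_contraction:
  "lazy_random_contraction mt_noise p mt_weight mt_state \<rho> move_min (4 * L)"
proof (intro lazy_random_contraction.intro lazy_random_contraction_axioms.intro)
  show "prob_space mt_noise" by (rule prob_mt_noise)
  fix j assume j: "j \<in> {0..p}"
  show "(\<lambda>(x, \<omega>). mt_state x \<omega> j) \<in> borel \<Otimes>\<^sub>M mt_noise \<rightarrow>\<^sub>M borel"
  proof (cases "j = 0")
    case True
    show ?thesis unfolding mt_state_def if_P[OF True] case_prod_unfold by (rule measurable_fst)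
  next
    case False
    then have "j \<in> {1..p}" using j by auto
    then show ?thesis unfolding mt_state_def if_not_P[OF False] case_prod_unfold by (rule mt_proposal_measurable)
  qed
  show "(\<lambda>(x, \<omega>). mt_weight x \<omega> j) \<in> borel_measurable (borel \<Otimes>\<^sub>M mt_noise)"
  proof (cases "j = 0")
    case True
    show ?thesis unfolding mt_weight_def if_P[OF True] case_prod_unfold
      by (intro borel_measurable_diff borel_measurable_const borel_measurable_sum borel_measurable_times
          mt_choice_measurable mt_acceptance_measurable)
  next
    case False
    then have "j \<in> {1..p}" using j by auto
    then show ?thesis unfolding mt_weight_def if_not_P[OF False] case_prod_unfold
      by (intro borel_measurable_times mt_choice_measurable mt_acceptance_measurable)
  qed
next
  fix x y \<omega> and j :: nat assume j: "j \<in> {1..p}"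
  then show "norm (mt_state x \<omega> j - mt_state y \<omega> j) \<le> \<rho> * norm (x - y)"
    by (simp add: mt_state_def mt_proposal_contraction)
  show "mt_weight x \<omega> j \<le> exp (4 * L * norm (x - y)) * mt_weight y \<omega> j"
    by (rule mt_weight_log_Lipschitz[OF j])
next
  fix x \<omega> and j :: nat assume j: "j \<in> {1..p}"
  have "move_min / p \<le> exp (- 4 * B) / p"
    by (intro divide_right_mono) (auto simp: move_min_def)
  also have "\<dots> = exp (- 2 * B) / card {1..p} * exp (- 2 * B)" by (simp add: exp_add[symmetric])
  also have "\<dots> \<le> mt_choice x \<omega> j * mt_acceptance x \<omega> j"
    unfolding mt_choice_def using j mt_acceptance_bounds
    by (intro mult_mono gibbs_weight_bounds gibbs_weight_nonneg) auto
  finally show "move_min / p \<le> mt_weight x \<omega> j" using j by (simp add: mt_weight_def)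
next
  show "(\<Sum>j = 0..p. mt_weight x \<omega> j) = 1" for x \<omega>
    by (simp add: sum.atLeast_Suc_atMost mt_weight_def)
qed (use \<rho> p L_nonneg move_min in \<open>auto simp: mt_weight_nonneg mt_state_def\<close>)

text \<open>
  The rejected parts of the \<open>p\<close> summands of the kernel add up to the summand with index 0 of the mixture.
\<close>

lemma MTpCN_eq_mixture: "MTpCN \<rho> \<mu>0 \<Phi> p x0 = mixture mt_noise {0..p} (mt_weight x0) (mt_state x0)"
  unfolding MTpCN_def
proof (rule measure_of_mixture)
  fix A :: "'a set" assume A [measurable]: "A \<in> sets borel"
  interpret Q: prob_space "noise {1..<p}" by (rule prob_noise)
  interpret mt: lazy_random_contraction mt_noise p mt_weight mt_state \<rho> move_min "4 * L"
    by (rule mt_lazy_random_contraction)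
  let ?t = "\<lambda>j x z. gibbs_weight \<Phi> {1..p} x j *
      (mt_accept \<Phi> p x0 x z * indicator A (x j) + (1 - mt_accept \<Phi> p x0 x z) * indicator A x0)"
  let ?T = "\<lambda>j \<omega>. ?t j (mt_proposal x0 \<omega>) (mt_reference x0 \<omega> j)"
  have t_measurable: "(\<lambda>s. ennreal (?t j (g s) (h s))) \<in> borel_measurable N"
    if g: "\<And>i. i \<in> {1..p} \<Longrightarrow> (\<lambda>s. g s i) \<in> N \<rightarrow>\<^sub>M borel" and h: "\<And>i. i \<in> {1..<p} \<Longrightarrow> (\<lambda>s. h s i) \<in> N \<rightarrow>\<^sub>M borel"
      and j: "j \<in> {1..p}" for g h j and N :: "'d measure"
  proof -
    have acc: "(\<lambda>s. mt_accept \<Phi> p x0 (g s) (h s)) \<in> borel_measurable N"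
      by (rule mt_accept_measurable[OF g h measurable_const]) simp_all
    have ind: "(\<lambda>s. indicator A (g s j) :: real) \<in> borel_measurable N"
      by (rule measurable_compose[OF g[OF j] borel_measurable_indicator[OF A]])
    have "(\<lambda>s. ?t j (g s) (h s)) \<in> borel_measurable N"
      by (intro borel_measurable_times borel_measurable_add borel_measurable_diff borel_measurable_const acc ind
          gibbs_weight_measurable g j)
    then show ?thesis by simp
  qed
  have t_cong: "?t j x z = ?t j y u"
    if "\<And>i. i \<in> {1..p} \<Longrightarrow> x i = y i" "\<And>i. i \<in> {1..<p} \<Longrightarrow> z i = u i" "j \<in> {1..p}" for j x y z u
    by (simp only: gibbs_weight_cong[of "{1..p}" x y j \<Phi>, OF that(1,3)] mt_accept_cong[of p x y z u \<Phi> x0, OF that(1,2)] that(1)[OF that(3)])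
  have T_eq: "?T j \<omega> = mt_choice x0 \<omega> j * mt_acceptance x0 \<omega> j * indicator A (mt_state x0 \<omega> j)
      + mt_choice x0 \<omega> j * (1 - mt_acceptance x0 \<omega> j) * indicator A x0" if "j \<in> {1..p}" for j \<omega>
    using that by (simp add: mt_choice_def mt_acceptance_def mt_state_def distrib_left mult.assoc)
  have T_nonneg: "0 \<le> ?T j \<omega>" if "j \<in> {1..p}" for j \<omega>
    unfolding T_eq[OF that] using mt_choice_nonneg mt_acceptance_bounds
    by (intro add_nonneg_nonneg mult_nonneg_nonneg) auto
  have mT: "(\<lambda>\<omega>. ennreal (?T j \<omega>)) \<in> borel_measurable mt_noise" if j: "j \<in> {1..p}" for j
  proof (rule t_measurable[of "mt_proposal x0" _ "\<lambda>\<omega>. mt_reference x0 \<omega> j", OF _ _ j])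
    have fix_x0: "Pair x0 \<in> mt_noise \<rightarrow>\<^sub>M borel \<Otimes>\<^sub>M mt_noise"
      by (rule measurable_Pair1') simp
    show "(\<lambda>\<omega>. mt_proposal x0 \<omega> i) \<in> mt_noise \<rightarrow>\<^sub>M borel" if "i \<in> {1..p}" for i
      using measurable_compose[OF fix_x0 mt_proposal_measurable[OF that]] by (simp only: fst_conv snd_conv)
    show "(\<lambda>\<omega>. mt_reference x0 \<omega> j i) \<in> mt_noise \<rightarrow>\<^sub>M borel" if "i \<in> {1..<p}" for i
      using measurable_compose[OF fix_x0 mt_reference_measurable[OF j that]] by (simp only: fst_conv snd_conv)
  qed
  have "emeasure (mixture mt_noise {0..p} (mt_weight x0) (mt_state x0)) A
      = (\<Sum>j\<in>{0..p}. \<integral>\<^sup>+\<omega>. ennreal (mt_weight x0 \<omega> j) * indicator A (mt_state x0 \<omega> j) \<partial>mt_noise)"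
    using mt.nn_integral_kernel[of "indicator A" x0] by (simp add: mt.kernel_def)
  also have "\<dots> = (\<integral>\<^sup>+\<omega>. (\<Sum>j\<in>{0..p}. ennreal (mt_weight x0 \<omega> j) * indicator A (mt_state x0 \<omega> j)) \<partial>mt_noise)"
    by (intro nn_integral_sum[symmetric] borel_measurable_times_ennreal measurable_compose[OF mt.w_slice measurable_ennreal]
        measurable_compose[OF mt.F_slice borel_measurable_indicator[OF A]])
  also have "\<dots> = (\<integral>\<^sup>+\<omega>. (\<Sum>j=1..p. ennreal (?T j \<omega>)) \<partial>mt_noise)"
  proof (rule nn_integral_cong)
    fix \<omega>
    have "(\<Sum>j\<in>{0..p}. ennreal (mt_weight x0 \<omega> j) * indicator A (mt_state x0 \<omega> j))
        = (\<Sum>j\<in>{0..p}. ennreal (mt_weight x0 \<omega> j * indicator A (mt_state x0 \<omega> j)))"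
      by (intro sum.cong refl) (simp add: indicator_def)
    also have "\<dots> = ennreal (\<Sum>j\<in>{0..p}. mt_weight x0 \<omega> j * indicator A (mt_state x0 \<omega> j))"
      using mt_weight_nonneg by (intro sum_ennreal) simp
    also have "(\<Sum>j\<in>{0..p}. mt_weight x0 \<omega> j * indicator A (mt_state x0 \<omega> j)) = (\<Sum>j=1..p. ?T j \<omega>)"
    proof -
      have "(\<Sum>j\<in>{0..p}. mt_weight x0 \<omega> j * indicator A (mt_state x0 \<omega> j))
          = mt_weight x0 \<omega> 0 * indicator A x0 + (\<Sum>j=1..p. mt_weight x0 \<omega> j * indicator A (mt_state x0 \<omega> j))"
        by (simp add: mt.idx_split mt_state_def)
      also have "(\<Sum>j=1..p. mt_weight x0 \<omega> j * indicator A (mt_state x0 \<omega> j))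
          = (\<Sum>j=1..p. mt_choice x0 \<omega> j * mt_acceptance x0 \<omega> j * indicator A (mt_state x0 \<omega> j))"
        by (intro sum.cong refl) (simp add: mt_weight_def)
      also have "mt_weight x0 \<omega> 0 * indicator A x0 + \<dots> = (\<Sum>j=1..p. ?T j \<omega>)"
        unfolding mt_rejection sum_distrib_right sum.distrib[symmetric]
        by (intro sum.cong refl) (subst T_eq, assumption, rule add.commute)
      finally show ?thesis .
    qed
    also have "ennreal (\<Sum>j=1..p. ?T j \<omega>) = (\<Sum>j=1..p. ennreal (?T j \<omega>))"
      using T_nonneg by (intro sum_ennreal[symmetric])
    finally show "(\<Sum>j\<in>{0..p}. ennreal (mt_weight x0 \<omega> j) * indicator A (mt_state x0 \<omega> j)) = (\<Sum>j=1..p. ennreal (?T j \<omega>))" .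
  qed
  also have "\<dots> = (\<Sum>j=1..p. \<integral>\<^sup>+\<omega>. ennreal (?T j \<omega>) \<partial>mt_noise)"
    by (rule nn_integral_sum[OF mT])
  also have "\<dots> = (\<Sum>j=1..p. \<integral>\<^sup>+x. (\<integral>\<^sup>+z. ennreal (?t j x z) \<partial>PiM {1..<p} (\<lambda>k. pCN \<rho> \<mu>0 (x j))) \<partial>PiM {1..p} (\<lambda>m. pCN \<rho> \<mu>0 x0))"
  proof (intro sum.cong refl)
    fix j assume j: "j \<in> {1..p}"
    let ?z = "\<lambda>x \<zeta> k. \<rho> *\<^sub>R x j + \<sigma> *\<^sub>R \<zeta> k"
    have inner: "(\<integral>\<^sup>+z. ennreal (?t j x z) \<partial>PiM {1..<p} (\<lambda>k. pCN \<rho> \<mu>0 (x j)))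
        = (\<integral>\<^sup>+\<zeta>. ennreal (?t j x (?z x \<zeta>)) \<partial>noise {1..<p})" for x
    proof -
      have "(\<lambda>z. ennreal (?t j x z)) \<in> borel_measurable (PiM {1..<p} (\<lambda>_. borel))"
        by (rule t_measurable[of "\<lambda>_. x" _ "\<lambda>z. z", OF _ measurable_component_singleton j]) simp_all
      then have "(\<integral>\<^sup>+z. ennreal (?t j x z) \<partial>PiM {1..<p} (\<lambda>k. pCN \<rho> \<mu>0 (x j)))
          = (\<integral>\<^sup>+\<zeta>. ennreal (?t j x (\<lambda>k\<in>{1..<p}. \<rho> *\<^sub>R x j + \<sigma> *\<^sub>R \<zeta> k)) \<partial>noise {1..<p})"
        by (intro nn_integral_PiM_pCN) auto
      also have "\<dots> = (\<integral>\<^sup>+\<zeta>. ennreal (?t j x (?z x \<zeta>)) \<partial>noise {1..<p})"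
      proof (rule nn_integral_cong)
        fix \<zeta> :: "nat \<Rightarrow> 'a"
        have "?t j x (\<lambda>k\<in>{1..<p}. \<rho> *\<^sub>R x j + \<sigma> *\<^sub>R \<zeta> k) = ?t j x (?z x \<zeta>)"
          by (rule t_cong[OF refl _ j]) simp
        then show "ennreal (?t j x (\<lambda>k\<in>{1..<p}. \<rho> *\<^sub>R x j + \<sigma> *\<^sub>R \<zeta> k)) = ennreal (?t j x (?z x \<zeta>))" by (rule arg_cong)
      qed
      finally show ?thesis .
    qed
    have pm: "(\<lambda>s. fst s i) \<in> PiM {1..p} (\<lambda>_. borel :: 'a measure) \<Otimes>\<^sub>M noise {1..<p} \<rightarrow>\<^sub>M borel" if "i \<in> {1..p}" for i
      by (rule measurable_compose[OF measurable_fst measurable_component_singleton[OF that]])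
    have qm: "(\<lambda>s. snd s i) \<in> PiM {1..p} (\<lambda>_. borel :: 'a measure) \<Otimes>\<^sub>M noise {1..<p} \<rightarrow>\<^sub>M borel" if "i \<in> {1..<p}" for i
      by (rule measurable_compose[OF measurable_snd noise_component[OF that]])
    have jm: "(\<lambda>(x, \<zeta>). ennreal (?t j x (?z x \<zeta>))) \<in> borel_measurable (PiM {1..p} (\<lambda>_. borel) \<Otimes>\<^sub>M noise {1..<p})"
      unfolding case_prod_unfold
      by (intro t_measurable[of fst _ "\<lambda>s. ?z (fst s) (snd s)"] pm j borel_measurable_add borel_measurable_scaleR borel_measurable_const qm)
    have "(\<integral>\<^sup>+x. (\<integral>\<^sup>+z. ennreal (?t j x z) \<partial>PiM {1..<p} (\<lambda>k. pCN \<rho> \<mu>0 (x j))) \<partial>PiM {1..p} (\<lambda>m. pCN \<rho> \<mu>0 x0))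
        = (\<integral>\<^sup>+x. (\<integral>\<^sup>+\<zeta>. ennreal (?t j x (?z x \<zeta>)) \<partial>noise {1..<p}) \<partial>PiM {1..p} (\<lambda>m. pCN \<rho> \<mu>0 x0))"
      by (simp only: inner)
    also have "\<dots> = (\<integral>\<^sup>+\<xi>. (\<integral>\<^sup>+\<zeta>. ennreal (?t j (\<lambda>k\<in>{1..p}. \<rho> *\<^sub>R x0 + \<sigma> *\<^sub>R \<xi> k) (?z (\<lambda>k\<in>{1..p}. \<rho> *\<^sub>R x0 + \<sigma> *\<^sub>R \<xi> k) \<zeta>))
        \<partial>noise {1..<p}) \<partial>noise {1..p})"
      by (rule nn_integral_PiM_pCN[OF _ Q.borel_measurable_nn_integral[OF jm]]) simp
    also have "\<dots> = (\<integral>\<^sup>+\<xi>. (\<integral>\<^sup>+\<zeta>. ennreal (?T j (\<xi>, \<zeta>)) \<partial>noise {1..<p}) \<partial>noise {1..p})"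
    proof (intro nn_integral_cong)
      fix \<xi> \<zeta> :: "nat \<Rightarrow> 'a"
      let ?x = "\<lambda>k\<in>{1..p}. \<rho> *\<^sub>R x0 + \<sigma> *\<^sub>R \<xi> k"
      have "?t j ?x (?z ?x \<zeta>) = ?T j (\<xi>, \<zeta>)"
        by (rule t_cong[OF _ _ j]) (use j in \<open>simp_all add: mt_proposal_def mt_reference_def\<close>)
      then show "ennreal (?t j ?x (?z ?x \<zeta>)) = ennreal (?T j (\<xi>, \<zeta>))" by (rule arg_cong)
    qed
    also have "\<dots> = (\<integral>\<^sup>+\<omega>. ennreal (?T j \<omega>) \<partial>mt_noise)"
      using mT[OF j] unfolding mt_noise_def by (rule Q.nn_integral_fst)
    finally show "(\<integral>\<^sup>+\<omega>. ennreal (?T j \<omega>) \<partial>mt_noise)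
        = (\<integral>\<^sup>+x. (\<integral>\<^sup>+z. ennreal (?t j x z) \<partial>PiM {1..<p} (\<lambda>k. pCN \<rho> \<mu>0 (x j))) \<partial>PiM {1..p} (\<lambda>m. pCN \<rho> \<mu>0 x0))" by (rule sym)
  qed
  finally show "(\<Sum>j=1..p. \<integral>\<^sup>+x. (\<integral>\<^sup>+z. ennreal (?t j x z) \<partial>PiM {1..<p} (\<lambda>k. pCN \<rho> \<mu>0 (x j))) \<partial>PiM {1..p} (\<lambda>m. pCN \<rho> \<mu>0 x0))
      = emeasure (mixture mt_noise {0..p} (mt_weight x0) (mt_state x0)) A" by (rule sym)
qed

section \<open>Contracting couplings for both kernels\<close>

lemma mp_noise_measurable:
  assumes G: "G \<in> borel \<rightarrow>\<^sub>M N"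
  shows "(\<lambda>\<omega>. G (fst \<omega>)) \<in> mp_noise \<rightarrow>\<^sub>M N" and "j \<in> {1..p} \<Longrightarrow> (\<lambda>\<omega>. G (snd \<omega> j)) \<in> mp_noise \<rightarrow>\<^sub>M N"
proof -
  have "G \<in> \<mu>0 \<rightarrow>\<^sub>M N" using G by (simp only: measurable_cong_sets[OF sets_\<mu>0 refl])
  then show "(\<lambda>\<omega>. G (fst \<omega>)) \<in> mp_noise \<rightarrow>\<^sub>M N"
    unfolding mp_noise_def by (rule measurable_compose[OF measurable_fst])
  show "(\<lambda>\<omega>. G (snd \<omega> j)) \<in> mp_noise \<rightarrow>\<^sub>M N" if "j \<in> {1..p}"
    unfolding mp_noise_def by (rule measurable_compose[OF measurable_compose[OF measurable_snd noise_component[OF that]] G])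
qed

lemma mt_noise_measurable:
  assumes G: "G \<in> borel \<rightarrow>\<^sub>M N" and j: "j \<in> {1..p}"
  shows "(\<lambda>\<omega>. G (fst \<omega> j)) \<in> mt_noise \<rightarrow>\<^sub>M N"
  unfolding mt_noise_def by (rule measurable_compose[OF measurable_compose[OF measurable_fst noise_component[OF j]] G])

lemma mp_noise_integral:
  assumes G: "G \<in> borel_measurable borel" and j: "j \<in> {1..p}"
  shows "(\<integral>\<^sup>+\<omega>. G (fst \<omega>) \<partial>mp_noise) = (\<integral>\<^sup>+\<xi>. G \<xi> \<partial>\<mu>0)" "(\<integral>\<^sup>+\<omega>. G (snd \<omega> j) \<partial>mp_noise) = (\<integral>\<^sup>+\<xi>. G \<xi> \<partial>\<mu>0)"
proof -
  interpret N: prob_space \<mu>0 by (rule prob_\<mu>0)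
  interpret P: prob_space "noise {1..p}" by (rule prob_noise)
  note m = mp_noise_measurable(1)[OF G, unfolded mp_noise_def] mp_noise_measurable(2)[OF G j, unfolded mp_noise_def]
  show "(\<integral>\<^sup>+\<omega>. G (fst \<omega>) \<partial>mp_noise) = (\<integral>\<^sup>+\<xi>. G \<xi> \<partial>\<mu>0)"
    unfolding mp_noise_def P.nn_integral_fst[OF m(1), symmetric]
    by (simp only: fst_conv nn_integral_const P.emeasure_space_1 mult_1_right)
  show "(\<integral>\<^sup>+\<omega>. G (snd \<omega> j) \<partial>mp_noise) = (\<integral>\<^sup>+\<xi>. G \<xi> \<partial>\<mu>0)"
    unfolding mp_noise_def P.nn_integral_fst[OF m(2), symmetric]
    by (simp only: snd_conv nn_integral_noise_component[OF finite_atLeastAtMost j G] nn_integral_const N.emeasure_space_1 mult_1_right)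
qed

lemma mt_noise_integral:
  assumes G: "G \<in> borel_measurable borel" and j: "j \<in> {1..p}"
  shows "(\<integral>\<^sup>+\<omega>. G (fst \<omega> j) \<partial>mt_noise) = (\<integral>\<^sup>+\<xi>. G \<xi> \<partial>\<mu>0)"
proof -
  interpret Q: prob_space "noise {1..<p}" by (rule prob_noise)
  show ?thesis
    unfolding mt_noise_def Q.nn_integral_fst[OF mt_noise_measurable[OF G j, unfolded mt_noise_def], symmetric]
    by (simp only: fst_conv nn_integral_const Q.emeasure_space_1 mult_1_right nn_integral_noise_component[OF finite_atLeastAtMost j G])
qed

text \<open>
  A move adds at most two noise vectors to a state whose norm has been multiplied by \<open>\<rho>\<close> or less: the centre and the
  proposal for mpCN, the proposal and a zero vector for MTpCN. The constants on the right are the same for both kernels and for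
  all \<open>p\<close>.
\<close>

lemma contracting_coupling_exists:
  assumes V: "V \<in> borel_measurable borel" "\<And>x. 0 \<le> V x"
    and G: "G \<in> borel_measurable borel" "\<And>\<xi>. 0 \<le> G \<xi>"
    and z: "(\<integral>\<^sup>+\<xi>. ennreal (G \<xi>) \<partial>\<mu>0) \<le> ennreal z" "G 0 \<le> z"
    and step: "\<And>x y \<xi> \<xi>'. norm y \<le> \<rho> * norm x + norm \<xi> + norm \<xi>' \<Longrightarrow> V y \<le> \<rho> * V x + (G \<xi> + G \<xi>')"
    and \<epsilon>: "0 < \<epsilon>" "16 * L * \<epsilon> \<le> move_min * (1 - \<rho>)"
    and P: "P = mpCN \<rho> \<mu>0 \<Phi> p \<or> P = MTpCN \<rho> \<mu>0 \<Phi> p"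
  shows "\<exists>K. contracting_coupling V \<epsilon> (1 - move_min * (1 - \<rho>)) (exp (2 * B) * (2 * z)) move_min \<rho>
    (1 - move_min * (1 - \<rho>) / 2) P K"
  using P
proof
  have z0: "0 \<le> z" using G(2)[of 0] z(2) by linarith
  have Gm: "(\<lambda>\<xi>. ennreal (G \<xi>)) \<in> borel_measurable borel" using G(1) by simp
  have two: "ennreal z + ennreal z = ennreal (2 * z)" using z0 by (simp add: ennreal_plus[symmetric] del: ennreal_plus)
  have \<epsilon>': "4 * (4 * L) * \<epsilon> \<le> move_min * (1 - \<rho>)" using \<epsilon>(2) by simp
  {
    assume P: "P = mpCN \<rho> \<mu>0 \<Phi> p"
    interpret mp: lazy_random_contraction mp_noise p mp_weight mp_state \<rho> move_min "4 * L"
      by (rule mp_lazy_random_contraction)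
    have "contracting_coupling V \<epsilon> (1 - move_min * (1 - \<rho>)) (exp (2 * B) * (2 * z)) move_min \<rho>
      (1 - move_min * (1 - \<rho>) / 2) mp.kernel mp.coupled"
    proof (rule mp.contracting_coupling_coupled[where Z = "\<lambda>j \<omega>. G (fst \<omega>) + G (snd \<omega> j)"])
      fix x \<omega> and j :: nat assume j: "j \<in> {1..p}"
      have "mp_weight x \<omega> j \<le> exp (2 * B) / card {0..p}"
        unfolding mp_weight_def using j by (intro gibbs_weight_bounds) auto
      also have "\<dots> \<le> exp (2 * B) / p" using p by (intro divide_left_mono) auto
      finally show "mp_weight x \<omega> j \<le> exp (2 * B) / p" .
      have rs: "\<rho> * \<rho> \<le> \<rho>" "\<rho> * \<sigma> \<le> 1" using \<rho> \<sigma> by (auto intro: mult_left_le mult_le_one)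
      have "mp_state x \<omega> j = (\<rho> * \<rho>) *\<^sub>R x + (\<rho> * \<sigma>) *\<^sub>R fst \<omega> + \<sigma> *\<^sub>R snd \<omega> j"
        using j by (simp add: mp_state_def scaleR_right_distrib)
      then have "norm (mp_state x \<omega> j) \<le> norm ((\<rho> * \<rho>) *\<^sub>R x) + norm ((\<rho> * \<sigma>) *\<^sub>R fst \<omega>) + norm (\<sigma> *\<^sub>R snd \<omega> j)"
        by (simp only:) (intro norm_triangle_le add_mono order_refl)
      also have "\<dots> = (\<rho> * \<rho>) * norm x + (\<rho> * \<sigma>) * norm (fst \<omega>) + \<sigma> * norm (snd \<omega> j)"
        using \<rho> \<sigma> by simp
      also have "\<dots> \<le> \<rho> * norm x + 1 * norm (fst \<omega>) + 1 * norm (snd \<omega> j)"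
        using rs \<sigma> by (intro add_mono mult_right_mono) auto
      finally show "V (mp_state x \<omega> j) \<le> \<rho> * V x + (G (fst \<omega>) + G (snd \<omega> j))" by (intro step) simp
    next
      fix j :: nat assume j: "j \<in> {1..p}"
      note ints = mp_noise_integral[OF Gm j]
      show "(\<lambda>\<omega>. G (fst \<omega>) + G (snd \<omega> j)) \<in> borel_measurable mp_noise"
        by (intro borel_measurable_add mp_noise_measurable G j)
      have "(\<integral>\<^sup>+\<omega>. ennreal (G (fst \<omega>) + G (snd \<omega> j)) \<partial>mp_noise)
          = (\<integral>\<^sup>+\<omega>. ennreal (G (fst \<omega>)) + ennreal (G (snd \<omega> j)) \<partial>mp_noise)"
        using G(2) by (intro nn_integral_cong) simp
      also have "\<dots> = (\<integral>\<^sup>+\<xi>. ennreal (G \<xi>) \<partial>\<mu>0) + (\<integral>\<^sup>+\<xi>. ennreal (G \<xi>) \<partial>\<mu>0)"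
        by (simp only: nn_integral_add[OF mp_noise_measurable(1)[OF Gm] mp_noise_measurable(2)[OF Gm j]] ints)
      also have "\<dots> \<le> ennreal (2 * z)" unfolding two[symmetric] by (intro add_mono z)
      finally show "(\<integral>\<^sup>+\<omega>. ennreal (G (fst \<omega>) + G (snd \<omega> j)) \<partial>mp_noise) \<le> ennreal (2 * z)" .
    qed (use V G(2) z0 \<epsilon>(1) \<epsilon>' in \<open>auto intro: add_nonneg_nonneg\<close>)
    moreover have "mp.kernel = P" unfolding P by (rule ext) (simp only: mp.kernel_def mpCN_eq_mixture)
    ultimately show ?thesis by auto
  next
    assume P: "P = MTpCN \<rho> \<mu>0 \<Phi> p"
    interpret mt: lazy_random_contraction mt_noise p mt_weight mt_state \<rho> move_min "4 * L"
      by (rule mt_lazy_random_contraction)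
    have "contracting_coupling V \<epsilon> (1 - move_min * (1 - \<rho>)) (exp (2 * B) * (2 * z)) move_min \<rho>
      (1 - move_min * (1 - \<rho>) / 2) mt.kernel mt.coupled"
    proof (rule mt.contracting_coupling_coupled[where Z = "\<lambda>j \<omega>. G (fst \<omega> j) + G 0"])
      fix x \<omega> and j :: nat assume j: "j \<in> {1..p}"
      have "mt_weight x \<omega> j \<le> mt_choice x \<omega> j"
        using j mt_choice_nonneg mt_acceptance_bounds by (simp add: mt_weight_def mult_left_le)
      also have "\<dots> \<le> exp (2 * B) / card {1..p}"
        unfolding mt_choice_def using j by (intro gibbs_weight_bounds) auto
      finally show "mt_weight x \<omega> j \<le> exp (2 * B) / p" by simp
      have "mt_state x \<omega> j = \<rho> *\<^sub>R x + \<sigma> *\<^sub>R fst \<omega> j" using j by (simp add: mt_state_def mt_proposal_def)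
      then have "norm (mt_state x \<omega> j) \<le> norm (\<rho> *\<^sub>R x) + norm (\<sigma> *\<^sub>R fst \<omega> j)"
        by (simp only: norm_triangle_ineq)
      also have "\<dots> \<le> \<rho> * norm x + 1 * norm (fst \<omega> j)"
        using \<rho> \<sigma> by (intro add_mono) (auto intro: mult_right_mono mult_left_le_one_le)
      finally show "V (mt_state x \<omega> j) \<le> \<rho> * V x + (G (fst \<omega> j) + G 0)" by (intro step) simp
    next
      fix j :: nat assume j: "j \<in> {1..p}"
      note ints = mt_noise_integral[OF Gm j]
      show "(\<lambda>\<omega>. G (fst \<omega> j) + G 0) \<in> borel_measurable mt_noise"
        by (intro borel_measurable_add mt_noise_measurable G j borel_measurable_const)
      have "(\<integral>\<^sup>+\<omega>. ennreal (G (fst \<omega> j) + G 0) \<partial>mt_noise)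
          = (\<integral>\<^sup>+\<omega>. ennreal (G (fst \<omega> j)) + ennreal (G 0) \<partial>mt_noise)"
        using G(2) by (intro nn_integral_cong) simp
      also have "\<dots> = (\<integral>\<^sup>+\<xi>. ennreal (G \<xi>) \<partial>\<mu>0) + (\<integral>\<^sup>+\<omega>. ennreal (G 0) \<partial>mt_noise)"
        by (simp only: nn_integral_add[OF mt_noise_measurable[OF Gm j] borel_measurable_const] ints)
      also have "\<dots> = (\<integral>\<^sup>+\<xi>. ennreal (G \<xi>) \<partial>\<mu>0) + ennreal (G 0)"
        using prob_space.emeasure_space_1[OF prob_mt_noise] by simp
      also have "\<dots> \<le> ennreal (2 * z)" unfolding two[symmetric] by (intro add_mono z ennreal_leI)
      finally show "(\<integral>\<^sup>+\<omega>. ennreal (G (fst \<omega> j) + G 0) \<partial>mt_noise) \<le> ennreal (2 * z)" .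
    qed (use V G(2) z0 \<epsilon>(1) \<epsilon>' in \<open>auto intro: add_nonneg_nonneg\<close>)
    moreover have "mt.kernel = P" unfolding P by (rule ext) (simp only: mt.kernel_def MTpCN_eq_mixture)
    ultimately show ?thesis by auto
  }
qed

end


section \<open>Lyapunov functions of the norm\<close>

text \<open>
  The properties of a function of the norm that the argument uses. Convexity splits the noise off the state, unbounded growth
  makes sublevel sets bounded, and the last bound makes the dilated profile integrable for a measure for which
  \<open>exp (t * (norm x)\<^sup>2)\<close> is integrable.
\<close>

definition growth_profile :: "real \<Rightarrow> real \<Rightarrow> (real \<Rightarrow> real) \<Rightarrow> bool" where
  "growth_profile t c g \<longleftrightarrow> convex_on {0..} g \<and> mono_on {0..} g \<and> 0 \<le> g 0 \<and> g \<in> borel_measurable borel \<and>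
     (\<forall>r. \<exists>R. \<forall>s\<ge>0. g s \<le> r \<longrightarrow> s \<le> R) \<and> (\<exists>D\<ge>0. \<forall>s\<ge>0. g (c * s) \<le> D * exp (t * s\<^sup>2))"

text \<open>
  Complete the square.
\<close>

lemma exp_linear_le_exp_square:
  fixes t a s :: real
  assumes "0 < t"
  shows "exp (a * s) \<le> exp (a\<^sup>2 / (4 * t)) * exp (t * s\<^sup>2)"
proof -
  have "0 \<le> t * (s - a / (2 * t))\<^sup>2" using assms by simp
  also have "\<dots> = t * s\<^sup>2 - a * s + a\<^sup>2 / (4 * t)" using assms by (simp add: power2_eq_square field_simps)
  finally show ?thesis by (simp add: exp_add[symmetric])
qed

text \<open>
  Only the third family restricts \<open>v\<close>: dilating the argument by \<open>c\<close> turns \<open>v\<close> into \<open>v * c\<^sup>2\<close>, which must not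
  exceed \<open>t\<close>.
\<close>

lemma lyapunov_function_profile:
  fixes V :: "'a::real_normed_vector \<Rightarrow> real"
  assumes V: "V \<in> lyapunov_functions v0" and t: "0 < t" and c: "0 < c" and v0: "v0 * c\<^sup>2 \<le> t"
  obtains g where "V = (\<lambda>x. g (norm x))" "growth_profile t c g"
proof -
  consider (power) k :: nat where "1 \<le> k" "V = (\<lambda>x. norm x ^ k)"
    | (linear) v where "0 < v" "V = (\<lambda>x. exp (v * norm x))"
    | (square) v where "0 < v" "v \<le> v0" "V = (\<lambda>x. exp (v * (norm x)\<^sup>2))"
    using V by (auto simp: lyapunov_functions_def)
  then show ?thesis
  proof cases
    case power
    have "growth_profile t c (\<lambda>s. s ^ k)" unfolding growth_profile_def
    proof (intro conjI)
      show "convex_on {0..} (\<lambda>s::real. s ^ k)"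
        using convex_power_even[of k] convex_power_odd[of k] convex_on_subset[of UNIV "\<lambda>s::real. s ^ k" "{0..}"]
        by (cases "even k") auto
      show "mono_on {0..} (\<lambda>s::real. s ^ k)" by (auto intro!: mono_onI power_mono)
      show "\<forall>r. \<exists>R. \<forall>s\<ge>0. s ^ k \<le> r \<longrightarrow> s \<le> (R::real)"
      proof
        fix r :: real
        have "s \<le> max 1 r" if "0 \<le> s" "s ^ k \<le> r" for s :: real
        proof (cases "s \<le> 1")
          case False
          then have "s ^ 1 \<le> s ^ k" using power(1) by (intro power_increasing) auto
          then show ?thesis using that by simp
        qed simp
        then show "\<exists>R. \<forall>s\<ge>0. s ^ k \<le> r \<longrightarrow> s \<le> R" by blast
      qed
      have "(c * s) ^ k \<le> (real k ^ k * exp (c\<^sup>2 / (4 * t))) * exp (t * s\<^sup>2)" if s: "0 \<le> s" for s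
      proof -
        have "(c * s / k) ^ k \<le> (1 + c * s / k) ^ k" using s c by (intro power_mono) auto
        also have "\<dots> \<le> exp (c * s)"
          using s c power(1) by (intro exp_ge_one_plus_x_over_n_power_n) (auto intro: order_trans[of _ 0])
        also have "\<dots> \<le> exp (c\<^sup>2 / (4 * t)) * exp (t * s\<^sup>2)" by (rule exp_linear_le_exp_square[OF t])
        finally have "real k ^ k * (c * s / k) ^ k \<le> real k ^ k * (exp (c\<^sup>2 / (4 * t)) * exp (t * s\<^sup>2))"
          by (intro mult_left_mono) auto
        moreover have "real k ^ k * (c * s / k) ^ k = (c * s) ^ k"
          using power(1) by (simp add: power_mult_distrib[symmetric])
        ultimately show ?thesis by (simp add: mult.assoc)
      qed
      then show "\<exists>D\<ge>0. \<forall>s\<ge>0. (c * s) ^ k \<le> D * exp (t * s\<^sup>2)"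
        by (intro exI[of _ "real k ^ k * exp (c\<^sup>2 / (4 * t))"]) auto
    qed (use power in auto)
    with power(2) show ?thesis by (rule that[of "\<lambda>s. s ^ k"])
  next
    case linear
    have "growth_profile t c (\<lambda>s. exp (v * s))" unfolding growth_profile_def
    proof (intro conjI)
      show "convex_on {0..} (\<lambda>s. exp (v * s))"
      proof (rule convex_onI)
        fix u x y :: real assume u: "0 < u" "u < 1"
        have "exp ((1 - u) *\<^sub>R (v * x) + u *\<^sub>R (v * y)) \<le> (1 - u) * exp (v * x) + u * exp (v * y)"
          using u by (intro convex_onD[OF exp_convex]) auto
        then show "exp (v * ((1 - u) *\<^sub>R x + u *\<^sub>R y)) \<le> (1 - u) * exp (v * x) + u * exp (v * y)"
          by (simp add: algebra_simps)
      qed simp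
      show "mono_on {0..} (\<lambda>s. exp (v * s))" using linear by (auto intro!: mono_onI)
      show "\<forall>r. \<exists>R. \<forall>s\<ge>0. exp (v * s) \<le> r \<longrightarrow> s \<le> R"
      proof
        fix r :: real
        have "s \<le> r / v" if "exp (v * s) \<le> r" for s
        proof -
          have "v * s \<le> r" using exp_ge_add_one_self[of "v * s"] that by linarith
          then show ?thesis using linear(1) by (simp add: field_simps)
        qed
        then show "\<exists>R. \<forall>s\<ge>0. exp (v * s) \<le> r \<longrightarrow> s \<le> R" by blast
      qed
      show "\<exists>D\<ge>0. \<forall>s\<ge>0. exp (v * (c * s)) \<le> D * exp (t * s\<^sup>2)"
        using exp_linear_le_exp_square[OF t, of "v * c"]
        by (intro exI[of _ "exp ((v * c)\<^sup>2 / (4 * t))"]) (auto simp: mult.assoc)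
    qed auto
    with linear(2) show ?thesis by (rule that[of "\<lambda>s. exp (v * s)"])
  next
    case square
    have "growth_profile t c (\<lambda>s. exp (v * s\<^sup>2))" unfolding growth_profile_def
    proof (intro conjI)
      show "convex_on {0..} (\<lambda>s. exp (v * s\<^sup>2))"
      proof (rule convex_onI)
        fix u x y :: real assume u: "0 < u" "u < 1"
        have "((1 - u) *\<^sub>R x + u *\<^sub>R y)\<^sup>2 \<le> (1 - u) * x\<^sup>2 + u * y\<^sup>2"
          using u by (intro convex_onD[OF convex_power2]) auto
        then have "exp (v * ((1 - u) *\<^sub>R x + u *\<^sub>R y)\<^sup>2) \<le> exp ((1 - u) *\<^sub>R (v * x\<^sup>2) + u *\<^sub>R (v * y\<^sup>2))"
          using mult_left_mono[of _ _ v] square(1) by (fastforce simp: algebra_simps)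
        also have "\<dots> \<le> (1 - u) * exp (v * x\<^sup>2) + u * exp (v * y\<^sup>2)"
          using u by (intro convex_onD[OF exp_convex]) auto
        finally show "exp (v * ((1 - u) *\<^sub>R x + u *\<^sub>R y)\<^sup>2) \<le> (1 - u) * exp (v * x\<^sup>2) + u * exp (v * y\<^sup>2)" .
      qed simp
      show "mono_on {0..} (\<lambda>s. exp (v * s\<^sup>2))" using square by (auto intro!: mono_onI power_mono)
      show "\<forall>r. \<exists>R. \<forall>s\<ge>0. exp (v * s\<^sup>2) \<le> r \<longrightarrow> s \<le> R"
      proof
        fix r :: real
        have "s \<le> 1 + r / v" if "exp (v * s\<^sup>2) \<le> r" for s
        proof -
          have "v * s\<^sup>2 \<le> r" using exp_ge_add_one_self[of "v * s\<^sup>2"] that by linarith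
          then have "s\<^sup>2 \<le> r / v" using square(1) by (simp add: field_simps)
          moreover have "0 \<le> (s - 1/2)\<^sup>2" by simp
          ultimately show ?thesis by (simp add: power2_eq_square algebra_simps)
        qed
        then show "\<exists>R. \<forall>s\<ge>0. exp (v * s\<^sup>2) \<le> r \<longrightarrow> s \<le> R" by blast
      qed
      have "exp (v * (c * s)\<^sup>2) \<le> 1 * exp (t * s\<^sup>2)" for s
      proof -
        have "v * c\<^sup>2 \<le> t" using square(2) v0 mult_right_mono[of v v0 "c\<^sup>2"] by simp
        then have "(v * c\<^sup>2) * s\<^sup>2 \<le> t * s\<^sup>2" by (intro mult_right_mono) auto
        then show ?thesis by (simp add: power_mult_distrib mult.assoc)
      qed
      then show "\<exists>D\<ge>0. \<forall>s\<ge>0. exp (v * (c * s)\<^sup>2) \<le> D * exp (t * s\<^sup>2)"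
        by (intro exI[of _ 1]) auto
    qed auto
    with square(3) show ?thesis by (rule that[of "\<lambda>s. exp (v * s\<^sup>2)"])
  qed
qed

lemma growth_profile_nonneg: "growth_profile t c g \<Longrightarrow> 0 \<le> s \<Longrightarrow> 0 \<le> g s"
  unfolding growth_profile_def by (meson atLeast_iff mono_onD order_refl order_trans)

text \<open>
  The number \<open>\<rho> * r + a + b\<close> is the convex combination of \<open>r\<close> and \<open>(a + b) / (1 - \<rho>)\<close> with weights \<open>\<rho>\<close> and
  \<open>1 - \<rho>\<close>, and the second point is the midpoint of the dilated noises.
\<close>

lemma growth_profile_step:
  assumes g: "growth_profile t (2 / (1 - \<rho>)) g" and \<rho>: "0 \<le> \<rho>" "\<rho> < 1"
    and nonneg: "0 \<le> r" "0 \<le> a" "0 \<le> b" "0 \<le> s" and s: "s \<le> \<rho> * r + a + b"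
  shows "g s \<le> \<rho> * g r + (g (2 / (1 - \<rho>) * a) + g (2 / (1 - \<rho>) * b))"
proof -
  have conv: "convex_on {0..} g" and mono: "mono_on {0..} g" using g by (auto simp: growth_profile_def)
  define c where "c = 2 / (1 - \<rho>)"
  have c: "0 < c" using \<rho> by (simp add: c_def)
  define y where "y = (1 - 1 / 2) *\<^sub>R (c * a) + (1 / 2) *\<^sub>R (c * b)"
  have y: "0 \<le> y" using c nonneg by (simp add: y_def)
  have eq: "\<rho> * r + a + b = (1 - (1 - \<rho>)) *\<^sub>R r + (1 - \<rho>) *\<^sub>R y"
  proof -
    have "y = c * (a + b) / 2" by (simp add: y_def distrib_left)
    then have "(1 - \<rho>) * y = ((1 - \<rho>) * c) * (a + b) / 2" by simp
    also have "\<dots> = a + b" using \<rho> by (simp add: c_def)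
    finally show ?thesis by simp
  qed
  have "g s \<le> g (\<rho> * r + a + b)"
    using s nonneg \<rho> by (intro mono_onD[OF mono]) auto
  also have "\<dots> \<le> (1 - (1 - \<rho>)) * g r + (1 - \<rho>) * g y"
    unfolding eq using \<rho> nonneg y by (intro convex_onD[OF conv]) auto
  also have "\<dots> \<le> \<rho> * g r + 1 * g y"
    using \<rho> growth_profile_nonneg[OF g y] growth_profile_nonneg[OF g nonneg(1)]
    by (intro add_mono mult_right_mono) auto
  also have "g y \<le> (1 - 1 / 2) * g (c * a) + (1 / 2) * g (c * b)"
    unfolding y_def using c nonneg by (intro convex_onD[OF conv]) auto
  also have "\<dots> \<le> g (c * a) + g (c * b)"
    using growth_profile_nonneg[OF g, of "c * a"] growth_profile_nonneg[OF g, of "c * b"] c nonneg by simp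
  finally show ?thesis by (simp add: c_def)
qed

section \<open>Contraction uniform in the number of proposals\<close>

text \<open>
  All constants of the coupling are functions of \<open>\<rho>\<close>, \<open>\<epsilon>\<close>, \<open>M\<close> and the moment \<open>z\<close> of the noise. Hence the rate and
  \<open>n1\<close> from the weak Harris theorem can be chosen before \<open>\<Phi>\<close>, the kernel and \<open>p\<close>.
\<close>

lemma uniform_Wasserstein_contraction:
  fixes \<mu>0 :: "'a::{real_inner, polish_space} measure" and V :: "'a \<Rightarrow> real"
  assumes \<rho>: "0 \<le> \<rho>" "\<rho> < 1" and \<mu>0: "prob_space \<mu>0" "sets \<mu>0 = sets borel"
    and V: "V = (\<lambda>x. g (norm x))" and g: "growth_profile t (2 / (1 - \<rho>)) g"
    and moment: "(\<integral>\<^sup>+x. ennreal (exp (t * (norm x)\<^sup>2)) \<partial>\<mu>0) < top"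
    and \<epsilon>: "0 < \<epsilon>" "16 * \<bar>L\<bar> * \<epsilon> \<le> exp (- 4 * \<bar>M\<bar>) / 2 * (1 - \<rho>)"
  obtains \<eta> :: real and n1 :: nat where "0 < \<eta>" "\<eta> < 1"
    "\<And>\<Phi> P p \<nu>1 \<nu>2 n. (\<And>x. \<bar>\<Phi> x\<bar> \<le> M) \<Longrightarrow> L-lipschitz_on UNIV \<Phi> \<Longrightarrow> P = mpCN \<rho> \<mu>0 \<Phi> p \<or> P = MTpCN \<rho> \<mu>0 \<Phi> p \<Longrightarrow>
      1 \<le> p \<Longrightarrow> n1 \<le> n \<Longrightarrow> wasserstein (dist_eps_V V \<epsilon>) (bind \<nu>1 (kernel_power P n)) (bind \<nu>2 (kernel_power P n))
        \<le> ennreal (\<eta> ^ n) * wasserstein (dist_eps_V V \<epsilon>) \<nu>1 \<nu>2"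
proof -
  define c where "c = 2 / (1 - \<rho>)"
  have c: "0 < c" using \<rho>(2) by (simp add: c_def)
  have g': "growth_profile t c g" using g by (simp add: c_def)
  have g_meas: "g \<in> borel_measurable borel" using g by (simp add: growth_profile_def)
  have V_meas: "V \<in> borel_measurable borel"
    unfolding V by (rule measurable_compose[OF _ g_meas]) measurable
  have V_nonneg: "0 \<le> V x" for x unfolding V by (rule growth_profile_nonneg[OF g]) simp
  have sublevel: "\<exists>R. \<forall>x. V x \<le> r \<longrightarrow> norm x \<le> R" for r
    using g unfolding growth_profile_def V by (meson norm_ge_zero)
  define G where "G \<xi> = g (c * norm \<xi>)" for \<xi> :: 'a
  have G_meas: "G \<in> borel_measurable borel"
    unfolding G_def[abs_def] by (rule measurable_compose[OF _ g_meas]) measurable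
  have G_nonneg: "0 \<le> G \<xi>" for \<xi> unfolding G_def using c by (intro growth_profile_nonneg[OF g]) simp
  obtain D where D: "0 \<le> D" "\<And>s. 0 \<le> s \<Longrightarrow> g (c * s) \<le> D * exp (t * s\<^sup>2)"
    using g' unfolding growth_profile_def by blast
  have "(\<integral>\<^sup>+\<xi>. ennreal (G \<xi>) \<partial>\<mu>0) \<le> (\<integral>\<^sup>+\<xi>. ennreal D * ennreal (exp (t * (norm \<xi>)\<^sup>2)) \<partial>\<mu>0)"
    using D by (intro nn_integral_mono) (simp add: ennreal_mult[symmetric] G_def ennreal_leI)
  also have "\<dots> = ennreal D * (\<integral>\<^sup>+x. ennreal (exp (t * (norm x)\<^sup>2)) \<partial>\<mu>0)"
    using \<mu>0(2) by (intro nn_integral_cmult) (simp cong: measurable_cong_sets)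
  also have "\<dots> < top" using moment by (simp add: ennreal_mult_less_top)
  finally obtain m where m: "(\<integral>\<^sup>+\<xi>. ennreal (G \<xi>) \<partial>\<mu>0) = ennreal m" by (cases rule: ennreal_cases) auto
  \<comment> \<open>The value \<open>G 0\<close> bounds the contribution of a missing second noise vector.\<close>
  define z where "z = max (G 0) m"
  have G_int: "(\<integral>\<^sup>+\<xi>. ennreal (G \<xi>) \<partial>\<mu>0) \<le> ennreal z" unfolding m z_def by (simp add: ennreal_leI)
  define \<gamma> where "\<gamma> = exp (- 4 * \<bar>M\<bar>) / 2"
  have \<gamma>: "0 < \<gamma>" "\<gamma> \<le> 1"
  proof -
    have "exp (- 4 * \<bar>M\<bar>) \<le> 1" by simp
    moreover have "0 < exp (- 4 * \<bar>M\<bar>)" by simp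
    ultimately show "0 < \<gamma>" "\<gamma> \<le> 1" unfolding \<gamma>_def by linarith+
  qed
  have g1: "0 < \<gamma> * (1 - \<rho>)" "\<gamma> * (1 - \<rho>) \<le> 1" using \<gamma> \<rho> by (auto intro: mult_le_one)
  define b where "b = exp (2 * \<bar>M\<bar>) * (2 * z)"
  have b: "0 \<le> b" using G_nonneg[of 0] by (simp add: b_def z_def le_max_iff_disj)
  let ?coupling = "contracting_coupling V \<epsilon> (1 - \<gamma> * (1 - \<rho>)) b \<gamma> \<rho> (1 - \<gamma> * (1 - \<rho>) / 2)"
  obtain \<eta> :: real and n1 :: nat where \<eta>: "0 < \<eta>" "\<eta> < 1"
    and contr: "\<And>P K s n. ?coupling P K \<Longrightarrow> n1 \<le> n \<Longrightarrow>
      (\<integral>\<^sup>+t. ennreal (dist_eps_V V \<epsilon> (fst t) (snd t)) \<partial>kernel_power K n s)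
        \<le> ennreal (\<eta> ^ n * dist_eps_V V \<epsilon> (fst s) (snd s))"
    by (rule weak_Harris_pointwise[of \<epsilon> "1 - \<gamma> * (1 - \<rho>)" b \<gamma> \<rho> "1 - \<gamma> * (1 - \<rho>) / 2" V])
      (use \<epsilon>(1) g1 \<gamma> \<rho> b sublevel that in auto)
  show ?thesis
  proof (rule that[OF \<eta>, of n1])
    fix \<Phi> :: "'a \<Rightarrow> real" and P \<nu>1 \<nu>2 and p n :: nat
    assume \<Phi>: "\<And>x. \<bar>\<Phi> x\<bar> \<le> M" "L-lipschitz_on UNIV \<Phi>"
      and P: "P = mpCN \<rho> \<mu>0 \<Phi> p \<or> P = MTpCN \<rho> \<mu>0 \<Phi> p" and p: "1 \<le> p" and n: "n1 \<le> n"
    interpret pCN_target \<rho> \<mu>0 \<Phi> "\<bar>M\<bar>" L p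
      by (rule pCN_target.intro[OF \<rho> \<mu>0 order_trans[OF \<Phi>(1) abs_ge_self] \<Phi>(2) p])
    have fc: "move_min = \<gamma>" by (simp add: move_min_def \<gamma>_def)
    have "\<exists>K. ?coupling P K"
      unfolding b_def fc[symmetric]
    proof (rule contracting_coupling_exists[OF V_meas V_nonneg G_meas G_nonneg G_int])
      show "G 0 \<le> z" by (simp add: z_def)
      show "0 < \<epsilon>" by (rule \<epsilon>(1))
      show "16 * L * \<epsilon> \<le> move_min * (1 - \<rho>)" using \<epsilon>(2) L_nonneg by (simp add: fc \<gamma>_def)
      show "P = mpCN \<rho> \<mu>0 \<Phi> p \<or> P = MTpCN \<rho> \<mu>0 \<Phi> p" by (rule P)
      fix x y \<xi> \<xi>' :: 'a assume "norm y \<le> \<rho> * norm x + norm \<xi> + norm \<xi>'"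
      then show "V y \<le> \<rho> * V x + (G \<xi> + G \<xi>')"
        unfolding V G_def c_def using g \<rho> by (intro growth_profile_step) auto
    qed
    then obtain K where K: "?coupling P K" by blast
    interpret K: contracting_coupling V \<epsilon> "1 - \<gamma> * (1 - \<rho>)" b \<gamma> \<rho> "1 - \<gamma> * (1 - \<rho>) / 2" P K
      by (rule K)
    show "wasserstein (dist_eps_V V \<epsilon>) (bind \<nu>1 (kernel_power P n)) (bind \<nu>2 (kernel_power P n))
        \<le> ennreal (\<eta> ^ n) * wasserstein (dist_eps_V V \<epsilon>) \<nu>1 \<nu>2"
      by (rule wasserstein_le_coupling_kernel[OF K.P_kernel K.K_kernel K.K_fst K.K_snd
            K.dist_eps_V_measurable K.dist_eps_V_nonneg _ contr[OF K n]]) (use \<eta> in simp)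
  qed
qed

theorem theorem3p1:
  fixes \<rho> :: real
    and C :: "'a::{real_inner, polish_space} \<Rightarrow> 'a"
    and \<mu>0 :: "'a measure"
  assumes "0 \<le> \<rho>" and "\<rho> < 1"
    and "linear C"
    and "\<And>x y. inner (C x) y = inner x (C y)"
    and "\<And>x. x \<noteq> 0 \<Longrightarrow> 0 < inner (C x) x"
    and "trace_class C"
    and "gaussian_measure 0 C \<mu>0"
  shows "\<exists>v0>0. \<forall>V\<in>lyapunov_functions v0. \<forall>M L :: real.
    \<exists>\<epsilon>s\<in>{0<..<1}. \<forall>\<epsilon>\<in>{0<..<\<epsilon>s}. \<exists>\<kappa>\<in>{0<..<1}. \<exists>n1::nat.
      \<forall>(\<Phi> :: 'a \<Rightarrow> real) (P :: nat \<Rightarrow> 'a \<Rightarrow> 'a measure).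
        bounded (range \<Phi>) \<and> (SUP x. \<bar>\<Phi> x\<bar>) = M \<and> L-lipschitz_on UNIV \<Phi> \<and>
        (\<forall>p\<ge>1. P p = mpCN \<rho> \<mu>0 \<Phi> p \<or> P p = MTpCN \<rho> \<mu>0 \<Phi> p) \<longrightarrow>
        (\<forall>\<nu>1 \<nu>2. prob_space \<nu>1 \<and> sets \<nu>1 = sets borel \<and>
                  prob_space \<nu>2 \<and> sets \<nu>2 = sets borel \<longrightarrow>
          (\<forall>n\<ge>n1.
            (SUP p\<in>{1..}. wasserstein (dist_eps_V V \<epsilon>)
                             (bind \<nu>1 (kernel_power (P p) n)) (bind \<nu>2 (kernel_power (P p) n)))
            \<le> ennreal (\<kappa> ^ n) * wasserstein (dist_eps_V V \<epsilon>) \<nu>1 \<nu>2))"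
proof -
  obtain t where t: "0 < t" and moment: "(\<integral>\<^sup>+x. ennreal (exp (t * (norm x)\<^sup>2)) \<partial>\<mu>0) < top"
    using gaussian_square_exp_moment[OF assms(7,6,4,5)] by blast
  have \<mu>0: "prob_space \<mu>0" "sets \<mu>0 = sets borel" using assms(7) by (auto simp: gaussian_measure_def)
  define c where "c = 2 / (1 - \<rho>)"
  have c: "0 < c" using assms(2) by (simp add: c_def)
  show ?thesis
  proof (intro exI[of _ "t / c\<^sup>2"] conjI ballI allI, goal_cases)
    case 1
    then show ?case using t c by simp
  next
    case (2 V M L)
    obtain g where V: "V = (\<lambda>x. g (norm x))" and g: "growth_profile t (2 / (1 - \<rho>)) g"
      using lyapunov_function_profile[OF 2 t c] c by (auto simp: c_def)
    define \<gamma> where "\<gamma> = exp (- 4 * \<bar>M\<bar>) / 2 * (1 - \<rho>)"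
    have \<gamma>: "0 < \<gamma>" using assms(2) by (simp add: \<gamma>_def)
    \<comment> \<open>The weights have logarithmic Lipschitz constant \<open>4 * L\<close>, and four times it times \<open>\<epsilon>\<close> must not exceed \<open>\<gamma>\<close>.\<close>
    define \<epsilon>s where "\<epsilon>s = min (1 / 2) (\<gamma> / (16 * (\<bar>L\<bar> + 1)))"
    have "\<epsilon>s \<in> {0<..<1}" using \<gamma> by (auto simp: \<epsilon>s_def)
    then show ?case
    proof (rule bexI[rotated], intro ballI, goal_cases)
      case (1 \<epsilon>)
      have "16 * \<bar>L\<bar> * \<epsilon> \<le> 16 * (\<bar>L\<bar> + 1) * (\<gamma> / (16 * (\<bar>L\<bar> + 1)))"
        using 1 by (intro mult_mono) (auto simp: \<epsilon>s_def)
      also have "\<dots> = \<gamma>" by simp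
      finally have \<epsilon>: "16 * \<bar>L\<bar> * \<epsilon> \<le> exp (- 4 * \<bar>M\<bar>) / 2 * (1 - \<rho>)" by (simp only: \<gamma>_def)
      have "0 < \<epsilon>" using 1 by simp
      from uniform_Wasserstein_contraction[OF assms(1,2) \<mu>0 V g moment this \<epsilon>]
      obtain \<eta> :: real and n1 :: nat where \<eta>: "0 < \<eta>" "\<eta> < 1" and contraction:
        "\<And>\<Phi> P p \<nu>1 \<nu>2 n. (\<And>x. \<bar>\<Phi> x\<bar> \<le> M) \<Longrightarrow> L-lipschitz_on UNIV \<Phi> \<Longrightarrow> P = mpCN \<rho> \<mu>0 \<Phi> p \<or> P = MTpCN \<rho> \<mu>0 \<Phi> p \<Longrightarrow>
          1 \<le> p \<Longrightarrow> n1 \<le> n \<Longrightarrow> wasserstein (dist_eps_V V \<epsilon>) (bind \<nu>1 (kernel_power P n)) (bind \<nu>2 (kernel_power P n))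
            \<le> ennreal (\<eta> ^ n) * wasserstein (dist_eps_V V \<epsilon>) \<nu>1 \<nu>2"
        by metis
      have "\<eta> \<in> {0<..<1}" using \<eta> by simp
      then show ?case
      proof (rule bexI[rotated], intro exI[of _ n1] allI impI SUP_least, goal_cases)
        case (1 \<Phi> P \<nu>1 \<nu>2 n p)
        then have \<Phi>: "bounded (range \<Phi>)" "(SUP x. \<bar>\<Phi> x\<bar>) = M" by auto
        obtain a where a: "\<And>x. \<bar>\<Phi> x\<bar> \<le> a" using \<Phi>(1) by (auto simp: bounded_iff)
        have "bdd_above (range (\<lambda>x. \<bar>\<Phi> x\<bar>))" using a by (rule bdd_aboveI2)
        then have "\<bar>\<Phi> x\<bar> \<le> M" for x unfolding \<Phi>(2)[symmetric] by (rule cSUP_upper[OF UNIV_I])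
        then show ?case by (rule contraction[where \<Phi> = \<Phi> and p = p]) (use 1 in auto)
      qed
    qed
  qed
qed

end
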